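(* Let $f:S\to S$ be a generalized pseudo-Anosov homeomorphism and let $n(f)$ be its compatibility order. For every integer $n>n(f)$, the set $\mathcal T(f,n)=\{T(f,\mathcal R):\mathcal R\in\mathcal M(f,n)\}$ of geometric types of primitive geometric Markov partitions of $f$ of order $n$ is finite.
   Context: $S$ is a closed oriented surface. A generalized pseudo-Anosov homeomorphism is an orientation-preserving homeomorphism $f:S\to S$ for which there are measured foliations $(\mathcal F^s,\mu^s)$, $(\mathcal F^u,\mu^u)$ (singular foliations with finitely many $k$-prong singularities, $k=1$ or $k\ge3$, with transverse measures that are non-atomic, absolutely continuous with respect to Lebesgue, positive on non-degenerate transverse arcs and invariant under leaf-preserving isotopy) with the same singularities and numbers of prongs, topologically transverse elsewhere, each preserved by $f$, and $\lambda>1$ with $\mu^s(f(J))=\lambda\mu^s(J)$ for unstable arcs $J$ and $\mu^u(f(I))=\lambda^{-1}\mu^u(I)$ for stable arcs $I$. $\mathbf{Sing}(f)$ is the set of singularities; if there are none, it denotes a fixed non-empty finite $f$-invariant set of periodic points. A separatrix of $x$ is a component of (leaf of $x$)$\setminus\{x\}$. Rectangles. A connected open $D\subset S$ is trivially bi-foliated if for each $x\in D$ the component $\overset{o}{I_x}$ of (stable leaf of $x$)$\cap D$ through $x$ and the analogous unstable component $\overset{o}{J_x}$ are open arcs, with $|\overset{o}{I_x}\cap\overset{o}{J_y}|=1$ for all $x,y\in D$. A rectangle is $R=\overline D$, with interior $\overset{o}{R}=D$; it has a continuous parametrization $[0,1]^2\to R$ that is an orientation-preserving homeomorphism $(0,1)^2\to\overset{o}{R}$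 and sends horizontal (vertical) segments into stable (unstable) leaves; the images of the horizontal (vertical) sides form $\partial^sR$ ($\partial^uR$). Horizontal (vertical) sub-rectangles of $R$ are rectangles contained in $R$ whose horizontal (vertical) leaves coincide with those of $R$. Markov partition of $f$: a finite labelled family of rectangles $\{R_i\}_{i=1}^n$ with union $S$, pairwise disjoint interiors, such that the closures of the components of $\overset{o}{R_i}\cap f^{-1}(\overset{o}{R_j})$ are horizontal sub-rectangles of $R_i$ and those of $f(\overset{o}{R_i})\cap\overset{o}{R_j}$ are vertical sub-rectangles of $R_j$. A geometric Markov partition is one with a chosen vertical direction (orientation of the vertical leaves) in each rectangle; horizontal leaves get the direction making (horizontal, vertical) agree with the orientation of $S$. The horizontal sub-rectangles above contained in $R_i$ are labelled $H^i_1,\dots,H^i_{h_i}$ from bottom to top, the vertical ones in $R_k$ are labelled $V^k_1,\dots,V^k_{v_k}$ from left to right. The geometric type is $T(f,\mathcal R)=(n,\{(h_i,v_i)\}_{i=1}^n,\rho,\epsilon)$ with $\rho(i,j)=(k,l)$ iff $f(H^i_j)=V^k_l$, and $\epsilon(i,j)=1$ if $f$ maps the vertical direction of $H^i_j$ to that of $V^k_l$, $-1$ otherwise. Graphs. An $s$-graph adapted to $f$ is a finite family $\delta^s$ of non-degenerate compact stable intervals such that $\bigcup\delta^s$ is $f$-invariant; each interval lies in the stable leaf of a point of $\mathbf{Sing}(f)$; each stable separatrix of each $p\in\mathbf{Sing}(f)$ carries an interval of $\delta^s$ with endpoint $p$; and all endpoints lie in unstable leaves of points of $\mathbf{Sing}(f)$.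 $u$-graphs are symmetric, with $f^{-1}$-invariant union. $\overset{o}{\delta^s}$ is $\bigcup\delta^s$ minus all endpoints of its intervals. A regular $u$-rail of $\delta^s$ is an unstable interval with interior disjoint from $\bigcup\delta^s$ and endpoints in $\overset{o}{\delta^s}$; an extreme $u$-rail is an unstable segment $J$ with at least one endpoint not in $\overset{o}{\delta^s}$ that is one component of $\partial^uR$ for an embedded rectangle $R$ with $\partial^sR\subset\bigcup\delta^s$ all of whose other vertical leaves are regular $u$-rails. Extreme $s$-rails of $\delta^u$ are symmetric. $\delta^s,\delta^u$ are compatible if the endpoints of each lie in the union of the other, the extreme $u$-rails of $\delta^s$ are contained in $\bigcup\delta^u$, and the extreme $s$-rails of $\delta^u$ are contained in $\bigcup\delta^s$. First intersection points. Given $p,q\in\mathbf{Sing}(f)$, a stable separatrix $F^s(p)$ of $p$ and an unstable separatrix $F^u(q)$ of $q$, a point $z\in F^s(p)\cap F^u(q)\setminus\mathbf{Sing}(f)$ is a first intersection point of $f$ if $(p,z]^s\cap(q,z]^u=\{z\}$, where $[p,z]^s$, $[q,z]^u$ are the stable and unstable segments joining $p$, resp. $q$, to $z$. For such $z$ put $\mathcal J^u(z)=\bigcup_{i\ge0}f^{-i}([q,z]^u)$; let $\delta^s(z)$ be the family of all non-degenerate stable segments with one endpoint in $\mathbf{Sing}(f)$, the other endpoint in $\mathcal J^u(z)$ and interior disjoint from $\mathcal J^u(z)$; let $\delta^u(z)$ be the family of all non-degenerate unstable segments with one endpoint in $\mathbf{Sing}(f)$, the other in $\bigcup\delta^s(z)$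 and interior disjoint from $\bigcup\delta^s(z)$. These are adapted graphs. Let $n(z)$ be the least $N\in\mathbb N$ such that $\delta^s(z)$ and $f^m(\delta^u(z))$ are compatible for all $m\ge N$ (it exists). For $n\ge n(z)$, $\mathcal R(z,n)$ is the Markov partition of $f$ formed by the closures of the components of $S\setminus(\bigcup\delta^s(z)\cup\bigcup f^n(\delta^u(z)))$. The compatibility order $n(f)$ is the maximum of $n(z)$ over all first intersection points $z$ of $f$ (it is finite). For $n\ge n(f)$, $\mathcal M(f,n)$ is the set of all Markov partitions $\mathcal R(z,n)$, $z$ a first intersection point of $f$, made geometric by a labelling of the rectangles and a choice of vertical directions. *)

theory Defs
  imports "HOL-Complex_Analysis.Complex_Analysis"
begin

section \<open>Oriented smooth surfaces\<close>

fun times_differentiable_on :: "nat \<Rightarrow> complex set \<Rightarrow> (complex \<Rightarrow> complex) \<Rightarrow> bool" where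
  "times_differentiable_on 0 U h \<longleftrightarrow> continuous_on U h"
| "times_differentiable_on (Suc m) U h \<longleftrightarrow>
     (\<exists>hx hy. (\<forall>z\<in>U. (h has_derivative (\<lambda>v. Re v *\<^sub>R hx z + Im v *\<^sub>R hy z)) (at z)) \<and>
        times_differentiable_on m U hx \<and> times_differentiable_on m U hy)"

(* Real smoothness, not holomorphy.  The last conjunct is positivity of the real Jacobian
   determinant: for a, b in the plane, Im (cnj a * b) is the determinant with columns a, b. *)
definition smooth_positive_on :: "complex set \<Rightarrow> (complex \<Rightarrow> complex) \<Rightarrow> bool" where
  "smooth_positive_on U h \<longleftrightarrow>
     (\<forall>m. times_differentiable_on m U h) \<and>
     (\<forall>z\<in>U. \<forall>D. (h has_derivative D) (at z) \<longrightarrow> Im (cnj (D 1) * D \<i>) > 0)"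

type_synonym 'a atlas = "('a set \<times> ('a \<Rightarrow> complex)) set"

(* The surface is the whole type 'a; the atlas carries its smooth structure and orientation. *)
definition closed_oriented_surface :: "('a::t2_space) atlas \<Rightarrow> bool" where
  "closed_oriented_surface A \<longleftrightarrow>
     compact (UNIV :: 'a set) \<and> connected (UNIV :: 'a set) \<and>
     (\<Union>(U, \<phi>)\<in>A. U) = UNIV \<and>
     (\<forall>(U, \<phi>)\<in>A. open U \<and> open (\<phi> ` U) \<and> homeomorphism U (\<phi> ` U) \<phi> (inv_into U \<phi>)) \<and>
     (\<forall>(U, \<phi>)\<in>A. \<forall>(V, \<psi>)\<in>A. smooth_positive_on (\<phi> ` (U \<inter> V)) (\<psi> \<circ> inv_into U \<phi>))"

(* Local degree one, for h a homeomorphism from a neighbourhood of z onto an open set. *)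
definition orientation_preserving_at :: "(complex \<Rightarrow> complex) \<Rightarrow> complex \<Rightarrow> bool" where
  "orientation_preserving_at h z \<longleftrightarrow>
     (\<forall>\<^sub>F e in at_right 0. winding_number (h \<circ> circlepath z e) (h z) = 1)"

definition orientation_preserving_homeo :: "('a::t2_space) atlas \<Rightarrow> ('a \<Rightarrow> 'a) \<Rightarrow> bool" where
  "orientation_preserving_homeo A f \<longleftrightarrow>
     homeomorphism UNIV UNIV f (inv f) \<and>
     (\<forall>(U, \<phi>)\<in>A. \<forall>(V, \<psi>)\<in>A. \<forall>x\<in>U. f x \<in> V \<longrightarrow>
        orientation_preserving_at (\<psi> \<circ> f \<circ> inv_into U \<phi>) (\<phi> x))"

section \<open>Singular foliations\<close>

text \<open>A foliation is given by its set of leaves.  A leaf through a singularity contains all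
  prongs of that singularity.  In a foliated chart the path components of a leaf are the
  plaques, so paths inside a leaf are continuous for the leaf topology, and
  path components below are components in the leaf topology.\<close>

definition leaf :: "'a set set \<Rightarrow> 'a \<Rightarrow> 'a set" where
  "leaf F x = \<Union>{L \<in> F. x \<in> L}"

definition plaque :: "('a::topological_space) set set \<Rightarrow> 'a set \<Rightarrow> 'a \<Rightarrow> 'a set" where
  "plaque F D x = path_component_set (leaf F x \<inter> D) x"

(* Plaques of the horizontal foliation of the quadratic differential z^(k-2) dz^2.  These are
   locally the level curves of Im w, w = z^(k/2), and |z|^k - Re (z^k) = 2 (Im w)^2 is single
   valued.  For k = 2 they are the horizontal chords of the disc; in general the plaque of 0
   is the union of k radii. *)
definition prong_plaque :: "nat \<Rightarrow> complex \<Rightarrow> complex set" where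
  "prong_plaque k z =
     connected_component_set
       {w \<in> ball 0 1. norm w ^ k - Re (w ^ k) = norm z ^ k - Re (z ^ k)} z"

definition foliated_chart ::
    "('a::topological_space) set set \<Rightarrow> nat \<Rightarrow> 'a \<Rightarrow> 'a set \<Rightarrow> ('a \<Rightarrow> complex) \<Rightarrow> bool" where
  "foliated_chart F k x U \<phi> \<longleftrightarrow>
     open U \<and> x \<in> U \<and> \<phi> x = 0 \<and> homeomorphism U (ball 0 1) \<phi> (inv_into U \<phi>) \<and>
     (\<forall>y\<in>U. plaque F U y = {w \<in> U. \<phi> w \<in> prong_plaque k (\<phi> y)})"

definition prongs :: "('a::topological_space) set set \<Rightarrow> 'a \<Rightarrow> nat \<Rightarrow> bool" where
  "prongs F x k \<longleftrightarrow> k \<ge> 1 \<and> (\<exists>U \<phi>. foliated_chart F k x U \<phi>)"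

definition singularities :: "('a::topological_space) set set \<Rightarrow> 'a set" where
  "singularities F = {x. \<not> prongs F x 2}"

definition singular_foliation :: "('a::topological_space) set set \<Rightarrow> bool" where
  "singular_foliation F \<longleftrightarrow>
     partition_on UNIV F \<and> (\<forall>L\<in>F. path_connected L) \<and>
     (\<forall>x. \<exists>k. prongs F x k) \<and> finite (singularities F)"

(* Rotation by a right angle turns the vertical chords of the disc into the horizontal ones,
   so phi is a chart in which the leaves of F are horizontal and those of G are vertical. *)
definition transverse_foliations ::
    "('a::topological_space) set set \<Rightarrow> 'a set set \<Rightarrow> bool" where
  "transverse_foliations F G \<longleftrightarrow>
     (\<forall>x k. prongs F x k \<longleftrightarrow> prongs G x k) \<and>
     (\<forall>x. x \<notin> singularities F \<longrightarrow>
        (\<exists>U \<phi>. foliated_chart F 2 x U \<phi> \<and> foliated_chart G 2 x U (\<lambda>y. \<i> * \<phi> y)))"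

definition separatrices :: "('a::topological_space) set set \<Rightarrow> 'a \<Rightarrow> 'a set set" where
  "separatrices F x = path_component_set (leaf F x - {x}) ` (leaf F x - {x})"

definition leaf_interval :: "('a::topological_space) set set \<Rightarrow> 'a set \<Rightarrow> bool" where
  "leaf_interval F I \<longleftrightarrow> (\<exists>g. arc g \<and> path_image g = I \<and> (\<exists>L\<in>F. I \<subseteq> L))"

definition endpoints :: "('a::topological_space) set \<Rightarrow> 'a set" where
  "endpoints I = {pathstart g | g. arc g \<and> path_image g = I}"

(* The arc is unique in a leaf containing neither a closed curve nor two singularities,
   as is the case for the leaves of a generalized pseudo-Anosov homeomorphism. *)
definition leaf_segment :: "('a::topological_space) set set \<Rightarrow> 'a \<Rightarrow> 'a \<Rightarrow> 'a set" where
  "leaf_segment F p z =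
     (THE I. \<exists>g. arc g \<and> path_image g = I \<and> pathstart g = p \<and> pathfinish g = z \<and> I \<subseteq> leaf F p)"

section \<open>Transverse measures\<close>

definition transverse_arc :: "('a::topological_space) set set \<Rightarrow> (real \<Rightarrow> 'a) \<Rightarrow> bool" where
  "transverse_arc F g \<longleftrightarrow>
     arc g \<and> path_image g \<inter> singularities F = {} \<and>
     (\<forall>t\<in>{0..1}. \<exists>U \<phi> e. foliated_chart F 2 (g t) U \<phi> \<and> e > 0 \<and>
        g ` ({0..1} \<inter> ball t e) \<subseteq> U \<and>
        (strict_mono_on ({0..1} \<inter> ball t e) (\<lambda>s. Im (\<phi> (g s))) \<or>
         strict_mono_on ({0..1} \<inter> ball t e) (\<lambda>s. - Im (\<phi> (g s)))))"

(* Lebesgue null sets of an arc are meaningful when the arc is a regular C^1 curve. *)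
definition regular_C1_curve :: "('a::topological_space) atlas \<Rightarrow> (real \<Rightarrow> 'a) \<Rightarrow> bool" where
  "regular_C1_curve A g \<longleftrightarrow>
     (\<forall>(U, \<phi>)\<in>A. \<exists>D. continuous_on ({0..1} \<inter> g -` U) D \<and>
        (\<forall>t\<in>{0..1} \<inter> g -` U. D t \<noteq> 0 \<and>
           ((\<phi> \<circ> g) has_vector_derivative D t) (at t within {0..1})))"

definition leaf_preserving_isotopy ::
    "('a::topological_space) set set \<Rightarrow> (real \<Rightarrow> real \<Rightarrow> 'a) \<Rightarrow> bool" where
  "leaf_preserving_isotopy F H \<longleftrightarrow>
     continuous_on ({0..1} \<times> {0..1}) (\<lambda>(s, t). H s t) \<and>
     (\<forall>s\<in>{0..1}. transverse_arc F (H s)) \<and>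
     (\<forall>t\<in>{0..1}. \<exists>L\<in>F. \<forall>s\<in>{0..1}. H s t \<in> L)"

(* One set function mu restricts to a finite Borel measure on every transverse arc; only its
   values on Borel subsets of transverse arcs matter. *)
definition measured_foliation ::
    "('a::t2_space) atlas \<Rightarrow> 'a set set \<Rightarrow> ('a set \<Rightarrow> ennreal) \<Rightarrow> bool" where
  "measured_foliation A F \<mu> \<longleftrightarrow>
     singular_foliation F \<and>
     (\<forall>g. transverse_arc F g \<longrightarrow>
        measure_space (path_image g) (sets (restrict_space borel (path_image g))) \<mu> \<and>
        \<mu> (path_image g) < \<infinity> \<and>
        (\<forall>x\<in>path_image g. \<mu> {x} = 0) \<and>
        (regular_C1_curve A g \<longrightarrow>
           (\<forall>N \<in> null_sets lborel. N \<subseteq> {0..1} \<longrightarrow> \<mu> (g ` N) = 0)) \<and>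
        \<mu> (path_image g) > 0) \<and>
     (\<forall>H. leaf_preserving_isotopy F H \<longrightarrow> \<mu> (path_image (H 0)) = \<mu> (path_image (H 1)))"

section \<open>Generalized pseudo-Anosov homeomorphisms\<close>

definition generalized_pseudo_Anosov ::
    "('a::t2_space) atlas \<Rightarrow> ('a \<Rightarrow> 'a) \<Rightarrow> 'a set set \<Rightarrow> 'a set set \<Rightarrow> bool" where
  "generalized_pseudo_Anosov A f Fs Fu \<longleftrightarrow>
     orientation_preserving_homeo A f \<and>
     (\<exists>\<mu>s \<mu>u. \<exists>stretch::real.
        measured_foliation A Fs \<mu>s \<and> measured_foliation A Fu \<mu>u \<and>
        transverse_foliations Fs Fu \<and>
        (`) f ` Fs = Fs \<and> (`) f ` Fu = Fu \<and> stretch > 1 \<and>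
        (\<forall>J. leaf_interval Fu J \<and> J \<inter> singularities Fu = {} \<longrightarrow>
           \<mu>s (f ` J) = ennreal stretch * \<mu>s J) \<and>
        (\<forall>I. leaf_interval Fs I \<and> I \<inter> singularities Fs = {} \<longrightarrow>
           \<mu>u (f ` I) = ennreal (inverse stretch) * \<mu>u I))"

(* P is the set denoted Sing(f). *)
definition Sing_set :: "('a::t2_space \<Rightarrow> 'a) \<Rightarrow> 'a set set \<Rightarrow> 'a set \<Rightarrow> bool" where
  "Sing_set f Fs P \<longleftrightarrow>
     (if singularities Fs \<noteq> {} then P = singularities Fs
      else P \<noteq> {} \<and> finite P \<and> f ` P = P \<and> (\<forall>x\<in>P. \<exists>m>0. (f ^^ m) x = x))"

section \<open>Rectangles\<close>

text \<open>A rectangle is represented by its interior \<open>D\<close>, the rectangle itself being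
  \<open>closure D\<close>.  Boundary sides of a rectangle may be identified with each other in the surface,
  in which case \<open>D\<close> can be smaller than the topological interior of \<open>closure D\<close>.\<close>

context
  fixes A :: "('a::t2_space) atlas" and f :: "'a \<Rightarrow> 'a"
    and Fs Fu :: "'a set set" and P :: "'a set"
begin

definition rectangle :: "'a set \<Rightarrow> bool" where
  "rectangle D \<longleftrightarrow>
     D \<noteq> {} \<and> open D \<and> connected D \<and>
     (\<forall>x\<in>D. plaque Fs D x homeomorphic (UNIV :: real set) \<and>
            plaque Fu D x homeomorphic (UNIV :: real set)) \<and>
     (\<forall>x\<in>D. \<forall>y\<in>D. \<exists>!w. w \<in> plaque Fs D x \<inter> plaque Fu D y)"

definition parametrization :: "'a set \<Rightarrow> (complex \<Rightarrow> 'a) \<Rightarrow> bool" where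
  "parametrization D r \<longleftrightarrow>
     continuous_on (cbox 0 (1 + \<i>)) r \<and> r ` cbox 0 (1 + \<i>) = closure D \<and>
     homeomorphism (box 0 (1 + \<i>)) D r (inv_into (box 0 (1 + \<i>)) r) \<and>
     (\<forall>z \<in> box 0 (1 + \<i>). \<forall>(U, \<phi>)\<in>A. r z \<in> U \<longrightarrow> orientation_preserving_at (\<phi> \<circ> r) z) \<and>
     (\<forall>y\<in>{0..1}. \<exists>L\<in>Fs. (\<lambda>x. r (Complex x y)) ` {0..1} \<subseteq> L) \<and>
     (\<forall>x\<in>{0..1}. \<exists>L\<in>Fu. (\<lambda>y. r (Complex x y)) ` {0..1} \<subseteq> L)"

text \<open>The orientation of the vertical leaves of a rectangle is encoded as the set of pairs
  \<open>(a, b)\<close> such that \<open>a\<close> and \<open>b\<close> are interior points on one vertical leaf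
  and \<open>a\<close> precedes \<open>b\<close>; likewise for the horizontal leaves.\<close>

definition upward :: "(complex \<Rightarrow> 'a) \<Rightarrow> ('a \<times> 'a) set" where
  "upward r = {(r (Complex x y), r (Complex x y')) | x y y'. 0 < x \<and> x < 1 \<and> 0 < y \<and> y < y' \<and> y' < 1}"

definition rightward :: "(complex \<Rightarrow> 'a) \<Rightarrow> ('a \<times> 'a) set" where
  "rightward r = {(r (Complex x y), r (Complex x' y)) | x x' y. 0 < x \<and> x < x' \<and> x' < 1 \<and> 0 < y \<and> y < 1}"

definition vertical_direction :: "'a set \<Rightarrow> ('a \<times> 'a) set \<Rightarrow> bool" where
  "vertical_direction D d \<longleftrightarrow> (\<exists>r. parametrization D r \<and> d = upward r)"

(* All parametrizations preserve orientation, so those inducing the vertical direction d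
   induce one and the same horizontal direction. *)
definition horizontal_direction :: "'a set \<Rightarrow> ('a \<times> 'a) set \<Rightarrow> ('a \<times> 'a) set" where
  "horizontal_direction D d = \<Union>{rightward r | r. parametrization D r \<and> upward r = d}"

definition horizontal_subrectangle :: "'a set \<Rightarrow> 'a set \<Rightarrow> bool" where
  "horizontal_subrectangle C D \<longleftrightarrow>
     rectangle C \<and> C \<subseteq> D \<and> (\<forall>x\<in>C. plaque Fs C x = plaque Fs D x)"

definition vertical_subrectangle :: "'a set \<Rightarrow> 'a set \<Rightarrow> bool" where
  "vertical_subrectangle C D \<longleftrightarrow>
     rectangle C \<and> C \<subseteq> D \<and> (\<forall>x\<in>C. plaque Fu C x = plaque Fu D x)"

section \<open>Markov partitions and geometric types\<close>

definition markov_partition :: "nat \<Rightarrow> (nat \<Rightarrow> 'a set) \<Rightarrow> bool" where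
  "markov_partition n D \<longleftrightarrow>
     (\<forall>i\<in>{1..n}. rectangle (D i)) \<and>
     (\<Union>i\<in>{1..n}. closure (D i)) = UNIV \<and>
     (\<forall>i\<in>{1..n}. \<forall>j\<in>{1..n}. i \<noteq> j \<longrightarrow> D i \<inter> D j = {}) \<and>
     (\<forall>i\<in>{1..n}. \<forall>j\<in>{1..n}.
        (\<forall>C\<in>components (D i \<inter> f -` D j). horizontal_subrectangle C (D i)) \<and>
        (\<forall>C\<in>components (f ` D i \<inter> D j). vertical_subrectangle C (D j)))"

definition geometric_markov_partition ::
    "nat \<times> (nat \<Rightarrow> 'a set) \<times> (nat \<Rightarrow> ('a \<times> 'a) set) \<Rightarrow> bool" where
  "geometric_markov_partition = (\<lambda>(n, D, d).
     markov_partition n D \<and> (\<forall>i\<in>{1..n}. vertical_direction (D i) (d i)))"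

definition H_rects :: "nat \<Rightarrow> (nat \<Rightarrow> 'a set) \<Rightarrow> nat \<Rightarrow> 'a set set" where
  "H_rects n D i = (\<Union>j\<in>{1..n}. components (D i \<inter> f -` D j))"

definition V_rects :: "nat \<Rightarrow> (nat \<Rightarrow> 'a set) \<Rightarrow> nat \<Rightarrow> 'a set set" where
  "V_rects n D k = (\<Union>i\<in>{1..n}. components (f ` D i \<inter> D k))"

(* For pairwise disjoint strips X of a rectangle directed by d: the strips containing a point
   that precedes a point of C are C itself (C is open) and those before C, so that the first
   strip gets number 1. *)
definition nth_strip :: "('a \<times> 'a) set \<Rightarrow> 'a set set \<Rightarrow> nat \<Rightarrow> 'a set" where
  "nth_strip d X m = (THE C. C \<in> X \<and> card {C'\<in>X. \<exists>x\<in>C'. \<exists>y\<in>C. (x, y) \<in> d} = m)"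

definition H_rect ::
    "nat \<times> (nat \<Rightarrow> 'a set) \<times> (nat \<Rightarrow> ('a \<times> 'a) set) \<Rightarrow> nat \<Rightarrow> nat \<Rightarrow> 'a set" where
  "H_rect = (\<lambda>(n, D, d) i j. nth_strip (d i) (H_rects n D i) j)"

definition V_rect ::
    "nat \<times> (nat \<Rightarrow> 'a set) \<times> (nat \<Rightarrow> ('a \<times> 'a) set) \<Rightarrow> nat \<Rightarrow> nat \<Rightarrow> 'a set" where
  "V_rect = (\<lambda>(n, D, d) k l. nth_strip (horizontal_direction (D k) (d k)) (V_rects n D k) l)"

(* (n, [(h_1, v_1), ..., (h_n, v_n)], rho, epsilon), where rho and epsilon are defined exactly
   on the pairs (i, j) with 1 <= i <= n and 1 <= j <= h_i. *)
definition geometric_type ::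
    "nat \<times> (nat \<Rightarrow> 'a set) \<times> (nat \<Rightarrow> ('a \<times> 'a) set) \<Rightarrow>
     nat \<times> (nat \<times> nat) list \<times> (nat \<times> nat \<rightharpoonup> nat \<times> nat) \<times> (nat \<times> nat \<rightharpoonup> int)" where
  "geometric_type R =
     (case R of (n, D, d) \<Rightarrow>
      let h = (\<lambda>i. card (H_rects n D i));
          v = (\<lambda>k. card (V_rects n D k));
          \<rho> = (\<lambda>(i, j). THE (k, l).
                 k \<in> {1..n} \<and> l \<in> {1..v k} \<and> f ` H_rect R i j = V_rect R k l);
          \<epsilon> = (\<lambda>(i, j).
                 if \<forall>x\<in>H_rect R i j. \<forall>y\<in>H_rect R i j.
                      (x, y) \<in> d i \<longrightarrow> (f x, f y) \<in> d (fst (\<rho> (i, j)))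
                 then 1 else - 1)
      in (n, map (\<lambda>i. (h i, v i)) [1..<Suc n],
          (Some \<circ> \<rho>) |` (SIGMA i:{1..n}. {1..h i}),
          (Some \<circ> \<epsilon>) |` (SIGMA i:{1..n}. {1..h i})))"

section \<open>Graphs and compatibility\<close>

(* An s-graph for F = Fs, G = Fu, g = f; a u-graph for F = Fu, G = Fs, g = inv f. *)
definition adapted_graph :: "'a set set \<Rightarrow> 'a set set \<Rightarrow> ('a \<Rightarrow> 'a) \<Rightarrow> 'a set set \<Rightarrow> bool" where
  "adapted_graph F G g \<delta> \<longleftrightarrow>
     finite \<delta> \<and> (\<forall>I\<in>\<delta>. leaf_interval F I) \<and>
     g ` \<Union>\<delta> \<subseteq> \<Union>\<delta> \<and>
     (\<forall>I\<in>\<delta>. \<exists>p\<in>P. I \<subseteq> leaf F p) \<and>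
     (\<forall>p\<in>P. \<forall>E\<in>separatrices F p. \<exists>I\<in>\<delta>. p \<in> endpoints I \<and> I \<subseteq> insert p E) \<and>
     (\<forall>I\<in>\<delta>. endpoints I \<subseteq> (\<Union>p\<in>P. leaf G p))"

definition graph_interior :: "'a set set \<Rightarrow> 'a set" where
  "graph_interior \<delta> = \<Union>\<delta> - (\<Union>I\<in>\<delta>. endpoints I)"

(* A regular u-rail of an s-graph for F = Fu, a regular s-rail of a u-graph for F = Fs. *)
definition regular_rail :: "'a set set \<Rightarrow> 'a set set \<Rightarrow> 'a set \<Rightarrow> bool" where
  "regular_rail F \<delta> J \<longleftrightarrow>
     leaf_interval F J \<and> (J - endpoints J) \<inter> \<Union>\<delta> = {} \<and> endpoints J \<subseteq> graph_interior \<delta>"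

definition extreme_u_rail :: "'a set set \<Rightarrow> 'a set \<Rightarrow> bool" where
  "extreme_u_rail \<delta>s J \<longleftrightarrow>
     leaf_interval Fu J \<and> \<not> endpoints J \<subseteq> graph_interior \<delta>s \<and>
     (\<exists>D r. rectangle D \<and> parametrization D r \<and> inj_on r (cbox 0 (1 + \<i>)) \<and>
        (\<forall>y\<in>{0, 1}. (\<lambda>x. r (Complex x y)) ` {0..1} \<subseteq> \<Union>\<delta>s) \<and>
        (\<exists>x\<^sub>0\<in>{0, 1}. J = (\<lambda>y. r (Complex x\<^sub>0 y)) ` {0..1} \<and>
           (\<forall>x\<in>{0..1} - {x\<^sub>0}. regular_rail Fu \<delta>s ((\<lambda>y. r (Complex x y)) ` {0..1}))))"

definition extreme_s_rail :: "'a set set \<Rightarrow> 'a set \<Rightarrow> bool" where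
  "extreme_s_rail \<delta>u I \<longleftrightarrow>
     leaf_interval Fs I \<and> \<not> endpoints I \<subseteq> graph_interior \<delta>u \<and>
     (\<exists>D r. rectangle D \<and> parametrization D r \<and> inj_on r (cbox 0 (1 + \<i>)) \<and>
        (\<forall>x\<in>{0, 1}. (\<lambda>y. r (Complex x y)) ` {0..1} \<subseteq> \<Union>\<delta>u) \<and>
        (\<exists>y\<^sub>0\<in>{0, 1}. I = (\<lambda>x. r (Complex x y\<^sub>0)) ` {0..1} \<and>
           (\<forall>y\<in>{0..1} - {y\<^sub>0}. regular_rail Fs \<delta>u ((\<lambda>x. r (Complex x y)) ` {0..1}))))"

definition compatible :: "'a set set \<Rightarrow> 'a set set \<Rightarrow> bool" where
  "compatible \<delta>s \<delta>u \<longleftrightarrow>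
     adapted_graph Fs Fu f \<delta>s \<and> adapted_graph Fu Fs (inv f) \<delta>u \<and>
     (\<forall>I\<in>\<delta>s. endpoints I \<subseteq> \<Union>\<delta>u) \<and> (\<forall>J\<in>\<delta>u. endpoints J \<subseteq> \<Union>\<delta>s) \<and>
     (\<forall>J. extreme_u_rail \<delta>s J \<longrightarrow> J \<subseteq> \<Union>\<delta>u) \<and>
     (\<forall>I. extreme_s_rail \<delta>u I \<longrightarrow> I \<subseteq> \<Union>\<delta>s)"

section \<open>First intersection points and primitive Markov partitions\<close>

text \<open>An unstable leaf contains at most one point of \<open>P\<close>, so the point \<open>q\<close> below is
  determined by \<open>z\<close>; it is carried along as an explicit argument.\<close>

definition first_intersection_point :: "'a \<Rightarrow> 'a \<Rightarrow> 'a \<Rightarrow> bool" where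
  "first_intersection_point p q z \<longleftrightarrow>
     p \<in> P \<and> q \<in> P \<and> z \<notin> P \<and>
     (\<exists>E\<in>separatrices Fs p. \<exists>E'\<in>separatrices Fu q. z \<in> E \<inter> E') \<and>
     (leaf_segment Fs p z - {p}) \<inter> (leaf_segment Fu q z - {q}) = {z}"

definition J_u :: "'a \<Rightarrow> 'a \<Rightarrow> 'a set" where
  "J_u q z = (\<Union>i. (f ^^ i) -` leaf_segment Fu q z)"

(* The non-degenerate F-segments from a point of P to a point of K with interior disjoint
   from K. *)
definition segments_to :: "'a set set \<Rightarrow> 'a set \<Rightarrow> 'a set set" where
  "segments_to F K =
     {I. leaf_interval F I \<and>
        (\<exists>p\<in>P. \<exists>y\<in>K. p \<noteq> y \<and> endpoints I = {p, y}) \<and> (I - endpoints I) \<inter> K = {}}"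

definition delta_s :: "'a \<Rightarrow> 'a \<Rightarrow> 'a set set" where
  "delta_s q z = segments_to Fs (J_u q z)"

definition delta_u :: "'a \<Rightarrow> 'a \<Rightarrow> 'a set set" where
  "delta_u q z = segments_to Fu (\<Union>(delta_s q z))"

definition iterate_graph :: "nat \<Rightarrow> 'a set set \<Rightarrow> 'a set set" where
  "iterate_graph m \<delta> = (`) (f ^^ m) ` \<delta>"

definition compatibility_index :: "'a \<Rightarrow> 'a \<Rightarrow> nat" where
  "compatibility_index q z =
     (LEAST N. \<forall>m\<ge>N. compatible (delta_s q z) (iterate_graph m (delta_u q z)))"

definition compatibility_order :: nat where
  "compatibility_order = Max {compatibility_index q z | p q z. first_intersection_point p q z}"

definition primitive_partitions ::
    "nat \<Rightarrow> (nat \<times> (nat \<Rightarrow> 'a set) \<times> (nat \<Rightarrow> ('a \<times> 'a) set)) set" where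
  "primitive_partitions n =
     {(N, D, d). geometric_markov_partition (N, D, d) \<and>
        (\<exists>p q z. first_intersection_point p q z \<and>
           bij_betw D {1..N}
             (components (UNIV - (\<Union>(delta_s q z) \<union> \<Union>(iterate_graph n (delta_u q z))))))}"

definition primitive_types ::
    "nat \<Rightarrow> (nat \<times> (nat \<times> nat) list \<times> (nat \<times> nat \<rightharpoonup> nat \<times> nat) \<times> (nat \<times> nat \<rightharpoonup> int)) set" where
  "primitive_types n = geometric_type ` primitive_partitions n"

end

end

theory Submission
  imports Defs
begin

text \<open>
  A geometric type consists of the number of rectangles, the numbers of horizontal and vertical
  strips in each rectangle, and two functions on finite index sets bounded by these numbers.  So
  finiteness follows once these counts are bounded uniformly over all first intersection points
  (\<open>finite_geometric_types\<close>).  All constructions commute with \<open>f\<close>, hence the counts are constant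
  along the orbit of a first intersection point (\<open>pieces_iterate\<close>), and it remains to show that there are only
  finitely many orbits of first intersection points (\<open>finitely_many_orbits\<close>).

  For this let \<open>z\<^sub>0\<close> be a first intersection point of a stable prong of \<open>p\<close> with an unstable
  prong of \<open>q\<close>.  Some power \<open>\<Phi>\<close> of \<open>f\<close> fixes \<open>p\<close>, \<open>q\<close> and both prongs, because \<open>P\<close> is finite and there
  are finitely many prongs at each point.  The transverse measure of the unstable foliation
  gives stable segments a length that \<open>\<Phi>\<close> multiplies by a constant smaller than 1, so every first
  intersection point \<open>z\<close> of the same two prongs has an iterate that lies on the stable prong
  between \<open>\<Phi>\<^sup>2 z\<^sub>0\<close> and \<open>z\<^sub>0\<close>.  The point \<open>\<Phi>\<^sup>2 z\<^sub>0\<close> then lies before this iterate on the stable prong,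
  and therefore not before it on the unstable prong: the iterate lies on the unstable segment from
  \<open>q\<close> to \<open>\<Phi>\<^sup>2 z\<^sub>0\<close>.  Two compact transverse arcs meet in finitely many regular points.

  The argument presupposes that a leaf through a point \<open>p\<close> of \<open>P\<close> is a union of rays, so that segments are
  unique and segments along one prong are nested.  A leaf could only fail to be one if
  an arc in it joined two points of \<open>P\<close> or closed up to a loop at \<open>p\<close>.  Such connections
  are determined by their initial prong (\<open>arc_inside_connection\<close>); hence two iterates of a connection agree,
  whereas \<open>f\<close> changes its length by a constant factor different from 1 (\<open>no_connection\<close>).

  This needs the length of a segment ending at a singularity to be finite
  (\<open>bounded_measure_near_start\<close>), although transverse measures are only defined for arcs off the
  singularities.  In the coordinate \<open>\<zeta>\<close>, a branch of the
  power \<open>k / 2\<close> of a chart at a \<open>k\<close>-prong, a sector becomes a half disc in which the plaques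
  are horizontal (\<open>prong_map\<close> is the inverse of this branch).
  In this picture a leaf of the other foliation issuing from the singularity rises monotonically, and
  its pieces can be slid horizontally into one vertical segment that starts away from the singularity
  and has finite measure.
\<close>

section \<open>Arcs in Hausdorff spaces\<close>

definition subarc :: "(real \<Rightarrow> 'a) \<Rightarrow> real \<Rightarrow> real \<Rightarrow> real \<Rightarrow> 'a" where
  "subarc g a b = (\<lambda>t. g (a + (b - a) * t))"

lemma subarc_ends [simp]: "pathstart (subarc g a b) = g a" "pathfinish (subarc g a b) = g b"
  by (auto simp: subarc_def pathstart_def pathfinish_def)

lemma affine_image_unit: "(\<lambda>t. a + (b - a) * t) ` {0..1} = closed_segment a b" for a b :: real
  by (auto simp: closed_segment_def algebra_simps image_def)

lemma path_image_subarc: "path_image (subarc g a b) = g ` closed_segment a b"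
  unfolding path_image_def subarc_def affine_image_unit[symmetric] by (simp add: image_image)

lemma path_subarc:
  assumes "continuous_on (closed_segment a b) g" shows "path (subarc g a b)"
  unfolding path_def subarc_def
  by (rule continuous_on_compose2[OF assms]) (auto intro!: continuous_intros simp: affine_image_unit)

lemma arc_subarc:
  assumes "continuous_on (closed_segment a b) g" "inj_on g (closed_segment a b)" "a \<noteq> b"
  shows "arc (subarc g a b)"
  unfolding arc_def
proof (intro conjI path_subarc assms inj_onI)
  fix s t :: real assume st: "s \<in> {0..1}" "t \<in> {0..1}" and eq: "subarc g a b s = subarc g a b t"
  have "a + (b - a) * s \<in> closed_segment a b" "a + (b - a) * t \<in> closed_segment a b"
    using st affine_image_unit by blast+
  with eq assms(2) have "a + (b - a) * s = a + (b - a) * t"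
    by (auto simp: subarc_def dest: inj_onD)
  then show "s = t" using assms(3) by simp
qed

lemma arc_continuous: "arc g \<Longrightarrow> continuous_on {0..1} g"
  by (simp add: arc_def path_def)

lemma arc_inj: "arc g \<Longrightarrow> inj_on g {0..1}"
  by (simp add: arc_def)

lemma path_image_subarc_subset:
  "a \<in> {0..1} \<Longrightarrow> b \<in> {0..1} \<Longrightarrow> path_image (subarc g a b) \<subseteq> path_image g"
  unfolding path_image_subarc by (auto simp: closed_segment_eq_real_ivl path_image_def)

lemma arc_subarc_arc:
  assumes "arc g" "a \<in> {0..1}" "b \<in> {0..1}" "a \<noteq> b" shows "arc (subarc g a b)"
proof -
  have "closed_segment a b \<subseteq> {0..1}" using assms(2,3) by (auto simp: closed_segment_eq_real_ivl)
  then show ?thesis using assms arc_subarc continuous_on_subset arc_continuous inj_on_subset arc_inj by metis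
qed

text \<open>Follow \<open>g\<close> up to its first point on \<open>h\<close> and continue along \<open>h\<close>.  The new arc runs along
  \<open>g\<close> at first, at speed \<open>r\<close>, so that it leaves the starting point along the same prong.\<close>

lemma arc_splice:
  fixes g h :: "real \<Rightarrow> 'a::t2_space"
  assumes g: "arc g" and h: "arc h" and gh: "pathfinish g = pathstart h"
    and nin: "pathstart g \<notin> path_image h"
  obtains k r \<delta> where "arc k" "pathstart k = pathstart g" "pathfinish k = pathfinish h"
    "path_image k \<subseteq> path_image g \<union> path_image h" "0 < r" "0 < \<delta>" "\<And>s. s \<in> {0..\<delta>} \<Longrightarrow> k s = g (r * s)"
    "\<And>s. s \<in> {0..\<delta>} \<Longrightarrow> r * s \<in> {0..1}" "\<delta> \<le> 1"
proof -
  define T where "T = {0..1} \<inter> g -` path_image h"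
  have clT: "closed T" unfolding T_def
    by (intro continuous_closed_preimage arc_continuous g closed_path_image arc_imp_path h closed_atLeastAtMost)
  have "1 \<in> T" using gh by (auto simp: T_def pathfinish_def pathstart_def path_image_def)
  moreover have bdd: "bdd_below T" by (auto simp: T_def intro!: bdd_belowI[of _ 0])
  ultimately have t1: "Inf T \<in> T" using clT closed_contains_Inf by blast
  define t where "t = Inf T"
  have tT: "t \<in> T" and tmin: "\<And>s. s \<in> T \<Longrightarrow> t \<le> s"
    using t1 bdd by (auto simp: t_def intro: cInf_lower)
  have t01: "t \<in> {0..1}" and gt: "g t \<in> path_image h" using tT by (auto simp: T_def)
  have t0: "t > 0" using gt nin t01 by (cases "t = 0") (auto simp: pathstart_def)
  obtain u where u: "u \<in> {0..1}" "g t = h u" using gt by (auto simp: path_image_def)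
  have a1: "arc (subarc g 0 t)" using arc_subarc_arc[OF g] t0 t01 by auto
  have init: "subarc g 0 t s = g (t * s)" for s by (simp add: subarc_def)
  show thesis
  proof (cases "u = 1")
    case True
    show thesis
    proof (rule that[OF a1, of t 1])
      show "path_image (subarc g 0 t) \<subseteq> path_image g \<union> path_image h"
        unfolding path_image_subarc using t01 by (auto simp: closed_segment_eq_real_ivl path_image_def)
    qed (use t0 t01 u True init in \<open>auto simp: pathstart_def pathfinish_def subarc_def mult_le_one\<close>)
  next
    case False
    have a2: "arc (subarc h u 1)" using arc_subarc_arc[OF h u(1)] False by auto
    have "arc (subarc g 0 t +++ subarc h u 1)"
    proof (rule arc_join[OF a1 a2])
      show "path_image (subarc g 0 t) \<inter> path_image (subarc h u 1) \<subseteq> {pathstart (subarc h u 1)}"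
      proof
        fix x assume x: "x \<in> path_image (subarc g 0 t) \<inter> path_image (subarc h u 1)"
        then obtain s where s: "s \<in> {0..t}" "x = g s" using t0 by (auto simp: path_image_subarc closed_segment_eq_real_ivl)
        have "x \<in> path_image h" using x u path_image_subarc_subset[of u 1 h] by auto
        then have "s \<in> T" using s t01 by (auto simp: T_def)
        then have "s = t" using tmin s by fastforce
        then show "x \<in> {pathstart (subarc h u 1)}" using s u by simp
      qed
    qed (use u in simp)
    then show thesis
    proof (rule that[of _ "2*t" "1/2"])
      show "path_image (subarc g 0 t +++ subarc h u 1) \<subseteq> path_image g \<union> path_image h"
        using t01 u(1) path_image_join_subset[of "subarc g 0 t" "subarc h u 1"]
          path_image_subarc_subset[of u 1 h] path_image_subarc_subset[of 0 t g] by fastforce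
      show "\<And>s. s \<in> {0..1 / 2} \<Longrightarrow> (subarc g 0 t +++ subarc h u 1) s = g (2 * t * s)"
        by (auto simp: joinpaths_def subarc_def ac_simps)
      show "2 * t * s \<in> {0..1}" if "s \<in> {0..1/2}" for s
      proof -
        have "t * (2 * s) \<le> 1 * 1" using t01 that by (intro mult_mono) auto
        then show ?thesis using t0 that by auto
      qed
    qed (use t0 in \<open>auto simp: pathstart_def pathfinish_def subarc_def joinpaths_def\<close>)
  qed
qed

text \<open>The parameter of a point of an arc depends continuously on the point, by compactness, and
  connected sets of parameters are intervals.\<close>

lemma connected_in_arc:
  fixes g :: "real \<Rightarrow> 'a::t2_space"
  assumes g: "arc g" and X: "connected X" "X \<subseteq> path_image g" and ab: "g a \<in> X" "g b \<in> X"
    "a \<in> {0..1}" "b \<in> {0..1}"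
  shows "g ` {a..b} \<subseteq> X"
proof -
  have ci: "continuous_on (path_image g) (inv_into {0..1} g)"
    unfolding path_image_def using g
    by (intro continuous_on_inv) (auto simp: arc_def path_def)
  define Y where "Y = inv_into {0..1} g ` X"
  have "connected Y" unfolding Y_def
    using X ci by (meson connected_continuous_image continuous_on_subset)
  moreover have "a \<in> Y" "b \<in> Y"
    using ab arc_inj[OF g] unfolding Y_def by (metis image_eqI inv_into_f_f)+
  ultimately have "{a..b} \<subseteq> Y" by (meson connected_contains_Icc)
  then show ?thesis
  proof (safe)
    fix t assume "t \<in> {a..b}"
    with \<open>{a..b} \<subseteq> Y\<close> obtain x where x: "x \<in> X" "t = inv_into {0..1} g x" by (auto simp: Y_def)
    then show "g t \<in> X" using X by (metis f_inv_into_f path_image_def subsetD)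
  qed
qed

text \<open>If \<open>h\<close> fell on one pair of parameters and rose on another, then it would take equal values on
  some pair between them.\<close>

lemma injective_real_imp_strict:
  fixes h :: "real \<Rightarrow> real"
  assumes S: "is_interval S" and c: "continuous_on S h" and i: "inj_on h S"
  shows "strict_mono_on S h \<or> strict_mono_on S (\<lambda>x. - h x)"
proof (rule ccontr)
  assume n: "\<not> ?thesis"
  have ne: "x \<in> S \<Longrightarrow> y \<in> S \<Longrightarrow> x < y \<Longrightarrow> h x \<noteq> h y" for x y
    using i by (metis inj_onD less_irrefl)
  from n obtain a b where ab: "a \<in> S" "b \<in> S" "a < b" "h a > h b"
    using ne unfolding strict_mono_on_def by (metis linorder_neqE)
  from n obtain p q where pq: "p \<in> S" "q \<in> S" "p < q" "h p < h q"
    using ne unfolding strict_mono_on_def by (metis linorder_neqE neg_less_iff_less)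
  define F where "F = (\<lambda>s. h (a + s * (p - a)) - h (b + s * (q - b)))"
  have conv: "x + s * (y - x) \<in> S" if "x \<in> S" "y \<in> S" "s \<in> {0..1}" for x y s
  proof -
    have "(1 - s) *\<^sub>R x + s *\<^sub>R y \<in> S" using S that is_interval_convex_1
      by (meson atLeastAtMost_iff convex_alt)
    then show ?thesis by (simp add: algebra_simps)
  qed
  have cF: "continuous_on {0..1} F" unfolding F_def
    by (intro continuous_intros continuous_on_compose2[OF c]) (auto intro!: conv ab pq)
  have "F 0 > 0" "F 1 < 0" using ab pq by (auto simp: F_def)
  then obtain s where s: "0 \<le> s" "s \<le> 1" "F s = 0" using IVT2'[of F 1 0 0] cF by force
  then have "a + s * (p - a) = b + s * (q - b)"
    using inj_onD[OF i] conv ab pq by (auto simp: F_def)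
  then have "(1 - s) * (b - a) + s * (q - p) = 0" by (simp add: algebra_simps)
  moreover have "(1 - s) * (b - a) \<ge> 0" "s * (q - p) \<ge> 0" using s ab pq by auto
  ultimately have "(1 - s) * (b - a) = 0" "s * (q - p) = 0" by linarith+
  then show False using ab pq by auto
qed

section \<open>Leaves, plaques and charts\<close>

lemma nearby_parameters:
  fixes g :: "real \<Rightarrow> 'a::topological_space"
  assumes "continuous_on S g" "t \<in> S" "open U" "g t \<in> U"
  obtains \<delta> where "\<delta> > 0" "\<And>s. s \<in> S \<Longrightarrow> \<bar>s - t\<bar> < \<delta> \<Longrightarrow> g s \<in> U"
proof -
  obtain A where A: "open A" "t \<in> A" "\<And>s. s \<in> S \<Longrightarrow> s \<in> A \<Longrightarrow> g s \<in> U"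
    using assms unfolding continuous_on_topological by metis
  then obtain \<delta> where "\<delta> > 0" "ball t \<delta> \<subseteq> A" using openE by blast
  then show thesis using A that[of \<delta>] by (auto simp: subset_iff dist_real_def abs_minus_commute)
qed

lemma foliated_chartD:
  assumes "foliated_chart F k x U \<phi>"
  shows "open U" "x \<in> U" "\<phi> x = 0" "continuous_on U \<phi>" "inj_on \<phi> U" "\<phi> ` U = ball 0 1"
    "continuous_on (ball 0 1) (inv_into U \<phi>)" "\<And>y. y \<in> U \<Longrightarrow> inv_into U \<phi> (\<phi> y) = y"
    "\<And>w. norm w < 1 \<Longrightarrow> \<phi> (inv_into U \<phi> w) = w" "\<And>w. norm w < 1 \<Longrightarrow> inv_into U \<phi> w \<in> U"
    "\<And>y. y \<in> U \<Longrightarrow> norm (\<phi> y) < 1"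
    "\<And>y. y \<in> U \<Longrightarrow> plaque F U y = {w \<in> U. \<phi> w \<in> prong_plaque k (\<phi> y)}"
proof -
  note A = assms[unfolded foliated_chart_def]
  have h: "homeomorphism U (ball 0 1) \<phi> (inv_into U \<phi>)" using A by blast
  show "open U" "x \<in> U" "\<phi> x = 0" using A by blast+
  show "continuous_on U \<phi>" "\<phi> ` U = ball 0 1" "continuous_on (ball 0 1) (inv_into U \<phi>)"
    and i: "\<And>y. y \<in> U \<Longrightarrow> inv_into U \<phi> (\<phi> y) = y" using h by (auto simp: homeomorphism_def)
  show "inj_on \<phi> U" using i by (rule inj_on_inverseI)
  show "\<phi> (inv_into U \<phi> w) = w" "inv_into U \<phi> w \<in> U" if "norm w < 1" for w
    using h that by (auto simp: homeomorphism_def)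
  show "norm (\<phi> y) < 1" if "y \<in> U" for y using h that by (auto simp: homeomorphism_def)
  show "plaque F U y = {w \<in> U. \<phi> w \<in> prong_plaque k (\<phi> y)}" if "y \<in> U" for y using A that by blast
qed

lemma chart_open_preimage:
  assumes "foliated_chart F k x U \<phi>" "open N" shows "open {w \<in> U. \<phi> w \<in> N}"
proof -
  have "{w \<in> U. \<phi> w \<in> N} = U \<inter> \<phi> -` N" by auto
  then show ?thesis using continuous_open_preimage foliated_chartD(1,4)[OF assms(1)] assms(2) by metis
qed

lemma chart_open_image:
  assumes c: "foliated_chart F k x U \<phi>" and W: "open W" shows "open (\<phi> ` (U \<inter> W))"
proof -
  have "\<phi> ` (U \<inter> W) = ball 0 1 \<inter> inv_into U \<phi> -` W"
  proof (intro equalityI subsetI)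
    fix z assume "z \<in> ball 0 1 \<inter> inv_into U \<phi> -` W"
    then show "z \<in> \<phi> ` (U \<inter> W)" using foliated_chartD(9,10)[OF c, of z] by (metis IntE IntI image_eqI mem_ball_0 vimageD)
  qed (use foliated_chartD(8,11)[OF c] in auto)
  then show ?thesis using continuous_open_preimage[OF foliated_chartD(7)[OF c] open_ball W] by metis
qed

lemma two_prong_level: "norm w ^ 2 - Re (w ^ 2) = 2 * (Im w)\<^sup>2"
  by (simp add: cmod_power2 Re_power2)

text \<open>The level set consists of two chords, and a connected subset cannot switch between them.\<close>

lemma prong_plaque_2:
  assumes "norm z < 1"
  shows "prong_plaque 2 z = {w \<in> ball 0 1. Im w = Im z}"
proof -
  define S where "S = {w \<in> ball 0 1. norm w ^ 2 - Re (w ^ 2) = norm z ^ 2 - Re (z ^ 2)}"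
  have S: "S = {w \<in> ball 0 1. (Im w)\<^sup>2 = (Im z)\<^sup>2}" unfolding S_def two_prong_level by auto
  have "connected_component_set S z = {w \<in> ball 0 1. Im w = Im z}"
  proof
    show "{w \<in> ball 0 1. Im w = Im z} \<subseteq> connected_component_set S z"
    proof (rule connected_component_maximal)
      have "{w \<in> ball 0 1. Im w = Im z} = ball 0 1 \<inter> {w. Im w = Im z}" by blast
      then show "connected {w \<in> ball 0 1. Im w = Im z}"
        using convex_connected[OF convex_Int[OF convex_ball convex_hyperplane[of \<i> "Im z"]]]
        by (simp add: inner_complex_def)
    qed (use assms in \<open>auto simp: S\<close>)
    have cc: "connected (Im ` connected_component_set S z)"
      by (intro connected_continuous_image continuous_intros connected_connected_component)
    have "Im ` connected_component_set S z \<subseteq> {Im z, - Im z}"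
      using connected_component_subset[of S z] by (auto simp: S power2_eq_iff)
    then have "finite (Im ` connected_component_set S z)" using finite_subset by blast
    then have "\<exists>a. Im ` connected_component_set S z \<subseteq> {a}" using cc connected_finite_iff_sing[OF cc] by auto
    moreover have "z \<in> connected_component_set S z" using assms by (simp add: S)
    ultimately have "Im ` connected_component_set S z \<subseteq> {Im z}" by (metis image_eqI singletonD subsetD)
    then show "connected_component_set S z \<subseteq> {w \<in> ball 0 1. Im w = Im z}"
      using connected_component_subset[of S z] by (auto simp: S)
  qed
  then show ?thesis unfolding prong_plaque_def S_def .
qed

text \<open>The zero level set is the union of the \<open>k\<close> prongs, which is star-shaped and hence connected.\<close>

lemma prong_plaque_0:
  assumes "k \<ge> 1"
  shows "prong_plaque k 0 = {w \<in> ball 0 1. w ^ k = of_real (norm w ^ k)}"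
proof -
  define S where "S = {w \<in> ball 0 1. norm w ^ k - Re (w ^ k) = 0}"
  have S: "S = {w \<in> ball 0 1. w ^ k = of_real (norm w ^ k)}"
  proof -
    have "norm w ^ k - Re (w ^ k) = 0 \<longleftrightarrow> w ^ k = of_real (norm w ^ k)" for w :: complex
    proof
      assume a: "norm w ^ k - Re (w ^ k) = 0"
      then have "(Re (w ^ k))\<^sup>2 + (Im (w ^ k))\<^sup>2 = (Re (w ^ k))\<^sup>2"
        using cmod_power2[of "w ^ k"] by (simp add: norm_power)
      then show "w ^ k = of_real (norm w ^ k)" using a by (intro complex_eqI) auto
    next
      assume "w ^ k = of_real (norm w ^ k)"
      then show "norm w ^ k - Re (w ^ k) = 0" by (metis Re_complex_of_real right_minus_eq)
    qed
    then show ?thesis by (auto simp: S_def)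
  qed
  have "starlike S" unfolding starlike_def
  proof (intro bexI[of _ 0] ballI)
    show "0 \<in> S" using assms by (simp add: S_def)
    fix w assume w: "w \<in> S"
    show "closed_segment 0 w \<subseteq> S"
    proof
      fix v assume "v \<in> closed_segment 0 w"
      then obtain u where u: "0 \<le> u" "u \<le> 1" "v = u *\<^sub>R w" by (auto simp: in_segment)
      have "norm v \<le> norm w" using u mult_right_mono[of u 1 "norm w"] by simp
      moreover have "v ^ k = of_real (norm v ^ k)"
        using w u by (simp add: S scaleR_conv_of_real power_mult_distrib norm_mult)
      ultimately show "v \<in> S" using w by (auto simp: S)
    qed
  qed
  then have c: "connected S" by (rule starlike_imp_connected)
  have "0 \<in> S" using assms by (simp add: S_def)
  then have "connected_component_set S 0 = S" using c connected_component_eq_self by blast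
  moreover have "prong_plaque k 0 = connected_component_set S 0"
    unfolding prong_plaque_def S_def using assms by simp
  ultimately show ?thesis using S by simp
qed

locale foliation =
  fixes F :: "'a::t2_space set set"
  assumes foliation: "singular_foliation F"
begin

lemma leaf_unique: "L \<in> F \<Longrightarrow> x \<in> L \<Longrightarrow> leaf F x = L"
proof -
  assume "L \<in> F" "x \<in> L"
  then have "{L \<in> F. x \<in> L} = {L}"
    using foliation by (auto simp: singular_foliation_def partition_on_def disjoint_def)
  then show ?thesis by (simp add: leaf_def)
qed

lemma leaf_mem: "leaf F x \<in> F" and in_leaf: "x \<in> leaf F x"
proof -
  have "\<Union>F = UNIV" using foliation by (auto simp: singular_foliation_def partition_on_def)
  then obtain L where "L \<in> F" "x \<in> L" by (metis UNIV_I UnionE)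
  then show "leaf F x \<in> F" "x \<in> leaf F x" by (simp_all add: leaf_unique)
qed

lemma leaf_eq: "y \<in> leaf F x \<Longrightarrow> leaf F y = leaf F x"
  using leaf_unique leaf_mem by blast

lemma leaf_interval_path_image: "arc g \<Longrightarrow> path_image g \<subseteq> leaf F x \<Longrightarrow> leaf_interval F (path_image g)"
  unfolding leaf_interval_def using leaf_mem by blast

lemma plaque_subset: "plaque F U y \<subseteq> U \<inter> leaf F y"
  unfolding plaque_def using path_component_subset[of "leaf F y \<inter> U" y] by auto

lemma plaque_mem_path:
  fixes g :: "real \<Rightarrow> 'a"
  assumes "continuous_on (closed_segment s t) g" "g ` closed_segment s t \<subseteq> U \<inter> leaf F x"
  shows "g t \<in> plaque F U (g s)"
proof -
  have "leaf F (g s) = leaf F x" using assms(2) leaf_eq[of "g s" x] by auto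
  moreover have "path_component (leaf F x \<inter> U) (g s) (g t)"
    unfolding path_component_def using assms path_subarc[OF assms(1)]
    by (intro exI[of _ "subarc g s t"]) (auto simp: path_image_subarc)
  ultimately show ?thesis by (simp add: plaque_def)
qed

text \<open>Continuity for the topology of the surface implies continuity for the leaf topology, as
  plaques are path components.\<close>

lemma local_plaque:
  fixes g :: "real \<Rightarrow> 'a"
  assumes "continuous_on S g" "is_interval S" "t \<in> S" "g ` S \<subseteq> leaf F x" "open U" "g t \<in> U"
  obtains \<delta> where "\<delta> > 0" "\<And>s. s \<in> S \<Longrightarrow> \<bar>s - t\<bar> < \<delta> \<Longrightarrow> g s \<in> plaque F U (g t)"
proof -
  obtain \<delta> where d: "\<delta> > 0" "\<And>s. s \<in> S \<Longrightarrow> \<bar>s - t\<bar> < \<delta> \<Longrightarrow> g s \<in> U"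
    using nearby_parameters assms by blast
  show thesis
  proof (rule that[OF d(1)])
    fix s assume s: "s \<in> S" "\<bar>s - t\<bar> < \<delta>"
    have sub: "closed_segment t s \<subseteq> S"
      using assms(2,3) s(1) by (meson closed_segment_subset is_interval_convex_1)
    have "\<bar>r - t\<bar> < \<delta>" if "r \<in> closed_segment t s" for r
      using that s(2) by (auto simp: closed_segment_eq_real_ivl split: if_splits)
    then show "g s \<in> plaque F U (g t)"
      using plaque_mem_path[of t s g U x] continuous_on_subset[OF assms(1) sub] d(2) sub assms(4) by blast
  qed
qed

lemma regular_plaque:
  assumes "foliated_chart F 2 x V \<psi>" "y \<in> V"
  shows "w \<in> plaque F V y \<longleftrightarrow> w \<in> V \<and> Im (\<psi> w) = Im (\<psi> y)"
  using foliated_chartD(11,12)[OF assms(1)] assms(2) by (auto simp: prong_plaque_2)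

lemma regular_chart:
  assumes "x \<notin> singularities F" obtains U \<phi> where "foliated_chart F 2 x U \<phi>"
  using assms by (auto simp: singularities_def prongs_def)

lemma center_plaque:
  assumes "foliated_chart F k x V \<psi>" "k \<ge> 1"
  shows "w \<in> plaque F V x \<longleftrightarrow> w \<in> V \<and> \<psi> w ^ k = of_real (norm (\<psi> w) ^ k)"
  using foliated_chartD(2,3,11,12)[OF assms(1)] assms(2) by (auto simp: prong_plaque_0)

text \<open>In a regular chart the curve moves along one chord, and a continuous injective real function
  maps interior points of an interval to interior points of its image.\<close>

lemma leaf_arc_covers:
  fixes g :: "real \<Rightarrow> 'a"
  assumes c: "continuous_on {a..b} g" and i: "inj_on g {a..b}" and L: "g ` {a..b} \<subseteq> leaf F x"
    and t: "a < t" "t < b" and ch: "foliated_chart F 2 y V \<psi>" and y: "g t \<in> V"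
  obtains N where "open N" "g t \<in> N" "plaque F V (g t) \<inter> N \<subseteq> g ` {a..b}"
proof -
  obtain \<delta> where d: "\<delta> > 0" "\<And>s. s \<in> {a..b} \<Longrightarrow> \<bar>s - t\<bar> < \<delta> \<Longrightarrow> g s \<in> plaque F V (g t)"
    using local_plaque[OF c is_interval_cc _ L foliated_chartD(1)[OF ch] y] t by auto
  define e where "e = min (\<delta> / 2) (min (t - a) (b - t))"
  have e: "e > 0" "e < \<delta>" "a \<le> t - e" "t + e \<le> b" using d(1) t by (auto simp: e_def min_def)
  define S where "S = {t - e .. t + e}"
  have SV: "g s \<in> V \<and> Im (\<psi> (g s)) = Im (\<psi> (g t))" if "s \<in> S" for s
  proof -
    have "g s \<in> plaque F V (g t)" using that e by (intro d(2)) (auto simp: S_def)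
    then show ?thesis using regular_plaque[OF ch y] by blast
  qed
  have Sab: "S \<subseteq> {a..b}" using e by (auto simp: S_def)
  define h where "h = (\<lambda>s. Re (\<psi> (g s)))"
  have ch': "continuous_on S h" unfolding h_def
    using SV by (intro continuous_intros continuous_on_compose2[OF foliated_chartD(4)[OF ch]]
        continuous_on_subset[OF c Sab]) auto
  have ih: "inj_on h S"
  proof (rule inj_onI)
    fix s s' assume s: "s \<in> S" "s' \<in> S" "h s = h s'"
    then have "\<psi> (g s) = \<psi> (g s')" using SV by (auto simp: h_def complex_eq_iff)
    then have "g s = g s'" using SV s foliated_chartD(5)[OF ch] by (auto dest: inj_onD)
    then show "s = s'" using s Sab i by (auto dest: inj_onD)
  qed
  define l where "l = min (h (t-e)) (h (t+e))"
  define u where "u = max (h (t-e)) (h (t+e))"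
  have lu: "l < h t" "h t < u"
    using continuous_inj_imp_mono[of "t-e" t "t+e" h] ch' ih e(1) by (auto simp: S_def l_def u_def)
  have cov: "\<exists>s\<in>S. h s = v" if "l \<le> v" "v \<le> u" for v
  proof -
    have "connected (h ` S)" using ch' unfolding S_def by (intro connected_continuous_image) auto
    moreover have "h (t-e) \<in> h ` S" "h (t+e) \<in> h ` S" using e by (auto simp: S_def)
    ultimately have "{l..u} \<subseteq> h ` S" unfolding l_def u_def
      by (intro connected_contains_Icc) (auto simp: min_def max_def)
    moreover have "v \<in> {l..u}" using that by simp
    ultimately show ?thesis by blast
  qed
  define N where "N = {w \<in> V. \<psi> w \<in> {z. l < Re z \<and> Re z < u}}"
  show thesis
  proof (rule that)
    show "open N" unfolding N_def
      by (intro chart_open_preimage[OF ch] open_Collect_conj open_Collect_less continuous_intros)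
    show "g t \<in> N" using lu y by (simp add: N_def h_def)
    show "plaque F V (g t) \<inter> N \<subseteq> g ` {a..b}"
    proof
      fix w assume "w \<in> plaque F V (g t) \<inter> N"
      then have w: "w \<in> V" "Im (\<psi> w) = Im (\<psi> (g t))" "l < Re (\<psi> w)" "Re (\<psi> w) < u"
        using regular_plaque[OF ch y] by (auto simp: N_def)
      then obtain s where s: "s \<in> S" "h s = Re (\<psi> w)" using cov by (meson less_imp_le)
      then have "\<psi> (g s) = \<psi> w" using SV w by (auto simp: h_def complex_eq_iff)
      then have "g s = w" using SV s w foliated_chartD(5)[OF ch] by (auto dest: inj_onD)
      then show "w \<in> g ` {a..b}" using s Sab by blast
    qed
  qed
qed

end

section \<open>Transverse pairs of foliations\<close>

locale transverse_pair =
  F: foliation F + G: foliation G for F G :: "'a::t2_space set set" +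
  assumes transverse: "transverse_foliations F G"
begin

lemma same_prongs: "prongs F x k \<longleftrightarrow> prongs G x k"
  using transverse by (auto simp: transverse_foliations_def)

lemma singularities_eq: "singularities G = singularities F"
  by (simp add: singularities_def same_prongs)

lemma joint_chart:
  assumes "x \<notin> singularities F"
  obtains W \<theta> where "foliated_chart F 2 x W \<theta>" "foliated_chart G 2 x W (\<lambda>y. \<i> * \<theta> y)"
  using transverse assms by (auto simp: transverse_foliations_def)

text \<open>Two points of a leaf of \<open>F\<close> that lie close to a regular point and on one plaque of
  \<open>G\<close> are equal, because in a joint chart they lie on one horizontal and on one vertical
  chord.\<close>

lemma transversal_injective:
  fixes g :: "real \<Rightarrow> 'a"
  assumes c: "continuous_on S g" and S: "is_interval S" and i: "inj_on g S" and L: "g ` S \<subseteq> leaf F x"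
    and t: "t \<in> S" and reg: "g t \<notin> singularities F"
    and ch: "foliated_chart G 2 y V \<psi>" and gV: "g t \<in> V"
  obtains \<delta> where "\<delta> > 0" "g ` (S \<inter> ball t \<delta>) \<subseteq> V" "inj_on (\<lambda>s. Im (\<psi> (g s))) (S \<inter> ball t \<delta>)"
proof -
  obtain W \<theta> where cF: "foliated_chart F 2 (g t) W \<theta>" and cG: "foliated_chart G 2 (g t) W (\<lambda>y. \<i> * \<theta> y)"
    using joint_chart[OF reg] .
  note W = foliated_chartD[OF cF] and V = foliated_chartD[OF ch]
  have "\<psi> (g t) \<in> \<psi> ` (V \<inter> W)" using gV W(2) by blast
  then obtain r where r: "r > 0" "ball (\<psi> (g t)) r \<subseteq> \<psi> ` (V \<inter> W)"
    using chart_open_image[OF ch W(1)] openE by blast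
  define N where "N = W \<inter> {w \<in> V. \<psi> w \<in> ball (\<psi> (g t)) r}"
  have N: "open N" "g t \<in> N"
    unfolding N_def using chart_open_preimage[OF ch open_ball] W(1,2) gV r by auto
  obtain \<delta> where d: "\<delta> > 0" "\<And>s. s \<in> S \<Longrightarrow> \<bar>s - t\<bar> < \<delta> \<Longrightarrow> g s \<in> N"
    using nearby_parameters[OF c t N] by blast
  show thesis
  proof (rule that[OF d(1)])
    have inN: "g s \<in> N" if "s \<in> S \<inter> ball t \<delta>" for s using d(2) that by (auto simp: dist_real_def)
    then show "g ` (S \<inter> ball t \<delta>) \<subseteq> V" by (auto simp: N_def)
    show "inj_on (\<lambda>s. Im (\<psi> (g s))) (S \<inter> ball t \<delta>)"
    proof (rule inj_onI)
      fix s s' assume s: "s \<in> S \<inter> ball t \<delta>" "s' \<in> S \<inter> ball t \<delta>" and eq: "Im (\<psi> (g s)) = Im (\<psi> (g s'))"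
      note sN = inN[OF s(1), unfolded N_def] inN[OF s(2), unfolded N_def]
      have "convex (S \<inter> ball t \<delta>)" using S by (simp add: is_interval_convex_1 convex_Int)
      then have seg: "closed_segment s s' \<subseteq> S \<inter> ball t \<delta>" using s by (intro closed_segment_subset)
      have "g s' \<in> plaque F W (g s)"
      proof (rule F.plaque_mem_path)
        show "continuous_on (closed_segment s s') g" using seg by (intro continuous_on_subset[OF c]) auto
        show "g ` closed_segment s s' \<subseteq> W \<inter> leaf F x" using seg inN L unfolding N_def image_subset_iff by blast
      qed
      then have Im: "Im (\<theta> (g s)) = Im (\<theta> (g s'))" using F.regular_plaque[OF cF] sN by auto
      define h where "h = (\<lambda>u. inv_into V \<psi> (linepath (\<psi> (g s)) (\<psi> (g s')) u))"
      have "closed_segment (\<psi> (g s)) (\<psi> (g s')) \<subseteq> ball (\<psi> (g t)) r"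
        using sN by (intro closed_segment_subset convex_ball) auto
      then have lB: "linepath (\<psi> (g s)) (\<psi> (g s')) u \<in> ball (\<psi> (g t)) r" if "u \<in> {0..1}" for u
        using linepath_in_path[OF that] by blast
      have hVW: "h u \<in> V \<inter> W \<and> \<psi> (h u) = linepath (\<psi> (g s)) (\<psi> (g s')) u" if u: "u \<in> {0..1}" for u
      proof -
        obtain w where "w \<in> V \<inter> W" "linepath (\<psi> (g s)) (\<psi> (g s')) u = \<psi> w" using lB[OF u] r(2) by blast
        then show ?thesis using V(8) by (simp add: h_def)
      qed
      have "g s' \<in> plaque G W (g s)"
      proof -
        have h01: "h 0 = g s" "h 1 = g s'" using sN V(8) by (auto simp: h_def linepath_def)
        have "h 1 \<in> plaque G W (h 0)"
        proof (rule G.plaque_mem_path)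
          have lb1: "linepath (\<psi> (g s)) (\<psi> (g s')) u \<in> ball 0 1" if "u \<in> {0..1}" for u
            using hVW[OF that] V(11) by (metis Int_iff mem_ball_0)
          show "continuous_on (closed_segment 0 1) h" unfolding h_def
            using lb1 by (intro continuous_on_compose2[OF V(7)] continuous_intros)
              (auto simp: closed_segment_eq_real_ivl)
          show "h ` closed_segment 0 1 \<subseteq> W \<inter> leaf G (g s)"
          proof (rule image_subsetI)
            fix u :: real assume "u \<in> closed_segment 0 1"
            then have u: "u \<in> {0..1}" by (auto simp: closed_segment_eq_real_ivl)
            have "Im (linepath (\<psi> (g s)) (\<psi> (g s')) u) = Im (\<psi> (g s))"
              using eq by (simp add: linepath_def algebra_simps)
            then have "h u \<in> plaque G V (g s)" using G.regular_plaque[OF ch, of "g s"] sN hVW[OF u] by auto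
            then show "h u \<in> W \<inter> leaf G (g s)" using hVW[OF u] G.plaque_subset by blast
          qed
        qed
        then show ?thesis by (simp add: h01)
      qed
      then have "Re (\<theta> (g s)) = Re (\<theta> (g s'))" using G.regular_plaque[OF cG] sN by auto
      then have "\<theta> (g s) = \<theta> (g s')" using Im by (simp add: complex_eq_iff)
      then have "g s = g s'" using sN W(5) by (auto dest: inj_onD)
      then show "s = s'" using s i by (auto dest: inj_onD)
    qed
  qed
qed

text \<open>A continuous injective function on an interval is strictly monotone, so transversality reduces
  to local injectivity of the transverse coordinate.\<close>

lemma leaf_arc_transverse:
  assumes g: "arc g" and L: "path_image g \<subseteq> leaf F x" and reg: "path_image g \<inter> singularities F = {}"
  shows "transverse_arc G g"
  unfolding transverse_arc_def
proof (intro conjI ballI g)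
  show "path_image g \<inter> singularities G = {}" using reg by (simp add: singularities_eq)
  fix t :: real assume t: "t \<in> {0..1}"
  then have "g t \<in> path_image g" by (simp add: path_image_def)
  then have gt: "g t \<notin> singularities F" using reg by blast
  then obtain V \<psi> where ch: "foliated_chart G 2 (g t) V \<psi>" using G.regular_chart singularities_eq by metis
  obtain \<delta> where d: "\<delta> > 0" "g ` ({0..1} \<inter> ball t \<delta>) \<subseteq> V"
      "inj_on (\<lambda>s. Im (\<psi> (g s))) ({0..1} \<inter> ball t \<delta>)"
    using transversal_injective[OF arc_continuous[OF g] is_interval_cc arc_inj[OF g] _ t gt ch
        foliated_chartD(2)[OF ch]] L by (metis path_image_def)
  have "continuous_on ({0..1} \<inter> ball t \<delta>) (\<lambda>s. Im (\<psi> (g s)))"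
    using d(2) by (intro continuous_intros continuous_on_compose2[OF foliated_chartD(4)[OF ch]]
        continuous_on_subset[OF arc_continuous[OF g]]) auto
  moreover have "is_interval ({0..1} \<inter> ball t \<delta>)"
    by (simp add: is_interval_convex_1 convex_Int)
  ultimately have "strict_mono_on ({0..1} \<inter> ball t \<delta>) (\<lambda>s. Im (\<psi> (g s))) \<or>
      strict_mono_on ({0..1} \<inter> ball t \<delta>) (\<lambda>s. - Im (\<psi> (g s)))"
    using injective_real_imp_strict d(3) by blast
  then show "\<exists>U \<phi> e. foliated_chart G 2 (g t) U \<phi> \<and> e > 0 \<and> g ` ({0..1} \<inter> ball t e) \<subseteq> U \<and>
        (strict_mono_on ({0..1} \<inter> ball t e) (\<lambda>s. Im (\<phi> (g s))) \<or>
         strict_mono_on ({0..1} \<inter> ball t e) (\<lambda>s. - Im (\<phi> (g s))))"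
    using ch d by blast
qed

text \<open>Off a neighbourhood of its parameter at \<open>y\<close> an arc stays away from \<open>y\<close>, so near \<open>y\<close> the two
  arcs run in the plaques of \<open>y\<close>, which are a horizontal and a vertical chord of a joint chart.\<close>

lemma isolated_intersection:
  assumes g: "arc g" "path_image g \<subseteq> leaf F x" and h: "arc h" "path_image h \<subseteq> leaf G x'"
    and y: "y \<in> path_image g \<inter> path_image h" "y \<notin> singularities F"
  obtains N where "open N" "y \<in> N" "path_image g \<inter> path_image h \<inter> N \<subseteq> {y}"
proof -
  obtain W \<theta> where cF: "foliated_chart F 2 y W \<theta>" and cG: "foliated_chart G 2 y W (\<lambda>y. \<i> * \<theta> y)"
    using joint_chart[OF y(2)] .
  note W = foliated_chartD[OF cF]
  have local: "\<exists>K. closed K \<and> y \<notin> K \<and> path_image k - K \<subseteq> plaque E W y"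
    if E: "foliation E" and k: "arc k" "path_image k \<subseteq> leaf E z" "y \<in> path_image k" for E k z
  proof -
    obtain t where t: "t \<in> {0..1}" "y = k t" using k(3) by (auto simp: path_image_def)
    obtain \<delta> where d: "\<delta> > 0" "\<And>s. s \<in> {0..1} \<Longrightarrow> \<bar>s - t\<bar> < \<delta> \<Longrightarrow> k s \<in> plaque E W (k t)"
      using foliation.local_plaque[OF E arc_continuous[OF k(1)] is_interval_cc t(1) _ W(1)] k(2) W(2) t(2)
      by (metis path_image_def)
    define K where "K = k ` ({0..1} - ball t \<delta>)"
    have "compact K" unfolding K_def
      by (intro compact_continuous_image compact_diff continuous_on_subset[OF arc_continuous[OF k(1)]]) auto
    moreover have "y \<notin> K"
      using t d(1) arc_inj[OF k(1)] by (auto simp: K_def dest: inj_onD)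
    moreover have "path_image k - K \<subseteq> plaque E W y"
      using d(2) t(2) by (auto simp: K_def path_image_def dist_real_def abs_minus_commute)
    ultimately show ?thesis using compact_imp_closed by blast
  qed
  obtain K where K: "closed K" "y \<notin> K" "path_image g - K \<subseteq> plaque F W y"
    using local[OF F.foliation_axioms g] y by auto
  obtain K' where K': "closed K'" "y \<notin> K'" "path_image h - K' \<subseteq> plaque G W y"
    using local[OF G.foliation_axioms h] y by auto
  show thesis
  proof (rule that[of "- (K \<union> K')"])
    show "path_image g \<inter> path_image h \<inter> - (K \<union> K') \<subseteq> {y}"
    proof
      fix w assume "w \<in> path_image g \<inter> path_image h \<inter> - (K \<union> K')"
      then have "w \<in> plaque F W y" "w \<in> plaque G W y" using K K' by auto
      then have "w \<in> W" "Im (\<theta> w) = Im (\<theta> y)" "Re (\<theta> w) = Re (\<theta> y)"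
        using F.regular_plaque[OF cF W(2)] G.regular_plaque[OF cG W(2)] by auto
      then have "\<theta> w = \<theta> y" by (simp add: complex_eq_iff)
      then show "w \<in> {y}" using W(2,5) \<open>w \<in> W\<close> by (auto dest: inj_onD)
    qed
  qed (use K K' in auto)
qed

text \<open>Compactness turns isolation into finiteness.\<close>

lemma finite_intersection:
  assumes g: "arc g" "path_image g \<subseteq> leaf F x" and h: "arc h" "path_image h \<subseteq> leaf G x'"
    and C: "compact C" "C \<inter> singularities F = {}"
  shows "finite (path_image g \<inter> path_image h \<inter> C)"
proof -
  define X where "X = path_image g \<inter> path_image h \<inter> C"
  have "compact X" unfolding X_def using g(1) h(1) C(1)
    by (intro compact_Int compact_path_image arc_imp_path)
  have "\<forall>y\<in>X. \<exists>N. open N \<and> y \<in> N \<and> path_image g \<inter> path_image h \<inter> N \<subseteq> {y}"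
  proof
    fix y assume "y \<in> X"
    then have "y \<in> path_image g \<inter> path_image h" "y \<notin> singularities F" using C by (auto simp: X_def)
    then show "\<exists>N. open N \<and> y \<in> N \<and> path_image g \<inter> path_image h \<inter> N \<subseteq> {y}"
      using isolated_intersection[OF g h] by metis
  qed
  then obtain N where N: "\<And>y. y \<in> X \<Longrightarrow> open (N y) \<and> y \<in> N y \<and> path_image g \<inter> path_image h \<inter> N y \<subseteq> {y}"
    by metis
  obtain D where D: "D \<subseteq> X" "finite D" "X \<subseteq> (\<Union>y\<in>D. N y)"
    using compactE_image[OF \<open>compact X\<close>, of X N] N by blast
  have "X \<subseteq> D"
  proof
    fix y assume y: "y \<in> X"
    then obtain d where d: "d \<in> D" "y \<in> N d" using D by blast
    then have "y = d" using N[of d] D(1) y by (auto simp: X_def)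
    then show "y \<in> D" using d by simp
  qed
  then have "finite X" using D(2) finite_subset by blast
  then show ?thesis by (simp add: X_def)
qed

end

section \<open>Straightening a foliation near a prong singularity\<close>

text \<open>The plane slit along the closed negative imaginary half-axis, where the branch of the power in
  \<open>prong_map\<close> jumps; it contains the closed upper half plane without the origin.\<close>

definition prong_domain :: "complex set" where
  "prong_domain = {\<zeta>. Re \<zeta> \<noteq> 0 \<or> Im \<zeta> > 0}"

text \<open>The factor next to \<open>u\<close> is the power \<open>2 / k\<close> of \<open>\<zeta> / \<i>\<close>.  If \<open>u\<^sup>k = -1\<close>, the \<open>k\<close>-th power of its value is
  \<open>\<zeta>\<^sup>2\<close>, and \<open>u\<close> points to the middle of the sector onto which it maps the upper half plane.\<close>

definition prong_map :: "nat \<Rightarrow> complex \<Rightarrow> complex \<Rightarrow> complex" where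
  "prong_map k u \<zeta> = u * exp (2 / of_nat k * Ln (\<zeta> / \<i>))"

text \<open>Plaques are components of the level sets of this function.\<close>

definition prong_height :: "nat \<Rightarrow> complex \<Rightarrow> real" where
  "prong_height k w = norm w ^ k - Re (w ^ k)"

lemma prong_domain_Ln: "\<zeta> \<in> prong_domain \<longleftrightarrow> \<zeta> / \<i> \<notin> \<real>\<^sub>\<le>\<^sub>0"
  by (auto simp: prong_domain_def complex_nonpos_Reals_iff)

lemma prong_domain_nonzero: "\<zeta> \<in> prong_domain \<Longrightarrow> \<zeta> \<noteq> 0"
  by (auto simp: prong_domain_def)

lemma open_prong_domain: "open prong_domain"
  unfolding prong_domain_def by (intro open_Collect_disj open_Collect_less open_Collect_neq continuous_intros)

context
  fixes k :: nat and u :: complex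
  assumes k: "k \<ge> 1" and u: "u ^ k = -1"
begin

lemma prong_map_power:
  assumes "\<zeta> \<noteq> 0" shows "prong_map k u \<zeta> ^ k = \<zeta>\<^sup>2"
proof -
  have "prong_map k u \<zeta> ^ k = u ^ k * exp (of_nat k * (2 / of_nat k * Ln (\<zeta> / \<i>)))"
    by (simp only: prong_map_def power_mult_distrib exp_of_nat_mult)
  also have "of_nat k * (2 / of_nat k * Ln (\<zeta> / \<i>)) = 2 * Ln (\<zeta> / \<i>)" using k by simp
  also have "exp (2 * Ln (\<zeta> / \<i>)) = (\<zeta> / \<i>)\<^sup>2"
    using assms by (simp only: exp_double) (simp add: exp_Ln)
  finally show ?thesis using u by (simp add: power_divide power_mult_distrib)
qed

lemma prong_map_norm: "\<zeta> \<noteq> 0 \<Longrightarrow> norm (prong_map k u \<zeta>) ^ k = norm \<zeta> ^ 2"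
  by (metis prong_map_power norm_power)

lemma prong_map_norm_less:
  assumes "\<zeta> \<noteq> 0" shows "norm (prong_map k u \<zeta>) < 1 \<longleftrightarrow> norm \<zeta> < 1"
proof -
  have "norm (prong_map k u \<zeta>) < 1 \<longleftrightarrow> norm (prong_map k u \<zeta>) ^ k < 1"
    using k by (auto simp: power_less_one_iff)
  also have "\<dots> \<longleftrightarrow> norm \<zeta> < 1" using prong_map_norm[OF assms] by (simp add: power_less_one_iff)
  finally show ?thesis .
qed

lemma prong_map_height:
  assumes "\<zeta> \<noteq> 0" shows "prong_height k (prong_map k u \<zeta>) = 2 * (Im \<zeta>)\<^sup>2"
  unfolding prong_height_def prong_map_norm[OF assms] prong_map_power[OF assms] by (rule two_prong_level)

lemma prong_map_eq:
  assumes "\<zeta> \<noteq> 0" "\<zeta>' \<noteq> 0" "prong_map k u \<zeta> = prong_map k u \<zeta>'" shows "\<zeta> = \<zeta>' \<or> \<zeta> = - \<zeta>'"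
  using prong_map_power assms by (metis power2_eq_iff)

lemma continuous_prong_map: "continuous_on prong_domain (prong_map k u)"
  unfolding prong_map_def by (intro continuous_intros) (auto simp: prong_domain_Ln)

end

lemma foliated_chartI:
  assumes "open V" "x \<in> V" "\<psi> x = 0" "continuous_on V \<psi>" "continuous_on (ball 0 1) \<chi>'"
    "\<And>y. y \<in> V \<Longrightarrow> \<psi> y \<in> ball 0 1" "\<And>w. w \<in> ball 0 1 \<Longrightarrow> \<chi>' w \<in> V"
    "\<And>y. y \<in> V \<Longrightarrow> \<chi>' (\<psi> y) = y" "\<And>w. w \<in> ball 0 1 \<Longrightarrow> \<psi> (\<chi>' w) = w"
    "\<And>y. y \<in> V \<Longrightarrow> plaque F V y = {w \<in> V. \<psi> w \<in> prong_plaque k (\<psi> y)}"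
  shows "foliated_chart F k x V \<psi>"
proof -
  have i: "inj_on \<psi> V" using assms(8) by (rule inj_on_inverseI)
  have inv: "inv_into V \<psi> w = \<chi>' w" if "w \<in> ball 0 1" for w
    using inv_into_f_f[OF i assms(7)[OF that]] assms(9)[OF that] by simp
  have "homeomorphism V (ball 0 1) \<psi> (inv_into V \<psi>)"
    unfolding homeomorphism_def
  proof (intro conjI ballI)
    show "continuous_on (ball 0 1) (inv_into V \<psi>)"
      using assms(5) inv continuous_on_cong by (metis (no_types, lifting))
    show "\<psi> ` V = ball 0 1" using assms(6,7,9) by (metis (no_types) image_eqI image_subsetI subsetI subset_antisym)
    show "inv_into V \<psi> ` ball 0 1 = V" using assms(6,7,8) inv
      by (metis (no_types, opaque_lifting) image_eqI image_subsetI subsetI subset_antisym)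
  qed (use assms inv i in auto)
  then show ?thesis using assms by (auto simp: foliated_chart_def)
qed

text \<open>In the coordinate \<open>\<zeta>\<close> on a prong chart the plaques are horizontal.\<close>

definition unfold_prong :: "'a set \<Rightarrow> ('a \<Rightarrow> complex) \<Rightarrow> nat \<Rightarrow> complex \<Rightarrow> complex \<Rightarrow> 'a" where
  "unfold_prong U \<phi> k u \<zeta> = inv_into U \<phi> (prong_map k u \<zeta>)"

context foliation
begin

context
  fixes k :: nat and u :: complex and p :: 'a and U :: "'a set" and \<phi> :: "'a \<Rightarrow> complex"
  assumes k: "k \<ge> 1" and u: "u ^ k = -1" and ch: "foliated_chart F k p U \<phi>"
begin

abbreviation "\<Theta> \<equiv> unfold_prong U \<phi> k u"

lemma unfold_prong_mem:
  assumes "\<zeta> \<noteq> 0" "norm \<zeta> < 1"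
  shows "\<Theta> \<zeta> \<in> U" "\<phi> (\<Theta> \<zeta>) = prong_map k u \<zeta>" "prong_height k (\<phi> (\<Theta> \<zeta>)) = 2 * (Im \<zeta>)\<^sup>2"
  using foliated_chartD(9,10)[OF ch] prong_map_norm_less[OF k u] prong_map_height[OF k u] assms
  by (auto simp: unfold_prong_def)

lemma unfold_prong_eq:
  assumes "\<zeta> \<noteq> 0" "norm \<zeta> < 1" "\<zeta>' \<noteq> 0" "norm \<zeta>' < 1" "\<Theta> \<zeta> = \<Theta> \<zeta>'"
  shows "\<zeta> = \<zeta>' \<or> \<zeta> = - \<zeta>'"
  using prong_map_eq[OF k u] unfold_prong_mem(2) assms by metis

lemma continuous_unfold_prong: "continuous_on (prong_domain \<inter> ball 0 1) \<Theta>"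
  unfolding unfold_prong_def
  by (intro continuous_on_compose2[OF foliated_chartD(7)[OF ch]]
      continuous_on_subset[OF continuous_prong_map[OF k u]])
    (use prong_map_norm_less[OF k u] prong_domain_nonzero in auto)

text \<open>The height is constant on the image of a horizontal chord, which is connected.\<close>

lemma chord_in_plaque:
  assumes z: "Im \<zeta> = Im \<zeta>'" and D: "closed_segment \<zeta> \<zeta>' \<subseteq> prong_domain \<inter> ball 0 1" and s: "\<xi> \<in> closed_segment \<zeta> \<zeta>'"
  shows "\<Theta> \<xi> \<in> plaque F U (\<Theta> \<zeta>)"
proof -
  have nz: "\<eta> \<noteq> 0 \<and> norm \<eta> < 1" if "\<eta> \<in> closed_segment \<zeta> \<zeta>'" for \<eta>
    using D that prong_domain_nonzero by auto
  have Im: "Im \<eta> = Im \<zeta>" if "\<eta> \<in> closed_segment \<zeta> \<zeta>'" for \<eta>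
  proof -
    obtain t where "\<eta> = (1 - t) *\<^sub>R \<zeta> + t *\<^sub>R \<zeta>'" using \<open>\<eta> \<in> closed_segment \<zeta> \<zeta>'\<close> by (auto simp: in_segment)
    then have "Im \<eta> = (1 - t) * Im \<zeta> + t * Im \<zeta>'" by simp
    then show ?thesis using z by (simp add: algebra_simps)
  qed
  let ?L = "{w \<in> ball 0 1. norm w ^ k - Re (w ^ k) = norm (prong_map k u \<zeta>) ^ k - Re (prong_map k u \<zeta> ^ k)}"
  have "prong_map k u ` closed_segment \<zeta> \<zeta>' \<subseteq> connected_component_set ?L (prong_map k u \<zeta>)"
  proof (rule connected_component_maximal)
    show "connected (prong_map k u ` closed_segment \<zeta> \<zeta>')"
      using D by (intro connected_continuous_image continuous_on_subset[OF continuous_prong_map[OF k u]]) auto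
    show "prong_map k u ` closed_segment \<zeta> \<zeta>' \<subseteq> ?L"
    proof (rule image_subsetI)
      fix \<eta> assume e: "\<eta> \<in> closed_segment \<zeta> \<zeta>'"
      show "prong_map k u \<eta> \<in> ?L"
        using nz[OF e] nz[of \<zeta>] Im[OF e] prong_map_height[OF k u, of \<eta>] prong_map_height[OF k u, of \<zeta>]
          prong_map_norm_less[OF k u, of \<eta>] by (simp add: prong_height_def)
    qed
  qed auto
  then have "\<phi> (\<Theta> \<xi>) \<in> prong_plaque k (\<phi> (\<Theta> \<zeta>))"
    using s nz[of \<xi>] nz[of \<zeta>] unfold_prong_mem(2) unfolding prong_plaque_def by auto
  then show ?thesis using foliated_chartD(12)[OF ch, of "\<Theta> \<zeta>"] unfold_prong_mem(1) nz s by auto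
qed

lemma plaque_height:
  assumes "y \<in> U" "w \<in> plaque F U y"
  shows "prong_height k (\<phi> w) = prong_height k (\<phi> y)"
proof -
  have "\<phi> w \<in> prong_plaque k (\<phi> y)" using assms foliated_chartD(12)[OF ch] by auto
  then show ?thesis unfolding prong_plaque_def prong_height_def
    using connected_component_in by fastforce
qed

text \<open>Where \<open>\<Theta>\<close> is injective its inverse is a regular chart: horizontal chords go to sets of
  constant height, and conversely the height is twice the square of the imaginary part, which
  cannot change sign along a path unless it vanishes.\<close>

lemma unfolded_chart:
  assumes z: "\<zeta> \<in> prong_domain" "norm \<zeta> < 1"
  obtains r V \<psi> where "r > 0" "foliated_chart F 2 (\<Theta> \<zeta>) V \<psi>" "V \<subseteq> U" "ball \<zeta> r \<subseteq> prong_domain \<inter> ball 0 1"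
    "V = \<Theta> ` ball \<zeta> r" "\<And>\<xi>. \<xi> \<in> ball \<zeta> r \<Longrightarrow> \<psi> (\<Theta> \<xi>) = (\<xi> - \<zeta>) / of_real r"
proof -
  have "open (prong_domain \<inter> ball 0 1)" using open_prong_domain by auto
  then obtain r0 where r0: "r0 > 0" "ball \<zeta> r0 \<subseteq> prong_domain \<inter> ball 0 1" using z openE by (metis IntI mem_ball_0)
  have z0: "\<zeta> \<noteq> 0" using z prong_domain_nonzero by blast
  \<comment> \<open>Two points with the same image are opposite, and a disc of radius at most \<open>norm \<zeta>\<close> contains no such pair.\<close>
  define r where "r = min r0 (norm \<zeta>)"
  have r: "r > 0" "r \<le> norm \<zeta>" "ball \<zeta> r \<subseteq> prong_domain \<inter> ball 0 1"
    using r0 z0 by (auto simp: r_def)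
  define B where "B = ball \<zeta> r"
  have B: "\<xi> \<in> prong_domain" "norm \<xi> < 1" "\<xi> \<noteq> 0" if "\<xi> \<in> B" for \<xi>
    using subsetD[OF r(3), of \<xi>] that prong_domain_nonzero[of \<xi>] by (auto simp: B_def)
  have zB: "\<zeta> \<in> B" using r by (simp add: B_def)
  have inj: "inj_on (prong_map k u) B"
  proof (rule inj_onI)
    fix \<xi> \<xi>' assume x: "\<xi> \<in> B" "\<xi>' \<in> B" "prong_map k u \<xi> = prong_map k u \<xi>'"
    show "\<xi> = \<xi>'"
    proof (rule ccontr)
      assume "\<xi> \<noteq> \<xi>'"
      then have "\<xi>' = - \<xi>" using prong_map_eq[OF k u B(3) B(3)] x by (metis minus_minus)
      then have "\<zeta> + \<zeta> = (\<zeta> - \<xi>) + (\<zeta> - \<xi>')" by simp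
      then have "norm (\<zeta> + \<zeta>) \<le> norm (\<zeta> - \<xi>) + norm (\<zeta> - \<xi>')" using norm_triangle_ineq by metis
      also have "\<dots> < r + r" using x(1,2) by (intro add_strict_mono) (auto simp: B_def dist_norm)
      also have "\<dots> \<le> norm (\<zeta> + \<zeta>)" using r(2) by (simp flip: mult_2 add: norm_mult)
      finally show False by simp
    qed
  qed
  have cB: "continuous_on B (prong_map k u)"
    using B(1) by (intro continuous_on_subset[OF continuous_prong_map[OF k u]]) auto
  have opn: "open (prong_map k u ` B)"
    using invariance_of_domain[OF cB _ inj] by (simp add: B_def)
  obtain g where g: "homeomorphism B (prong_map k u ` B) (prong_map k u) g"
    using invariance_of_domain_homeomorphism[OF _ cB _ inj] by (auto simp: B_def)
  have gP: "g (prong_map k u \<xi>) = \<xi>" if "\<xi> \<in> B" for \<xi> using g that by (auto simp: homeomorphism_def)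
  have cg: "continuous_on (prong_map k u ` B) g" using g by (auto simp: homeomorphism_def)
  define V where "V = \<Theta> ` B"
  define \<psi> where "\<psi> = (\<lambda>y. (g (\<phi> y) - \<zeta>) / of_real r)"
  define \<chi>' where "\<chi>' = (\<lambda>w. \<Theta> (\<zeta> + of_real r * w))"
  have VU: "V \<subseteq> U" using unfold_prong_mem(1) B by (auto simp: V_def)
  have Veq: "V = {w \<in> U. \<phi> w \<in> prong_map k u ` B}"
  proof (intro equalityI subsetI)
    fix w assume w: "w \<in> {w \<in> U. \<phi> w \<in> prong_map k u ` B}"
    then obtain \<xi> where x: "\<xi> \<in> B" "\<phi> w = prong_map k u \<xi>" by auto
    then have "w = \<Theta> \<xi>" using foliated_chartD(8)[OF ch, of w] w by (simp add: unfold_prong_def)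
    then show "w \<in> V" using x by (auto simp: V_def)
  qed (use unfold_prong_mem(1,2) B in \<open>auto simp: V_def\<close>)
  have \<psi>\<Theta>: "\<psi> (\<Theta> \<xi>) = (\<xi> - \<zeta>) / of_real r" if "\<xi> \<in> B" for \<xi>
    using unfold_prong_mem(2) B that gP by (simp add: \<psi>_def)
  have nB: "norm ((\<xi> - \<zeta>) / of_real r) < 1" if "\<xi> \<in> B" for \<xi>
    using that r(1) by (simp add: B_def dist_norm norm_divide norm_minus_commute)
  have wB: "\<zeta> + of_real r * w \<in> B" if "norm w < 1" for w
    using that r(1) by (simp add: B_def dist_norm norm_mult)
  have "foliated_chart F 2 (\<Theta> \<zeta>) V \<psi>"
  proof (rule foliated_chartI[where \<chi>' = \<chi>'])
    show "open V" unfolding Veq by (rule chart_open_preimage[OF ch opn])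
    show "\<Theta> \<zeta> \<in> V" using zB by (auto simp: V_def)
    show "\<psi> (\<Theta> \<zeta>) = 0" using \<psi>\<Theta>[OF zB] by simp
    show c\<psi>: "continuous_on V \<psi>" unfolding \<psi>_def
      using r(1) by (intro continuous_intros continuous_on_compose2[OF cg]
          continuous_on_subset[OF foliated_chartD(4)[OF ch] VU]) (auto simp: Veq)
    show "continuous_on (ball 0 1) \<chi>'" unfolding \<chi>'_def
      using wB B by (intro continuous_on_compose2[OF continuous_unfold_prong] continuous_intros) auto
    show "\<psi> y \<in> ball 0 1" if "y \<in> V" for y using that \<psi>\<Theta> nB by (auto simp: V_def)
    show "\<chi>' w \<in> V" if "w \<in> ball 0 1" for w using that wB by (auto simp: V_def \<chi>'_def)
    show "\<chi>' (\<psi> y) = y" if "y \<in> V" for y using that \<psi>\<Theta> r(1) by (auto simp: V_def \<chi>'_def)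
    show "\<psi> (\<chi>' w) = w" if "w \<in> ball 0 1" for w using \<psi>\<Theta>[OF wB] that r(1) by (simp add: \<chi>'_def)
    fix y assume "y \<in> V"
    then obtain \<eta> where \<eta>: "\<eta> \<in> B" "y = \<Theta> \<eta>" by (auto simp: V_def)
    have Im\<psi>: "Im (\<psi> (\<Theta> \<xi>)) = (Im \<xi> - Im \<zeta>) / r" if "\<xi> \<in> B" for \<xi> using \<psi>\<Theta>[OF that] by simp
    have pp: "w \<in> {w \<in> V. \<psi> w \<in> prong_plaque 2 (\<psi> y)} \<longleftrightarrow> w \<in> V \<and> Im (\<psi> w) = Im (\<psi> y)" for w
    proof -
      have "norm (\<psi> y) < 1" using \<eta> \<psi>\<Theta> nB by auto
      moreover have "norm (\<psi> w) < 1" if "w \<in> V" for w using that \<psi>\<Theta> nB by (auto simp: V_def)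
      ultimately show ?thesis by (auto simp: prong_plaque_2)
    qed
    show "plaque F V y = {w \<in> V. \<psi> w \<in> prong_plaque 2 (\<psi> y)}"
    proof (intro equalityI subsetI)
      fix w assume "w \<in> {w \<in> V. \<psi> w \<in> prong_plaque 2 (\<psi> y)}"
      then have w: "w \<in> V" "Im (\<psi> w) = Im (\<psi> y)" using pp by blast+
      then obtain \<xi> where \<xi>: "\<xi> \<in> B" "w = \<Theta> \<xi>" by (auto simp: V_def)
      have eq: "Im \<eta> = Im \<xi>" using w(2) Im\<psi> \<eta> \<xi> r(1) by (simp add: divide_simps)
      have seg: "closed_segment \<eta> \<xi> \<subseteq> B" using \<eta> \<xi> by (simp add: B_def closed_segment_subset)
      have "(\<Theta> \<circ> linepath \<eta> \<xi>) 1 \<in> plaque F V ((\<Theta> \<circ> linepath \<eta> \<xi>) 0)"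
      proof (rule plaque_mem_path)
        have lp: "linepath \<eta> \<xi> t \<in> closed_segment \<eta> \<xi>" if "t \<in> closed_segment 0 1" for t
          using linepath_in_path[of t \<eta> \<xi>] that by (simp add: closed_segment_eq_real_ivl)
        show "continuous_on (closed_segment 0 1) (\<Theta> \<circ> linepath \<eta> \<xi>)" unfolding o_def
          using lp seg B by (intro continuous_on_compose2[OF continuous_unfold_prong] continuous_intros) fastforce+
        show "(\<Theta> \<circ> linepath \<eta> \<xi>) ` closed_segment 0 1 \<subseteq> V \<inter> leaf F y"
        proof (rule image_subsetI)
          fix t :: real assume t: "t \<in> closed_segment 0 1"
          have "\<Theta> (linepath \<eta> \<xi> t) \<in> plaque F U (\<Theta> \<eta>)"
            using seg B by (intro chord_in_plaque[OF eq _ lp[OF t]]) auto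
          then show "(\<Theta> \<circ> linepath \<eta> \<xi>) t \<in> V \<inter> leaf F y"
            using plaque_subset[of U "\<Theta> \<eta>"] \<eta>(2) lp[OF t] seg by (auto simp: V_def)
        qed
      qed
      then show "w \<in> plaque F V y" using \<eta> \<xi> by (simp add: linepath_0' linepath_1')
    next
      fix w assume w: "w \<in> plaque F V y"
      then obtain h where h: "path h" "path_image h \<subseteq> leaf F y \<inter> V" "h 0 = y" "h 1 = w"
        by (auto simp: plaque_def path_component_def pathstart_def pathfinish_def)
      have hV: "h t \<in> V" if "t \<in> {0..1}" for t using h(2) that by (auto simp: path_image_def)
      define f where "f = (\<lambda>t. Im (\<psi> (h t)) * r + Im \<zeta>)"
      have cf: "continuous_on {0..1} f" unfolding f_def
        using h(1) hV by (intro continuous_intros continuous_on_compose2[OF c\<psi>]) (auto simp: path_def)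
      have f2: "(f t)\<^sup>2 = (Im \<eta>)\<^sup>2" if t: "t \<in> {0..1}" for t
      proof -
        obtain \<xi> where \<xi>: "\<xi> \<in> B" "h t = \<Theta> \<xi>" using hV[OF t] by (auto simp: V_def)
        have "h t \<in> plaque F U (h 0)"
        proof (rule plaque_mem_path)
          have sub: "closed_segment 0 t \<subseteq> {0..1}" using t by (auto simp: closed_segment_eq_real_ivl)
          then show "continuous_on (closed_segment 0 t) h" using h(1) by (auto simp: path_def intro: continuous_on_subset)
          show "h ` closed_segment 0 t \<subseteq> U \<inter> leaf F y" using sub h(2) VU unfolding path_image_def by blast
        qed
        then have "prong_height k (\<phi> (\<Theta> \<xi>)) = prong_height k (\<phi> (\<Theta> \<eta>))"
          using plaque_height[of y "h t"] h(3) \<eta> \<xi> VU \<open>y \<in> V\<close> by auto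
        then have "(Im \<xi>)\<^sup>2 = (Im \<eta>)\<^sup>2" using unfold_prong_mem(3) B \<eta> \<xi> by simp
        moreover have "f t = Im \<xi>" using Im\<psi>[OF \<xi>(1)] \<xi>(2) r(1) by (simp add: f_def)
        ultimately show ?thesis by simp
      qed
      have conn: "connected (f ` {0..1})" using cf by (intro connected_continuous_image) auto
      have "f ` {0..1} \<subseteq> {Im \<eta>, - Im \<eta>}"
        using f2 unfolding power2_eq_iff by (intro image_subsetI) blast
      then have "finite (f ` {0..1})" using finite_subset by blast
      then obtain a where "f ` {0..1} \<subseteq> {a}" using connected_finite_iff_sing[OF conn] by auto
      then have "f 0 = f 1" by (metis atLeastAtMost_iff image_subset_iff order_refl singletonD zero_le_one)
      then have "Im (\<psi> w) = Im (\<psi> y)" using h r(1) by (simp add: f_def)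
      moreover have "w \<in> V" using hV[of 1] h(4) by simp
      ultimately show "w \<in> {w \<in> V. \<psi> w \<in> prong_plaque 2 (\<psi> y)}" using pp by blast
    qed
  qed
  then show thesis using that[of r V \<psi>] r(1,3) VU \<psi>\<Theta> by (simp add: V_def B_def)
qed

end

text \<open>Every point other than the singularity has a preimage: \<open>\<zeta>\<close> is the principal square root of
  \<open>w\<^sup>k\<close>, which avoids the slit, and \<open>u\<close> corrects the remaining \<open>k\<close>-th root of unity.\<close>

lemma unfold_prong_surj:
  assumes k: "k \<ge> 1" and ch: "foliated_chart F k p U \<phi>" and y: "y \<in> U" "y \<noteq> p"
  obtains u \<zeta> where "u ^ k = -1" "\<zeta> \<in> prong_domain" "norm \<zeta> < 1" "y = unfold_prong U \<phi> k u \<zeta>"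
proof -
  define w where "w = \<phi> y"
  have w0: "w \<noteq> 0" using y foliated_chartD(2,3,5)[OF ch] unfolding w_def by (metis inj_onD)
  have w1: "norm w < 1" using y foliated_chartD(11)[OF ch] by (simp add: w_def)
  define \<zeta> where "\<zeta> = csqrt (w ^ k)"
  have z2: "\<zeta>\<^sup>2 = w ^ k" by (simp add: \<zeta>_def)
  then have z0: "\<zeta> \<noteq> 0" using w0 by auto
  have zd: "\<zeta> \<in> prong_domain"
    using csqrt_principal[of "w ^ k", folded \<zeta>_def] z0 by (auto simp: prong_domain_def complex_eq_iff)
  define e where "e = exp (2 / of_nat k * Ln (\<zeta> / \<i>))"
  define u where "u = w / e"
  have e0: "e \<noteq> 0" by (simp add: e_def)
  have "e ^ k = exp (of_nat k * (2 / of_nat k * Ln (\<zeta> / \<i>)))" by (simp only: e_def exp_of_nat_mult)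
  also have "of_nat k * (2 / of_nat k * Ln (\<zeta> / \<i>)) = 2 * Ln (\<zeta> / \<i>)" using k by simp
  also have "exp (2 * Ln (\<zeta> / \<i>)) = (\<zeta> / \<i>)\<^sup>2" using z0 by (simp only: exp_double) (simp add: exp_Ln)
  finally have "e ^ k = - (w ^ k)" by (simp add: power_divide power_mult_distrib z2)
  then have uk: "u ^ k = -1" using w0 by (simp add: u_def power_divide)
  have pm: "prong_map k u \<zeta> = w" using e0 by (simp add: prong_map_def u_def e_def)
  show thesis
  proof (rule that[OF uk zd])
    show "norm \<zeta> < 1" using prong_map_norm_less[OF k uk z0] pm w1 by simp
    show "y = unfold_prong U \<phi> k u \<zeta>" using pm foliated_chartD(8)[OF ch y(1)] by (simp add: unfold_prong_def w_def)
  qed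
qed

end

section \<open>Leaves have finite length near a singularity\<close>

lemma strict_mono_without_maximum:
  fixes H :: "real \<Rightarrow> real"
  assumes c: "continuous_on {0..d} H" and H0: "H 0 = 0" and Hn: "\<And>t. t \<in> {0..d} \<Longrightarrow> H t \<ge> 0"
    and m: "\<And>t e. 0 < t \<Longrightarrow> t < d \<Longrightarrow> e > 0 \<Longrightarrow> \<exists>s. 0 < s \<and> s < d \<and> \<bar>s - t\<bar> < e \<and> H s > H t"
  shows "strict_mono_on {0..d} H"
proof (rule strict_mono_onI)
  fix a b assume ab: "a \<in> {0..d}" "b \<in> {0..d}" "a < b"
  have cb: "continuous_on {0..b} H" using ab by (intro continuous_on_subset[OF c]) auto
  have int: False if t: "0 < t" "t < b" and mx: "\<And>s. s \<in> {0..b} \<Longrightarrow> H s \<le> H t" for t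
  proof -
    obtain s where "0 < s" "s < d" "\<bar>s - t\<bar> < b - t" "H s > H t" using m[of t "b - t"] t ab by auto
    moreover from this have "s \<in> {0..b}" by (auto simp: abs_less_iff)
    ultimately show False using mx[of s] by auto
  qed
  obtain t where t: "t \<in> {0..b}" "\<And>s. s \<in> {0..b} \<Longrightarrow> H s \<le> H t"
    using continuous_attains_sup[OF compact_Icc _ cb] ab by auto
  have "t = b"
  proof (rule ccontr)
    assume "t \<noteq> b"
    then have "t = 0" using int[OF _ _ t(2)] t(1) by force
    then have "H s \<le> 0" if "s \<in> {0..b}" for s using t(2) H0 that by auto
    then have "H s \<le> H (b / 2)" if "s \<in> {0..b}" for s using that Hn[of "b/2"] ab by fastforce
    then show False using int[of "b/2"] ab by auto
  qed
  show "H a < H b"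
  proof (rule ccontr)
    assume "\<not> H a < H b"
    then have mxa: "H s \<le> H a" if "s \<in> {0..b}" for s using t(2)[OF that] \<open>t = b\<close> by simp
    show False
    proof (cases "a = 0")
      case True
      then have "H s \<le> H (b / 2)" if "s \<in> {0..b}" for s using mxa[OF that] H0 Hn[of "b/2"] ab by fastforce
      then show False using int[of "b/2"] ab by auto
    qed (use int[of a] mxa ab in auto)
  qed
qed

context transverse_pair
begin

text \<open>In a straightened chart the height is \<open>2 (c + r y)\<^sup>2\<close>, where \<open>y\<close> is strictly monotone along a
  transverse arc; so it increases on at least one side, also where the arc crosses a prong (\<open>c = 0\<close>).\<close>

lemma height_no_maximum:
  fixes g :: "real \<Rightarrow> 'a"
  assumes k: "k \<ge> 1" and ch: "foliated_chart G k p U \<phi>"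
    and g: "continuous_on {0..d} g" "inj_on g {0..d}" "g ` {0..d} \<subseteq> leaf F x" "g ` {0..d} \<subseteq> U"
    and reg: "\<And>t. 0 < t \<Longrightarrow> t < d \<Longrightarrow> g t \<notin> singularities F" "\<And>t. 0 < t \<Longrightarrow> t < d \<Longrightarrow> g t \<noteq> p"
    and t: "0 < t" "t < d" and e: "e > 0"
  obtains s where "0 < s" "s < d" "\<bar>s - t\<bar> < e" "prong_height k (\<phi> (g s)) > prong_height k (\<phi> (g t))"
proof -
  have gtU: "g t \<in> U" using g(4) t by (auto simp: image_subset_iff)
  obtain u \<zeta> where u: "u ^ k = -1" and z: "\<zeta> \<in> prong_domain" "norm \<zeta> < 1" and gt: "g t = unfold_prong U \<phi> k u \<zeta>"
    using G.unfold_prong_surj[OF k ch gtU reg(2)[OF t]] .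
  obtain r V \<psi> where r: "r > 0" and V: "foliated_chart G 2 (g t) V \<psi>" "ball \<zeta> r \<subseteq> prong_domain \<inter> ball 0 1"
    and Veq: "V = unfold_prong U \<phi> k u ` ball \<zeta> r"
    and \<psi>: "\<And>\<xi>. \<xi> \<in> ball \<zeta> r \<Longrightarrow> \<psi> (unfold_prong U \<phi> k u \<xi>) = (\<xi> - \<zeta>) / of_real r"
    using G.unfolded_chart[OF k u ch z] gt by metis
  have h: "prong_height k (\<phi> w) = 2 * (Im \<zeta> + r * Im (\<psi> w))\<^sup>2" if w: "w \<in> V" for w
  proof -
    obtain \<xi> where \<xi>: "\<xi> \<in> ball \<zeta> r" "w = unfold_prong U \<phi> k u \<xi>" using w Veq by auto
    then have "\<xi> \<in> prong_domain \<inter> ball 0 1" using V(2) by blast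
    then have "\<xi> \<noteq> 0" "norm \<xi> < 1" using prong_domain_nonzero[of \<xi>] by auto
    then show ?thesis using G.unfold_prong_mem(3)[OF k u ch] \<xi> \<psi> r by simp
  qed
  obtain \<delta> where d: "\<delta> > 0" "g ` ({0..d} \<inter> ball t \<delta>) \<subseteq> V" "inj_on (\<lambda>s. Im (\<psi> (g s))) ({0..d} \<inter> ball t \<delta>)"
    using transversal_injective[OF g(1) is_interval_cc g(2,3) _ reg(1)[OF t] V(1) foliated_chartD(2)[OF V(1)]] t
    by auto
  define \<eta> where "\<eta> = min (min \<delta> e) (min t (d - t)) / 2"
  have \<eta>: "\<eta> > 0" "\<eta> < \<delta>" "\<eta> < e" "\<eta> < t" "\<eta> < d - t" using d e t by (auto simp: \<eta>_def min_def)
  have sub: "{t-\<eta>..t+\<eta>} \<subseteq> {0..d} \<inter> ball t \<delta>" using \<eta> by (auto simp: dist_real_def)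
  have "g ` {t-\<eta>..t+\<eta>} \<subseteq> V" using sub d(2) by blast
  then have cont: "continuous_on {t-\<eta>..t+\<eta>} (\<lambda>s. Im (\<psi> (g s)))"
    using sub by (intro continuous_intros continuous_on_compose2[OF foliated_chartD(4)[OF V(1)]]
        continuous_on_subset[OF g(1)]) auto
  have "(Im (\<psi> (g (t-\<eta>))) < Im (\<psi> (g t)) \<and> Im (\<psi> (g t)) < Im (\<psi> (g (t+\<eta>)))) \<or>
        (Im (\<psi> (g (t+\<eta>))) < Im (\<psi> (g t)) \<and> Im (\<psi> (g t)) < Im (\<psi> (g (t-\<eta>))))"
    using continuous_inj_imp_mono[OF _ _ cont inj_on_subset[OF d(3) sub], of t] \<eta> by auto
  then have ex: "(\<exists>s\<in>{t-\<eta>,t+\<eta>}. Im (\<psi> (g s)) > 0) \<and> (\<exists>s\<in>{t-\<eta>,t+\<eta>}. Im (\<psi> (g s)) < 0)"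
    using foliated_chartD(3)[OF V(1)] by auto
  have "\<exists>s\<in>{t-\<eta>,t+\<eta>}. Im \<zeta> * Im (\<psi> (g s)) \<ge> 0 \<and> Im (\<psi> (g s)) \<noteq> 0"
  proof (cases "Im \<zeta> \<ge> 0")
    case True
    with ex obtain s where "s\<in>{t-\<eta>,t+\<eta>}" "Im (\<psi> (g s)) > 0" by blast
    with True show ?thesis by (intro bexI[of _ s]) auto
  next
    case False
    from ex obtain s where "s\<in>{t-\<eta>,t+\<eta>}" "Im (\<psi> (g s)) < 0" by blast
    with False show ?thesis by (intro bexI[of _ s]) (auto simp: mult_nonpos_nonpos)
  qed
  then obtain s where s: "s\<in>{t-\<eta>,t+\<eta>}" "Im \<zeta> * Im (\<psi> (g s)) \<ge> 0" "Im (\<psi> (g s)) \<noteq> 0" by blast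
  have "s \<in> {t-\<eta>..t+\<eta>}" using s(1) \<eta>(1) by auto
  then have "s \<in> {0..d} \<inter> ball t \<delta>" using sub by blast
  then have sV: "g s \<in> V" using d(2) by blast
  have "r\<^sup>2 * (Im (\<psi> (g s)))\<^sup>2 > 0" "2 * r * (Im \<zeta> * Im (\<psi> (g s))) \<ge> 0" using s r by auto
  then have "(Im \<zeta> + r * Im (\<psi> (g s)))\<^sup>2 > (Im \<zeta>)\<^sup>2"
    by (simp add: power2_sum power_mult_distrib algebra_simps)
  then have "prong_height k (\<phi> (g s)) > prong_height k (\<phi> (g t))"
    using h[OF sV] h[of "g t"] foliated_chartD(2,3)[OF V(1)] by simp
  then show thesis using that[of s] s(1) \<eta> by auto
qed

text \<open>An arc of \<open>F\<close> issuing from \<open>p\<close> stays in one sector of \<open>G\<close>: the height, which vanishes on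
  the prongs of \<open>G\<close>, has no interior maximum and hence increases.  A continuous choice of the
  square root then lifts the arc to the upper half plane.\<close>

lemma lift_to_sector:
  fixes g :: "real \<Rightarrow> 'a"
  assumes k: "k \<ge> 1" and ch: "foliated_chart G k p U \<phi>"
    and g: "continuous_on {0..d} g" "inj_on g {0..d}" "g ` {0..d} \<subseteq> leaf F x" "g ` {0..d} \<subseteq> U"
    and reg: "\<And>t. 0 < t \<Longrightarrow> t < d \<Longrightarrow> g t \<notin> singularities F" and g0: "g 0 = p" and d: "d > 0"
  obtains u \<zeta> where "u ^ k = -1" "continuous_on {0<..d} \<zeta>" "strict_mono_on {0<..d} (\<lambda>t. Im (\<zeta> t))"
    "\<And>t. t \<in> {0<..d} \<Longrightarrow> Im (\<zeta> t) > 0 \<and> norm (\<zeta> t) < 1 \<and> g t = unfold_prong U \<phi> k u (\<zeta> t)"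
proof -
  note C = foliated_chartD[OF ch]
  define W where "W = (\<lambda>t. \<phi> (g t))"
  have cW: "continuous_on {0..d} W" unfolding W_def
    by (intro continuous_on_compose2[OF C(4) g(1)] g)
  define H where "H = (\<lambda>t. prong_height k (W t))"
  have np: "g t \<noteq> p" if "0 < t" "t \<le> d" for t
    using that g0 inj_onD[OF g(2), of t 0] d by auto
  have smH: "strict_mono_on {0..d} H"
  proof (rule strict_mono_without_maximum)
    show "continuous_on {0..d} H" unfolding H_def prong_height_def by (intro continuous_intros cW)
    show "H 0 = 0" using k by (simp add: H_def W_def g0 C(3) prong_height_def)
    show "H t \<ge> 0" for t using complex_Re_le_cmod[of "W t ^ k"] by (simp add: H_def prong_height_def norm_power)
    show "\<exists>s. 0 < s \<and> s < d \<and> \<bar>s - t\<bar> < e \<and> H s > H t" if "0 < t" "t < d" "e > 0" for t e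
      using height_no_maximum[OF k ch g reg _ that] np unfolding H_def W_def by (metis less_imp_le)
  qed
  have Hpos: "H t > 0" if "t \<in> {0<..d}" for t
  proof -
    have "H 0 < H t" using smH that by (auto simp: strict_mono_on_def)
    moreover have "H 0 = 0" using k by (simp add: H_def W_def g0 C(3) prong_height_def)
    ultimately show ?thesis by simp
  qed
  have nonpos: "- (W t ^ k) \<notin> \<real>\<^sub>\<le>\<^sub>0" if "t \<in> {0<..d}" for t
  proof
    assume "- (W t ^ k) \<in> \<real>\<^sub>\<le>\<^sub>0"
    then obtain r where r: "r \<ge> 0" "W t ^ k = of_real r" 
      by (metis add.inverse_inverse neg_0_le_iff_le nonpos_Reals_cases of_real_minus)
    then have "norm (W t) ^ k = Re (W t ^ k)" by (metis Re_complex_of_real abs_of_nonneg norm_of_real norm_power)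
    then have "H t = 0" by (simp add: H_def prong_height_def)
    then show False using Hpos[OF that] by simp
  qed
  define E where "E = (\<lambda>t. exp (Ln (- (W t ^ k)) / 2))"
  define \<zeta> where "\<zeta> = (\<lambda>t. \<i> * E t)"
  define u where "u = (\<lambda>t. W t / exp (Ln (- (W t ^ k)) / of_nat k))"
  have cW': "continuous_on {0<..d} W" by (rule continuous_on_subset[OF cW]) auto
  have W0: "W t \<noteq> 0" if "t \<in> {0<..d}" for t using nonpos[OF that] k by auto
  have c\<zeta>: "continuous_on {0<..d} \<zeta>" unfolding \<zeta>_def E_def
    using nonpos by (intro continuous_intros cW') auto
  have cu: "continuous_on {0<..d} u" unfolding u_def
    using nonpos k by (intro continuous_intros cW') auto
  have uk: "u t ^ k = -1" if t: "t \<in> {0<..d}" for t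
  proof -
    have "exp (Ln (- (W t ^ k)) / of_nat k) ^ k = exp (of_nat k * (Ln (- (W t ^ k)) / of_nat k))"
      by (simp only: exp_of_nat_mult)
    also have "\<dots> = - (W t ^ k)" using k W0[OF t] by (simp add: exp_Ln)
    finally show ?thesis using W0[OF t] by (simp add: u_def power_divide)
  qed
  have fin: "finite {z :: complex. z ^ k = -1}" using k by (intro finite_nth_roots) simp
  have "u ` {0<..d} \<subseteq> {z. z ^ k = -1}" using uk by auto
  then have "finite (u ` {0<..d})" using fin finite_subset by blast
  moreover have conn: "connected (u ` {0<..d})" using cu by (intro connected_continuous_image) auto
  ultimately obtain u0 where "u ` {0<..d} \<subseteq> {u0}" using connected_finite_iff_sing[OF conn] by auto
  then have u0: "u t = u0" if "t \<in> {0<..d}" for t using that by blast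
  have LnE: "Ln (E t) = Ln (- (W t ^ k)) / 2 \<and> Re (E t) > 0" if t: "t \<in> {0<..d}" for t
  proof -
    have "- (W t ^ k) \<noteq> 0" using W0[OF t] by simp
    then have b: "- pi < Im (Ln (- (W t ^ k)))" "Im (Ln (- (W t ^ k))) < pi"
      using mpi_less_Im_Ln Im_Ln_less_pi[OF nonpos[OF t]] by blast+
    have "Ln (E t) = Ln (- (W t ^ k)) / 2" unfolding E_def using b by (intro Ln_exp) auto
    moreover have "Re (E t) > 0" unfolding E_def Re_exp using b by (simp add: cos_gt_zero_pi)
    ultimately show ?thesis by simp
  qed
  have pm: "prong_map k u0 (\<zeta> t) = W t" if t: "t \<in> {0<..d}" for t
  proof -
    have "prong_map k u0 (\<zeta> t) = u t * exp (2 / of_nat k * Ln (E t))"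
      using u0[OF t] by (simp add: prong_map_def \<zeta>_def)
    also have "2 / of_nat k * Ln (E t) = Ln (- (W t ^ k)) / of_nat k"
      using conjunct1[OF LnE[OF t]] by (simp only:) simp
    finally show ?thesis by (simp add: u_def)
  qed
  have u0k: "u0 ^ k = -1" using uk[of d] u0[of d] d by simp
  have Im\<zeta>: "Im (\<zeta> t) > 0" if "t \<in> {0<..d}" for t using LnE[OF that] by (simp add: \<zeta>_def)
  have H\<zeta>: "H t = 2 * (Im (\<zeta> t))\<^sup>2" if t: "t \<in> {0<..d}" for t
  proof -
    have "\<zeta> t \<noteq> 0" using Im\<zeta>[OF t] by auto
    then show ?thesis using prong_map_height[OF k u0k, of "\<zeta> t"] pm[OF t] by (simp add: H_def)
  qed
  show thesis
  proof (rule that[OF u0k c\<zeta>])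
    show "strict_mono_on {0<..d} (\<lambda>t. Im (\<zeta> t))"
    proof (rule strict_mono_onI)
      fix s t assume st: "s \<in> {0<..d}" "t \<in> {0<..d}" "s < t"
      have "H s < H t" using smH st by (auto simp: strict_mono_on_def)
      then show "Im (\<zeta> s) < Im (\<zeta> t)" using H\<zeta> st Im\<zeta>[OF st(2)] power2_less_imp_less by fastforce
    qed
    fix t assume t: "t \<in> {0<..d}"
    have "\<zeta> t \<noteq> 0" using Im\<zeta>[OF t] by auto
    moreover have gU: "g t \<in> U" using g(4) t by (auto simp: image_subset_iff)
    moreover have "norm (W t) < 1" using C(11)[OF gU] by (simp add: W_def)
    ultimately have "norm (\<zeta> t) < 1" using prong_map_norm_less[OF k u0k] pm[OF t] by metis
    moreover have "g t = unfold_prong U \<phi> k u0 (\<zeta> t)" using pm[OF t] C(8)[OF gU] by (simp add: unfold_prong_def W_def)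
    ultimately show "Im (\<zeta> t) > 0 \<and> norm (\<zeta> t) < 1 \<and> g t = unfold_prong U \<phi> k u0 (\<zeta> t)"
      using Im\<zeta>[OF t] by simp
  qed
qed

text \<open>The imaginary part of \<open>\<zeta>\<close> is a transverse coordinate in every straightened chart.  Points on the
  real axis are allowed: they lie on the prongs.\<close>

lemma rising_curve_transverse:
  fixes z :: "real \<Rightarrow> complex"
  assumes k: "k \<ge> 1" and u: "u ^ k = -1" and ch: "foliated_chart G k p U \<phi>"
    and c: "continuous_on {0..1} z" and D: "\<And>t. t \<in> {0..1} \<Longrightarrow> z t \<in> prong_domain \<and> norm (z t) < 1 \<and> Im (z t) \<ge> 0"
    and m: "strict_mono_on {0..1} (\<lambda>t. Im (z t))"
  shows "transverse_arc G (\<lambda>t. unfold_prong U \<phi> k u (z t))"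
  unfolding transverse_arc_def
proof (intro conjI ballI)
  let ?\<Theta> = "unfold_prong U \<phi> k u"
  have nz: "z t \<noteq> 0" if "t \<in> {0..1}" for t using D[OF that] prong_domain_nonzero by blast
  show "arc (\<lambda>t. ?\<Theta> (z t))"
    unfolding arc_def path_def
  proof
    show "continuous_on {0..1} (\<lambda>t. ?\<Theta> (z t))"
      using D by (intro continuous_on_compose2[OF G.continuous_unfold_prong[OF k u ch] c]) auto
    show "inj_on (\<lambda>t. ?\<Theta> (z t)) {0..1}"
    proof (rule inj_onI)
      fix s t :: real assume st: "s \<in> {0..1}" "t \<in> {0..1}" "?\<Theta> (z s) = ?\<Theta> (z t)"
      then have "z s = z t \<or> z s = - z t" using G.unfold_prong_eq[OF k u ch] nz D by blast
      then have "Im (z s) = Im (z t)" using D[OF st(1)] D[OF st(2)] by auto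
      then show "s = t" using m st by (metis (no_types, lifting) linorder_neqE less_irrefl strict_mono_onD)
    qed
  qed
  have chart: "\<exists>r V \<psi>. r > 0 \<and> foliated_chart G 2 (?\<Theta> (z t)) V \<psi> \<and> V = ?\<Theta> ` ball (z t) r \<and>
      (\<forall>\<xi>\<in>ball (z t) r. \<psi> (?\<Theta> \<xi>) = (\<xi> - z t) / of_real r)" if "t \<in> {0..1}" for t
    using G.unfolded_chart[OF k u ch, of "z t"] D[OF that] by metis
  show "path_image (\<lambda>t. ?\<Theta> (z t)) \<inter> singularities G = {}"
    using chart unfolding path_image_def singularities_def prongs_def by fastforce
  fix t :: real assume t: "t \<in> {0..1}"
  obtain r V \<psi> where r: "r > 0" and V: "foliated_chart G 2 (?\<Theta> (z t)) V \<psi>" "V = ?\<Theta> ` ball (z t) r"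
    and \<psi>: "\<And>\<xi>. \<xi> \<in> ball (z t) r \<Longrightarrow> \<psi> (?\<Theta> \<xi>) = (\<xi> - z t) / of_real r"
    using chart[OF t] by blast
  obtain e where e: "e > 0" "\<And>s. s \<in> {0..1} \<Longrightarrow> \<bar>s - t\<bar> < e \<Longrightarrow> z s \<in> ball (z t) r"
    using nearby_parameters[OF c t open_ball, of "z t" r] r by auto
  have zb: "z s \<in> ball (z t) r" if "s \<in> {0..1} \<inter> ball t e" for s
    using e(2)[of s] that by (auto simp: dist_real_def)
  have "strict_mono_on ({0..1} \<inter> ball t e) (\<lambda>s. Im (\<psi> (?\<Theta> (z s))))"
  proof (rule strict_mono_onI)
    fix s s' assume s: "s \<in> {0..1} \<inter> ball t e" "s' \<in> {0..1} \<inter> ball t e" "s < s'"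
    then have "Im (z s) < Im (z s')" using m by (auto simp: strict_mono_on_def)
    then show "Im (\<psi> (?\<Theta> (z s))) < Im (\<psi> (?\<Theta> (z s')))"
      using \<psi>[OF zb[OF s(1)]] \<psi>[OF zb[OF s(2)]] r by (simp add: divide_strict_right_mono)
  qed
  moreover have "(\<lambda>t. ?\<Theta> (z t)) ` ({0..1} \<inter> ball t e) \<subseteq> V" using zb V(2) by auto
  ultimately show "\<exists>V \<psi> e. foliated_chart G 2 (?\<Theta> (z t)) V \<psi> \<and> e > 0 \<and> (\<lambda>t. ?\<Theta> (z t)) ` ({0..1} \<inter> ball t e) \<subseteq> V \<and>
        (strict_mono_on ({0..1} \<inter> ball t e) (\<lambda>s. Im (\<psi> (?\<Theta> (z s)))) \<or>
         strict_mono_on ({0..1} \<inter> ball t e) (\<lambda>s. - Im (\<psi> (?\<Theta> (z s)))))"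
    using V(1) e(1) by blast
qed

end

locale measured_pair = transverse_pair F G for F G :: "'a::t2_space set set" +
  fixes A :: "'a atlas" and \<mu> :: "'a set \<Rightarrow> ennreal"
  assumes measured: "measured_foliation A G \<mu>"
begin

text \<open>This makes monotonicity and subadditivity available for \<open>\<mu>\<close> on one transverse arc.\<close>

lemma arc_measure:
  assumes "transverse_arc G g"
  obtains N where "\<And>X. compact X \<Longrightarrow> X \<subseteq> path_image g \<Longrightarrow> X \<in> sets N \<and> emeasure N X = \<mu> X"
proof -
  let ?M = "sets (restrict_space borel (path_image g))"
  have ms: "measure_space (path_image g) ?M \<mu>" using measured assms by (auto simp: measured_foliation_def)
  then have sa: "sigma_algebra (path_image g) ?M" and p: "positive ?M \<mu>" "countably_additive ?M \<mu>"
    by (auto simp: measure_space_def)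
  show thesis
  proof (rule that[of "measure_of (path_image g) ?M \<mu>"])
    fix X :: "'a set" assume X: "compact X" "X \<subseteq> path_image g"
    then have "X \<in> sets borel" by (intro borel_closed compact_imp_closed)
    then have "X \<in> ?M" using X by (auto simp: sets_restrict_space)
    then show "X \<in> sets (measure_of (path_image g) ?M \<mu>) \<and> emeasure (measure_of (path_image g) ?M \<mu>) X = \<mu> X"
      using emeasure_measure_of_sigma[OF sa p] sigma_algebra.sets_measure_of_eq[OF sa] by auto
  qed
qed

lemma measure_mono:
  assumes "transverse_arc G g" "compact X" "compact Y" "X \<subseteq> Y" "Y \<subseteq> path_image g"
  shows "\<mu> X \<le> \<mu> Y"
proof -
  obtain N where N: "\<And>X. compact X \<Longrightarrow> X \<subseteq> path_image g \<Longrightarrow> X \<in> sets N \<and> emeasure N X = \<mu> X"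
    using arc_measure[OF assms(1)] by blast
  then show ?thesis using emeasure_mono[of X Y N] assms by (metis subset_trans)
qed

lemma measure_subadditive:
  assumes "transverse_arc G g" "compact X" "compact Y" "X \<union> Y \<subseteq> path_image g"
  shows "\<mu> (X \<union> Y) \<le> \<mu> X + \<mu> Y"
proof -
  obtain N where N: "\<And>X. compact X \<Longrightarrow> X \<subseteq> path_image g \<Longrightarrow> X \<in> sets N \<and> emeasure N X = \<mu> X"
    using arc_measure[OF assms(1)] by blast
  have "emeasure N (X \<union> Y) \<le> emeasure N X + emeasure N Y"
    using N assms by (intro emeasure_subadditive) auto
  then show ?thesis using N[of X] N[of Y] N[of "X \<union> Y"] assms compact_Un[of X Y] by auto
qed

lemma measure_arc_finite: "transverse_arc G g \<Longrightarrow> \<mu> (path_image g) < \<infinity>"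
  and measure_arc_positive: "transverse_arc G g \<Longrightarrow> \<mu> (path_image g) > 0"
  using measured by (auto simp: measured_foliation_def)

text \<open>In the lifted sector all arcs \<open>g ` {\<epsilon>..\<delta>}\<close> slide along \<open>G\<close> onto parts of one compact
  vertical segment, which starts on a prong of \<open>G\<close> away from \<open>p\<close>.\<close>

lemma bounded_measure_near_start:
  assumes g: "arc g" "path_image g \<subseteq> leaf F p" "g 0 = p" and reg: "\<And>t. t \<in> {0<..1} \<Longrightarrow> g t \<notin> singularities F"
  obtains \<delta> M where "0 < \<delta>" "\<delta> \<le> 1" "M < \<infinity>" "\<And>\<epsilon>. 0 < \<epsilon> \<Longrightarrow> \<epsilon> < \<delta> \<Longrightarrow> \<mu> (g ` {\<epsilon>..\<delta>}) \<le> M"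
proof -
  obtain k where "prongs G p k" using G.foliation by (auto simp: singular_foliation_def)
  then obtain U \<phi> where k: "k \<ge> 1" and ch: "foliated_chart G k p U \<phi>" by (auto simp: prongs_def)
  obtain d0 where d0: "d0 > 0" "\<And>s. s \<in> {0..1} \<Longrightarrow> \<bar>s - 0\<bar> < d0 \<Longrightarrow> g s \<in> U"
    using nearby_parameters[OF arc_continuous[OF g(1)] _ foliated_chartD(1)[OF ch], of 0]
      foliated_chartD(2)[OF ch] g(3) by auto
  define d where "d = min 1 (d0 / 2)"
  have d: "0 < d" "d \<le> 1" "d < d0" using d0(1) by (auto simp: d_def)
  have sub: "{0..d} \<subseteq> {0..1}" using d by auto
  have gd: "continuous_on {0..d} g" "inj_on g {0..d}" "g ` {0..d} \<subseteq> leaf F p" "g ` {0..d} \<subseteq> U"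
    "\<And>t. 0 < t \<Longrightarrow> t < d \<Longrightarrow> g t \<notin> singularities F"
    using continuous_on_subset[OF arc_continuous[OF g(1)] sub] inj_on_subset[OF arc_inj[OF g(1)] sub]
      g(2) sub d0(2) d reg by (auto simp: path_image_def)
  obtain u \<zeta> where u: "u ^ k = -1" and c\<zeta>: "continuous_on {0<..d} \<zeta>"
    and m\<zeta>: "strict_mono_on {0<..d} (\<lambda>t. Im (\<zeta> t))"
    and \<zeta>: "\<And>t. t \<in> {0<..d} \<Longrightarrow> Im (\<zeta> t) > 0 \<and> norm (\<zeta> t) < 1 \<and> g t = unfold_prong U \<phi> k u (\<zeta> t)"
    using lift_to_sector[OF k ch gd g(3) d(1)] by blast
  let ?\<Theta> = "unfold_prong U \<phi> k u"
  define v where "v = Im (\<zeta> d)"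
  have v: "0 < v" "v < 1" using \<zeta>[of d] d(1) abs_Im_le_cmod[of "\<zeta> d"] by (auto simp: v_def)
  \<comment> \<open>The abscissa of the vertical segment: positive, and small enough for the segment to stay in the disc.\<close>
  define c where "c = (1 - v) / 2"
  have c: "0 < c" "c + v < 1" using v by (auto simp: c_def field_simps)
  have nc: "norm (Complex c b) < 1" if "0 \<le> b" "b \<le> v" for b
    using cmod_le[of "Complex c b"] that c by simp
  define \<sigma> where "\<sigma> = (\<lambda>t. ?\<Theta> (Complex c (v * t)))"
  have t\<sigma>: "transverse_arc G \<sigma>" unfolding \<sigma>_def
  proof (rule rising_curve_transverse[OF k u ch])
    show "continuous_on {0..1} (\<lambda>t. Complex c (v * t))" by (intro continuous_intros)
    show "Complex c (v * t) \<in> prong_domain \<and> norm (Complex c (v * t)) < 1 \<and> Im (Complex c (v * t)) \<ge> 0" if "t \<in> {0..1}" for t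
      using nc[of "v * t"] that v c by (auto simp: prong_domain_def mult_left_le)
    show "strict_mono_on {0..1} (\<lambda>t. Im (Complex c (v * t)))" using v by (auto simp: strict_mono_on_def)
  qed
  have c\<sigma>: "compact (path_image \<sigma>)" using t\<sigma> by (intro compact_path_image arc_imp_path) (auto simp: transverse_arc_def)
  show thesis
  proof (rule that[OF d(1,2)])
    show "\<mu> (path_image \<sigma>) < \<infinity>" using measure_arc_finite[OF t\<sigma>] .
    fix \<epsilon> assume e: "0 < \<epsilon>" "\<epsilon> < d"
    define \<tau> where "\<tau> = (\<lambda>t. \<epsilon> + (d - \<epsilon>) * t)"
    have \<tau>: "\<tau> t \<in> {0<..d}" if "t \<in> {0..1}" for t
    proof -
      have "(d - \<epsilon>) * t \<le> d - \<epsilon>" "(d - \<epsilon>) * t \<ge> 0" using that e by (auto intro: mult_left_le)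
      then show ?thesis using e unfolding \<tau>_def greaterThanAtMost_iff by linarith
    qed
    have \<tau>im: "\<tau> ` {0..1} = {\<epsilon>..d}"
      using affine_image_unit[of \<epsilon> d] e by (simp add: \<tau>_def closed_segment_eq_real_ivl)
    define Z where "Z = (\<lambda>s t. of_real (1 - s) * \<zeta> (\<tau> t) + of_real s * Complex c (Im (\<zeta> (\<tau> t))))"
    have ImZ: "Im (Z s t) = Im (\<zeta> (\<tau> t))" for s t by (simp add: Z_def algebra_simps)
    have mono: "Im (\<zeta> (\<tau> t)) \<le> v" if "t \<in> {0..1}" for t
      using strict_mono_on_leD[OF m\<zeta> \<tau>[OF that], of d] \<tau>[OF that] d(1) by (simp add: v_def)
    have Zseg: "Z s t \<in> closed_segment (\<zeta> (\<tau> t)) (Complex c (Im (\<zeta> (\<tau> t))))" if "s \<in> {0..1}" for s t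
      using that by (auto simp: in_segment Z_def scaleR_conv_of_real)
    have seg: "closed_segment (\<zeta> (\<tau> t)) (Complex c (Im (\<zeta> (\<tau> t)))) \<subseteq> prong_domain \<inter> ball 0 1"
      if t: "t \<in> {0..1}" for t
    proof -
      have z: "\<zeta> (\<tau> t) \<in> {z. Im z > 0} \<inter> ball 0 1" using \<zeta>[OF \<tau>[OF t]] by simp
      moreover have "Complex c (Im (\<zeta> (\<tau> t))) \<in> {z. Im z > 0} \<inter> ball 0 1" using z nc mono[OF t] by auto
      moreover have "convex ({z. Im z > 0} \<inter> ball (0::complex) 1)"
        by (intro convex_Int convex_ball convex_halfspace_Im_gt)
      ultimately have "closed_segment (\<zeta> (\<tau> t)) (Complex c (Im (\<zeta> (\<tau> t)))) \<subseteq> {z. Im z > 0} \<inter> ball 0 1"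
        by (intro closed_segment_subset)
      then show ?thesis by (auto simp: prong_domain_def)
    qed
    have ZD: "Z s t \<in> prong_domain \<inter> ball 0 1" if "s \<in> {0..1}" "t \<in> {0..1}" for s t
      using Zseg seg that by blast
    \<comment> \<open>\<open>Z\<close> slides the lifted arc horizontally onto the vertical segment.\<close>
    define H where "H = (\<lambda>s t. ?\<Theta> (Z s t))"
    have iso: "leaf_preserving_isotopy G H"
      unfolding leaf_preserving_isotopy_def
    proof (intro conjI ballI)
      have c\<tau>: "continuous_on X (\<lambda>x. \<zeta> (\<tau> (snd x)))" if "X = {0..1} \<times> {0..1}" for X :: "(real \<times> real) set"
        using \<tau> that by (intro continuous_on_compose2[OF c\<zeta>]) (auto simp: \<tau>_def intro!: continuous_intros)
      show "continuous_on ({0..1} \<times> {0..1}) (\<lambda>(s, t). H s t)"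
        unfolding case_prod_unfold H_def
      proof (rule continuous_on_compose2[OF G.continuous_unfold_prong[OF k u ch]])
        show "continuous_on ({0..1} \<times> {0..1}) (\<lambda>x. Z (fst x) (snd x))"
          unfolding Z_def Complex_eq by (intro continuous_intros c\<tau> refl)
      qed (use ZD in auto)
      fix s :: real assume s: "s \<in> {0..1}"
      show "transverse_arc G (H s)" unfolding H_def
      proof (rule rising_curve_transverse[OF k u ch])
        have "continuous_on {0..1} (\<lambda>t. \<zeta> (\<tau> t))"
          using \<tau> by (intro continuous_on_compose2[OF c\<zeta>]) (auto simp: \<tau>_def intro!: continuous_intros)
        then show "continuous_on {0..1} (Z s)"
          unfolding Z_def Complex_eq by (intro continuous_intros)
        show "Z s t \<in> prong_domain \<and> norm (Z s t) < 1 \<and> Im (Z s t) \<ge> 0" if "t \<in> {0..1}" for t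
          using ZD[OF s that] \<zeta>[OF \<tau>[OF that]] by (simp add: ImZ)
        show "strict_mono_on {0..1} (\<lambda>t. Im (Z s t))"
        proof (rule strict_mono_onI)
          fix a b :: real assume ab: "a \<in> {0..1}" "b \<in> {0..1}" "a < b"
          then have "\<tau> a < \<tau> b" using e by (simp add: \<tau>_def)
          then show "Im (Z s a) < Im (Z s b)" using m\<zeta> \<tau> ab by (auto simp: ImZ strict_mono_on_def)
        qed
      qed
    next
      fix t :: real assume t: "t \<in> {0..1}"
      show "\<exists>L\<in>G. \<forall>s\<in>{0..1}. H s t \<in> L"
      proof (intro bexI ballI)
        fix s :: real assume s: "s \<in> {0..1}"
        have "H s t \<in> plaque G U (?\<Theta> (\<zeta> (\<tau> t)))" unfolding H_def
          by (rule G.chord_in_plaque[OF k u ch _ seg[OF t] Zseg[OF s]]) simp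
        then show "H s t \<in> leaf G (?\<Theta> (\<zeta> (\<tau> t)))" using G.plaque_subset by blast
      qed (rule G.leaf_mem)
    qed
    have H0: "path_image (H 0) = g ` {\<epsilon>..d}"
    proof -
      have "H 0 t = g (\<tau> t)" if "t \<in> {0..1}" for t using \<zeta>[OF \<tau>[OF that]] by (simp add: H_def Z_def)
      then show ?thesis unfolding path_image_def \<tau>im[symmetric] by (simp add: image_image)
    qed
    have H1: "path_image (H 1) \<subseteq> path_image \<sigma>"
    proof -
      have "H 1 t = \<sigma> (Im (\<zeta> (\<tau> t)) / v)" "Im (\<zeta> (\<tau> t)) / v \<in> {0..1}" if "t \<in> {0..1}" for t
        using \<zeta>[OF \<tau>[OF that]] mono[OF that] v by (simp_all add: H_def Z_def \<sigma>_def)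
      then show ?thesis unfolding path_image_def by blast
    qed
    have "\<mu> (g ` {\<epsilon>..d}) = \<mu> (path_image (H 1))"
      using measured iso unfolding measured_foliation_def H0[symmetric] by blast
    also have "\<dots> \<le> \<mu> (path_image \<sigma>)"
    proof (rule measure_mono[OF t\<sigma> _ c\<sigma> H1])
      have "arc (H 1)" using iso by (simp add: leaf_preserving_isotopy_def transverse_arc_def)
      then show "compact (path_image (H 1))" by (intro compact_path_image arc_imp_path)
    qed simp
    finally show "\<mu> (g ` {\<epsilon>..d}) \<le> \<mu> (path_image \<sigma>)" .
  qed
qed

end

section \<open>Arcs in a leaf\<close>

text \<open>Two arcs issuing from a point along one prong, expressed without charts.\<close>

definition same_start :: "(real \<Rightarrow> 'a) \<Rightarrow> (real \<Rightarrow> 'a) \<Rightarrow> bool" where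
  "same_start g h \<longleftrightarrow>
     (\<forall>b\<in>{0<..1}. \<exists>a\<in>{0<..1}. g ` {0..a} \<subseteq> h ` {0..b}) \<and>
     (\<forall>b\<in>{0<..1}. \<exists>a\<in>{0<..1}. h ` {0..a} \<subseteq> g ` {0..b})"

lemma same_start_sym: "same_start g h \<Longrightarrow> same_start h g"
  unfolding same_start_def by blast

lemma same_start_trans: "same_start g h \<Longrightarrow> same_start h k \<Longrightarrow> same_start g k"
  unfolding same_start_def by (meson subset_trans)

lemma same_start_reparametrized:
  assumes r: "r > 0" and d: "d > 0" "d \<le> 1" and k: "\<And>s. s \<in> {0..d} \<Longrightarrow> k s = g (r * s)"
    and rd: "r * d \<le> 1"
  shows "same_start k g"
  unfolding same_start_def
proof (intro conjI ballI)
  fix b :: real assume b: "b \<in> {0<..1}"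
  define a where "a = min d (b / r)"
  have "r * s \<in> {0..b}" if "s \<in> {0..a}" for s
    using that r by (auto simp: a_def field_simps)
  then have "k ` {0..a} \<subseteq> g ` {0..b}" using k by (force simp: a_def)
  moreover have "a \<in> {0<..1}" using b r d by (auto simp: a_def)
  ultimately show "\<exists>a\<in>{0<..1}. k ` {0..a} \<subseteq> g ` {0..b}" by blast
next
  fix b :: real assume b: "b \<in> {0<..1}"
  define a where "a = r * min d b"
  have "a \<le> r * d" using r by (simp add: a_def)
  then have "a \<le> 1" using rd by linarith
  moreover have "a > 0" using b r d by (simp add: a_def)
  ultimately have a: "a \<in> {0<..1}" by simp
  have "g ` {0..a} \<subseteq> k ` {0..b}"
  proof (rule image_subsetI)
    fix t assume t: "t \<in> {0..a}"
    have "r * min d b \<le> r * d" "r * min d b \<le> r * b" using r by auto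
    then have "t \<le> r * d" "t \<le> r * b" "0 \<le> t" using t unfolding a_def atLeastAtMost_iff by linarith+
    then have "t / r \<in> {0..d}" "t / r \<in> {0..b}" using r by (auto simp: field_simps)
    moreover have "g t = k (t / r)" using k[OF \<open>t / r \<in> {0..d}\<close>] r by simp
    ultimately show "g t \<in> k ` {0..b}" by blast
  qed
  with a show "\<exists>a\<in>{0<..1}. g ` {0..a} \<subseteq> k ` {0..b}" by blast
qed

context foliation
begin

definition leaf_arc :: "'a \<Rightarrow> (real \<Rightarrow> 'a) \<Rightarrow> bool" where
  "leaf_arc x g \<longleftrightarrow> arc g \<and> g 0 = x \<and> path_image g \<subseteq> leaf F x"

lemma leaf_arcD:
  assumes "leaf_arc x g"
  shows "arc g" "g 0 = x" "path_image g \<subseteq> leaf F x" "pathstart g = x" "g ` {0..1} \<subseteq> leaf F x"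
  using assms by (auto simp: leaf_arc_def pathstart_def path_image_def)

text \<open>Plaques of chart centres are stars.\<close>

lemma radial_arc:
  assumes ch: "foliated_chart F k x U \<phi>" and k: "k \<ge> 1" and y: "y \<in> plaque F U x" "y \<noteq> x"
  obtains h where "leaf_arc x h" "h 1 = y" "path_image h \<subseteq> plaque F U x"
proof -
  note C = foliated_chartD[OF ch]
  define w where "w = \<phi> y"
  have yU: "y \<in> U" "w ^ k = of_real (norm w ^ k)" using center_plaque[OF ch k] y(1) by (auto simp: w_def)
  have w0: "w \<noteq> 0" using y(2) yU(1) C(2,3,5) unfolding w_def by (metis inj_onD)
  have w1: "norm w < 1" using C(11)[OF yU(1)] by (simp add: w_def)
  have n: "norm (of_real t * w) < 1" if "t \<in> {0..1}" for t :: real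
    using that w1 mult_left_le_one_le[of "norm w" t] by (simp add: norm_mult)
  define h where "h = (\<lambda>t. inv_into U \<phi> (of_real t * w))"
  have hpl: "h t \<in> plaque F U x" if t: "t \<in> {0..1}" for t
    using C(9,10)[OF n[OF t]] that yU(2) k
    by (auto simp: center_plaque[OF ch k] h_def power_mult_distrib norm_mult)
  have "leaf_arc x h" unfolding leaf_arc_def arc_def
  proof (intro conjI)
    show "path h" unfolding path_def h_def
      using n by (intro continuous_on_compose2[OF C(7)] continuous_intros) auto
    show "inj_on h {0..1}"
    proof (rule inj_onI)
      fix s t :: real assume st: "s \<in> {0..1}" "t \<in> {0..1}" "h s = h t"
      then have "of_real s * w = of_real t * w" using C(9)[OF n[OF st(1)]] C(9)[OF n[OF st(2)]] unfolding h_def by metis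
      then show "s = t" using w0 by simp
    qed
    show "h 0 = x" using C(8)[OF C(2)] C(3) by (simp add: h_def)
    show "path_image h \<subseteq> leaf F x" using hpl plaque_subset[of U x] by (auto simp: path_image_def)
  qed
  moreover have "h 1 = y" using C(8)[OF yU(1)] by (simp add: h_def w_def)
  moreover have "path_image h \<subseteq> plaque F U x" using hpl by (auto simp: path_image_def)
  ultimately show thesis using that by blast
qed

lemma leaf_arc_trans:
  assumes g: "leaf_arc x g" and h: "leaf_arc (g 1) h" and ne: "h 1 \<noteq> x"
  obtains k where "leaf_arc x k" "k 1 = h 1"
proof -
  note G = leaf_arcD[OF g] and H = leaf_arcD[OF h]
  have "g 1 \<in> leaf F x" using G(5) by auto
  then have L: "leaf F (g 1) = leaf F x" by (rule leaf_eq)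
  show thesis
  proof (cases "x \<in> path_image h")
    case True
    then obtain t where t: "t \<in> {0..1}" "h t = x" by (auto simp: path_image_def)
    then have "t \<noteq> 1" using ne by auto
    then have "arc (subarc h t 1)" using arc_subarc_arc[OF H(1) t(1)] by auto
    moreover have "path_image (subarc h t 1) \<subseteq> leaf F x"
      using path_image_subarc_subset[OF t(1), of 1 h] H(3) L by auto
    ultimately show thesis using that[of "subarc h t 1"] t by (auto simp: leaf_arc_def subarc_def)
  next
    case False
    then obtain k where k: "arc k" "pathstart k = pathstart g" "pathfinish k = pathfinish h"
        "path_image k \<subseteq> path_image g \<union> path_image h"
      using arc_splice[OF G(1) H(1)] G(4) H(4) by (metis pathfinish_def)
    moreover have "path_image k \<subseteq> leaf F x" using k(4) G(3) H(3) L by blast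
    ultimately show thesis using that[of k] G(4) by (simp add: leaf_arc_def pathstart_def pathfinish_def)
  qed
qed

lemma leaf_arc_reverse:
  assumes g: "leaf_arc x g" shows "leaf_arc (g 1) (reversepath g)"
proof -
  have "g 1 \<in> leaf F x" using leaf_arcD(5)[OF g] by auto
  then show ?thesis using leaf_arcD[OF g] arc_reversepath leaf_eq
    by (auto simp: leaf_arc_def reversepath_def path_image_reversepath[unfolded reversepath_def])
qed

text \<open>Being joined by an arc of the leaf is an equivalence relation, by splicing, and it is locally
  constant along a path in the leaf, because plaques are stars.\<close>

theorem leaf_arc_exists:
  assumes y: "y \<in> leaf F x" and ne: "y \<noteq> x"
  obtains g where "leaf_arc x g" "g 1 = y"
proof -
  have "path_connected (leaf F x)" using foliation leaf_mem[of x] by (auto simp: singular_foliation_def)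
  then obtain \<pi> where \<pi>: "path \<pi>" "path_image \<pi> \<subseteq> leaf F x" "\<pi> 0 = x" "\<pi> 1 = y"
    using in_leaf y unfolding path_connected_def pathstart_def pathfinish_def by metis
  define R where "R = (\<lambda>s t. \<pi> s = \<pi> t \<or> (\<exists>g. leaf_arc (\<pi> s) g \<and> g 1 = \<pi> t))"
  have "R 0 (1::real)"
  proof (rule connected_equivalence_relation[of "{0..1::real}"])
    fix s t assume "R s t"
    then show "R t s" unfolding R_def
      by (metis leaf_arc_reverse leaf_arcD(2) reversepath_def diff_self)
  next
    fix s t u assume "R s t" "R t u"
    then show "R s u" unfolding R_def by (metis leaf_arc_trans)
  next
    fix t :: real assume t: "t \<in> {0..1}"
    obtain k where "prongs F (\<pi> t) k" using foliation by (auto simp: singular_foliation_def)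
    then obtain U \<phi> where k: "k \<ge> 1" and ch: "foliated_chart F k (\<pi> t) U \<phi>" by (auto simp: prongs_def)
    obtain \<delta> where d: "\<delta> > 0" "\<And>s. s \<in> {0..1} \<Longrightarrow> \<bar>s - t\<bar> < \<delta> \<Longrightarrow> \<pi> s \<in> plaque F U (\<pi> t)"
      using local_plaque[of "{0..1}" \<pi> t x U] \<pi>(1,2) t foliated_chartD(1,2)[OF ch]
      unfolding path_def path_image_def by (metis is_interval_cc)
    show "\<exists>T. openin (top_of_set {0..1}) T \<and> t \<in> T \<and> (\<forall>s\<in>T. R t s)"
    proof (intro exI[of _ "{0..1} \<inter> ball t \<delta>"] conjI ballI)
      fix s assume "s \<in> {0..1} \<inter> ball t \<delta>"
      then have "\<pi> s \<in> plaque F U (\<pi> t)" using d(2) by (auto simp: dist_real_def)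
      then show "R t s" unfolding R_def using radial_arc[OF ch k] by metis
    qed (use t d in auto)
  qed auto
  then show thesis using that \<pi> ne by (auto simp: R_def)
qed

text \<open>In a chart centred at \<open>x\<close> the plaque of \<open>x\<close> consists of finitely many radii, whence an arc
  issuing from \<open>x\<close> starts along one of them.\<close>

lemma finitely_many_starts:
  obtains d :: "(real \<Rightarrow> 'a) \<Rightarrow> complex" and D where "finite D" "\<And>g. leaf_arc x g \<Longrightarrow> d g \<in> D"
    "\<And>g h. leaf_arc x g \<Longrightarrow> leaf_arc x h \<Longrightarrow> d g = d h \<Longrightarrow> same_start g h"
    "\<And>g h. leaf_arc x g \<Longrightarrow> leaf_arc x h \<Longrightarrow> d g \<noteq> d h \<Longrightarrow> \<exists>a\<in>{0<..1}. g ` {0<..a} \<inter> h ` {0<..a} = {}"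
proof -
  obtain k where "prongs F x k" using foliation by (auto simp: singular_foliation_def)
  then obtain U \<phi> where k: "k \<ge> 1" and ch: "foliated_chart F k x U \<phi>" by (auto simp: prongs_def)
  note C = foliated_chartD[OF ch]
  define along where "along = (\<lambda>(g :: real \<Rightarrow> 'a) e a. \<forall>t\<in>{0<..a}. g t \<in> U \<and> \<phi> (g t) \<noteq> 0 \<and> \<phi> (g t) = e * of_real (norm (\<phi> (g t))))"
  define D where "D = {z :: complex. z ^ k = 1}"
  have ex: "\<exists>e\<in>D. \<exists>a\<in>{0<..1}. along g e a" if g: "leaf_arc x g" for g :: "real \<Rightarrow> 'a"
  proof -
    note G = leaf_arcD[OF g]
    obtain \<delta> where \<delta>: "\<delta> > 0" "\<And>s. s \<in> {0..1} \<Longrightarrow> \<bar>s - 0\<bar> < \<delta> \<Longrightarrow> g s \<in> plaque F U (g 0)"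
      using local_plaque[OF arc_continuous[OF G(1)] is_interval_cc, of 0 x U] G(2,5) C(1,2) by auto
    define a where "a = min 1 (\<delta> / 2)"
    have a: "a \<in> {0<..1}" "a < \<delta>" using \<delta>(1) by (auto simp: a_def)
    have pl: "g t \<in> U \<and> \<phi> (g t) ^ k = of_real (norm (\<phi> (g t)) ^ k)" if "t \<in> {0..a}" for t
    proof -
      have "g t \<in> plaque F U x" using \<delta>(2)[of t] a that G(2) by auto
      then show ?thesis using center_plaque[OF ch k] by blast
    qed
    have nz: "\<phi> (g t) \<noteq> 0" if "t \<in> {0<..a}" for t
    proof
      assume "\<phi> (g t) = 0"
      then have "g t = g 0" using C(2,3) pl[of t] that G(2) inj_onD[OF C(5), of "g t" "g 0"] by auto
      then show False using inj_onD[OF arc_inj[OF G(1)], of t 0] that a by auto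
    qed
    define e where "e = (\<lambda>t. \<phi> (g t) / of_real (norm (\<phi> (g t))))"
    have eD: "e t \<in> D" if "t \<in> {0<..a}" for t
      using pl[of t] nz[OF that] that by (simp add: D_def e_def power_divide)
    have sub: "{0<..a} \<subseteq> {0..1}" using a by auto
    have "continuous_on {0<..a} e" unfolding e_def
      using nz pl by (intro continuous_intros continuous_on_compose2[OF C(4)]
          continuous_on_subset[OF arc_continuous[OF G(1)] sub]) auto
    then have conn: "connected (e ` {0<..a})" by (intro connected_continuous_image) auto
    have "finite D" using k by (auto simp: D_def)
    then have "finite (e ` {0<..a})" using eD by (meson finite_subset image_subsetI)
    then obtain e0 where "e ` {0<..a} \<subseteq> {e0}" using connected_finite_iff_sing[OF conn] by auto
    then have e0: "e t = e0" if "t \<in> {0<..a}" for t using that by blast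
    have "along g e0 a" unfolding along_def
    proof (intro ballI conjI)
      fix t assume t: "t \<in> {0<..a}"
      show "\<phi> (g t) = e0 * of_real (norm (\<phi> (g t)))" using e0[OF t] nz[OF t] by (auto simp: e_def)
    qed (use pl nz in auto)
    moreover have "e0 \<in> D" using eD[of a] e0[of a] a by simp
    ultimately show ?thesis using a by blast
  qed
  define d where "d = (\<lambda>g. SOME e. e \<in> D \<and> (\<exists>a\<in>{0<..1}. along g e a))"
  have d: "d g \<in> D \<and> (\<exists>a\<in>{0<..1}. along g (d g) a)" if "leaf_arc x g" for g
  proof -
    have "\<exists>e. e \<in> D \<and> (\<exists>a\<in>{0<..1}. along g e a)" using ex[OF that] by blast
    then show ?thesis unfolding d_def by (rule someI_ex)
  qed
  have cover: "\<exists>a'\<in>{0<..1}. g ` {0..a'} \<subseteq> h ` {0..b}"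
    if g: "leaf_arc x g" and h: "leaf_arc x h" and a: "a \<in> {0<..1}" "along g e a"
      and b0: "b0 \<in> {0<..1}" "along h e b0" and b: "b \<in> {0<..1}" for g h e a b0 b
  proof -
    note G = leaf_arcD[OF g] and H = leaf_arcD[OF h]
    define b' where "b' = min b b0"
    have b': "0 < b'" "b' \<le> b" "b' \<le> b0" "b' \<le> 1" using b b0 by (auto simp: b'_def)
    define n where "n = (\<lambda>t. norm (\<phi> (h t)))"
    have hU: "h t \<in> U" if "t \<in> {0..b'}" for t
      using that b0(2) b' C(2) H(2) by (cases "t = 0") (auto simp: along_def)
    have cn: "continuous_on {0..b'} n" unfolding n_def
      using hU b' by (intro continuous_intros continuous_on_compose2[OF C(4)]
          continuous_on_subset[OF arc_continuous[OF H(1)]]) auto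
    have n0: "n 0 = 0" using C(3) H(2) by (simp add: n_def)
    have nb: "n b' > 0" using b0(2) b' by (simp add: n_def along_def)
    define N where "N = {w \<in> U. \<phi> w \<in> ball 0 (n b')}"
    have "open N" unfolding N_def by (rule chart_open_preimage[OF ch open_ball])
    moreover have "g 0 \<in> N" using G(2) C(2,3) nb by (simp add: N_def)
    ultimately obtain \<delta> where \<delta>: "\<delta> > 0" "\<And>s. s \<in> {0..1} \<Longrightarrow> \<bar>s - 0\<bar> < \<delta> \<Longrightarrow> g s \<in> N"
      using nearby_parameters[OF arc_continuous[OF G(1)], of 0] by auto
    define a' where "a' = min a (\<delta> / 2)"
    have a': "a' \<in> {0<..1}" "a' < \<delta>" "a' \<le> a" using \<delta>(1) a(1) by (auto simp: a'_def)
    have "g ` {0..a'} \<subseteq> h ` {0..b}"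
    proof (rule image_subsetI)
      fix t assume t: "t \<in> {0..a'}"
      show "g t \<in> h ` {0..b}"
      proof (cases "t = 0")
        case True
        then show ?thesis using G(2) H(2) b image_eqI[of "g t" h 0 "{0..b}"] by auto
      next
        case False
        have gN: "g t \<in> U" "norm (\<phi> (g t)) < n b'" using \<delta>(2)[of t] t a' by (auto simp: N_def)
        then obtain s where s: "s \<in> {0..b'}" "n s = norm (\<phi> (g t))"
          using IVT'[of n 0 "norm (\<phi> (g t))" b'] cn n0 b' by auto
        have al: "\<phi> (g t) = e * of_real (norm (\<phi> (g t)))" "\<phi> (g t) \<noteq> 0"
          using a(2) t False a' unfolding along_def by auto
        have "s \<noteq> 0" using s n0 al by auto
        then have "\<phi> (h s) = e * of_real (n s)" using b0(2) s(1) b' unfolding along_def n_def by auto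
        then have "\<phi> (h s) = \<phi> (g t)" using s(2) al by simp
        then have "h s = g t" using hU[OF s(1)] gN(1) C(5) by (auto dest: inj_onD)
        then show ?thesis using s(1) b'(2) by (metis atLeastAtMost_iff image_eqI order_trans)
      qed
    qed
    then show ?thesis using a' by blast
  qed
  show thesis
  proof (rule that)
    show "finite D" using k by (auto simp: D_def)
    show "d g \<in> D" if "leaf_arc x g" for g using d[OF that] by blast
    show "same_start g h" if gh: "leaf_arc x g" "leaf_arc x h" "d g = d h" for g h
    proof -
      obtain a b where ab: "a \<in> {0<..1}" "along g (d g) a" "b \<in> {0<..1}" "along h (d g) b"
        using d[OF gh(1)] d[OF gh(2)] gh(3) by auto
      show ?thesis unfolding same_start_def
        using cover[OF gh(1,2) ab] cover[OF gh(2,1) ab(3,4,1,2)] by blast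
    qed
    show "\<exists>a\<in>{0<..1}. g ` {0<..a} \<inter> h ` {0<..a} = {}" if gh: "leaf_arc x g" "leaf_arc x h" "d g \<noteq> d h" for g h
    proof -
      obtain a b where a: "a \<in> {0<..1}" "along g (d g) a" and b: "b \<in> {0<..1}" "along h (d h) b"
        using d gh(1,2) by blast
      have "g s \<noteq> h t" if "s \<in> {0<..min a b}" "t \<in> {0<..min a b}" for s t
      proof
        assume eq: "g s = h t"
        have "d g * of_real (norm (\<phi> (g s))) = d h * of_real (norm (\<phi> (g s)))" "\<phi> (g s) \<noteq> 0"
          using a(2) b(2) that eq unfolding along_def by (metis greaterThanAtMost_iff min.bounded_iff)+
        then show False using gh(3) by simp
      qed
      then show ?thesis using a(1) b(1) by (intro bexI[of _ "min a b"]) auto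
    qed
  qed
qed

text \<open>Arcs with the same start are nested: the set of parameters up to which the first one runs
  in the second one is open as long as the end of the second one is not reached.\<close>

lemma same_start_nested:
  assumes g: "leaf_arc x g" and h: "leaf_arc x h" and s: "same_start g h"
    and reg: "\<And>t. t \<in> {0<..1} \<Longrightarrow> g t \<notin> singularities F"
  shows "path_image g \<subseteq> path_image h \<or> path_image h \<subseteq> path_image g"
proof -
  note G = leaf_arcD[OF g] and H = leaf_arcD[OF h]
  define T where "T = {t \<in> {0..1}. g ` {0..t} \<subseteq> path_image h}"
  obtain a where a: "a \<in> {0<..1}" "g ` {0..a} \<subseteq> h ` {0..1}"
    using s[unfolded same_start_def, THEN conjunct1, rule_format, of 1] by auto
  have aT: "a \<in> T" using a by (auto simp: T_def path_image_def)
  define t where "t = Sup T"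
  have bdd: "bdd_above T" by (auto simp: T_def intro!: bdd_aboveI[of _ 1])
  have ta: "a \<le> t" using aT bdd by (simp add: t_def cSup_upper)
  have t1: "t \<le> 1" unfolding t_def using aT by (intro cSup_least) (auto simp: T_def)
  have t0: "0 < t" using ta a by auto
  have below: "g r \<in> path_image h" if r: "0 \<le> r" "r < t" for r
  proof -
    obtain t' where "t' \<in> T" "r < t'" using r(2) aT bdd less_cSup_iff[of T r] by (auto simp: t_def)
    then show ?thesis using r(1) by (auto simp: T_def)
  qed
  have ch: "closed (path_image h)" using H(1) by (intro closed_path_image arc_imp_path)
  have gt: "g t \<in> path_image h"
  proof -
    have "closed ({0..1} \<inter> g -` path_image h)"
      by (intro continuous_closed_preimage arc_continuous G(1) ch closed_atLeastAtMost)
    moreover have "{0..<t} \<subseteq> {0..1} \<inter> g -` path_image h" using below t1 by auto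
    ultimately have "closure {0..<t} \<subseteq> {0..1} \<inter> g -` path_image h" by (rule closure_minimal[rotated])
    moreover have "t \<in> closure {0..<t}" using t0 by simp
    ultimately show ?thesis by blast
  qed
  have sub: "g ` {0..t} \<subseteq> path_image h"
  proof (rule image_subsetI)
    fix r assume "r \<in> {0..t}"
    then show "g r \<in> path_image h" using below[of r] gt by (cases "r = t") auto
  qed
  show ?thesis
  proof (cases "t = 1")
    case True
    then show ?thesis using sub by (simp add: path_image_def)
  next
    case False
    then have t1: "t < 1" using t1 by simp
    obtain s where s: "s \<in> {0..1}" "h s = g t" using gt by (auto simp: path_image_def)
    have "g t \<noteq> x" using inj_onD[OF arc_inj[OF G(1)], of t 0] t0 t1 G(2) by auto
    then have s0: "s > 0" using s H(2) by (cases "s = 0") auto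
    have "s = 1"
    proof (rule ccontr)
      assume "s \<noteq> 1"
      then have s1: "s < 1" using s by simp
      obtain V \<psi> where V: "foliated_chart F 2 (g t) V \<psi>" using regular_chart[OF reg[of t]] t0 t1 by auto
      obtain N where N: "open N" "h s \<in> N" "plaque F V (h s) \<inter> N \<subseteq> h ` {0..1}"
        using leaf_arc_covers[OF arc_continuous[OF H(1)] arc_inj[OF H(1)] H(5) s0 s1 V]
          foliated_chartD(2)[OF V] s(2) by metis
      obtain \<delta>1 where d1: "\<delta>1 > 0" "\<And>r. r \<in> {0..1} \<Longrightarrow> \<bar>r - t\<bar> < \<delta>1 \<Longrightarrow> g r \<in> plaque F V (g t)"
        using local_plaque[OF arc_continuous[OF G(1)] is_interval_cc _ G(5) foliated_chartD(1)[OF V], of t]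
          foliated_chartD(2)[OF V] t0 t1 by auto
      obtain \<delta>2 where d2: "\<delta>2 > 0" "\<And>r. r \<in> {0..1} \<Longrightarrow> \<bar>r - t\<bar> < \<delta>2 \<Longrightarrow> g r \<in> N"
        using nearby_parameters[OF arc_continuous[OF G(1)] _ N(1), of t] N(2) s(2) t0 t1 by auto
      define t' where "t' = t + min (min \<delta>1 \<delta>2) (1 - t) / 2"
      have t': "t < t'" "t' \<le> 1" "t' - t < \<delta>1" "t' - t < \<delta>2"
        using d1(1) d2(1) t1 by (auto simp: t'_def min_def field_simps)
      have "g r \<in> path_image h" if r: "r \<in> {0..t'}" for r
      proof (cases "r \<le> t")
        case True
        then show ?thesis using sub r by auto
      next
        case False
        then have "r \<in> {0..1}" "\<bar>r - t\<bar> < \<delta>1" "\<bar>r - t\<bar> < \<delta>2" using r t' by auto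
        then have "g r \<in> plaque F V (h s) \<inter> N" using d1(2) d2(2) s(2) by simp
        then show ?thesis using N(3) by (auto simp: path_image_def)
      qed
      then have "t' \<in> T" using t' t0 by (auto simp: T_def)
      then have "t' \<le> t" using bdd by (simp add: t_def cSup_upper)
      then show False using t' by simp
    qed
    have "connected (g ` {0..t})"
      using t1 by (intro connected_continuous_image continuous_on_subset[OF arc_continuous[OF G(1)]]) auto
    moreover have "h 0 \<in> g ` {0..t}" using G(2) H(2) t0 image_eqI[of "h 0" g 0 "{0..t}"] by auto
    moreover have "h 1 \<in> g ` {0..t}" using s(2) \<open>s = 1\<close> t0 image_eqI[of "h 1" g t "{0..t}"] by auto
    ultimately have "h ` {0..1} \<subseteq> g ` {0..t}" using connected_in_arc[OF H(1) _ sub] by simp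
    moreover have "g ` {0..t} \<subseteq> path_image g" using t1 by (auto simp: path_image_def)
    ultimately show ?thesis by (auto simp: path_image_def)
  qed
qed

end

section \<open>Leaves of a scaled foliation\<close>

text \<open>One half of a generalized pseudo-Anosov homeomorphism: \<open>F\<close> is the stable or the unstable
  foliation, \<open>\<mu>\<close> is the measure transverse to the other one, and \<open>c\<close> is the factor by which \<open>f\<close>
  changes lengths in the leaves of \<open>F\<close>.  The set \<open>P\<close> plays the part of Sing(f).\<close>

locale scaled_foliation = measured_pair F G A \<mu>
  for F G :: "'a::t2_space set set" and A :: "'a atlas" and \<mu> :: "'a set \<Rightarrow> ennreal" +
  fixes f :: "'a \<Rightarrow> 'a" and P :: "'a set" and c :: real
  assumes homeo: "homeomorphism UNIV UNIV f (inv f)"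
    and leaves: "(`) f ` F = F"
    and P: "finite P" "f ` P = P" "singularities F \<subseteq> P"
    and c: "c > 0" "c \<noteq> 1"
    and scaling: "leaf_interval F J \<Longrightarrow> J \<inter> singularities F = {} \<Longrightarrow> \<mu> (f ` J) = ennreal c * \<mu> J"
begin

lemma bij_f: "bij f"
proof (rule bijI)
  show "inj f" using homeo by (intro inj_on_inverseI[of _ "inv f"]) (auto simp: homeomorphism_def)
  show "surj f" using homeo by (auto simp: homeomorphism_def)
qed

lemma continuous_f: "continuous_on X f" and continuous_inv_f: "continuous_on X (inv f)"
  using homeo continuous_on_subset unfolding homeomorphism_def by blast+

lemma continuous_on_f: "continuous_on X g \<Longrightarrow> continuous_on X (\<lambda>x. f (g x))"
  and continuous_on_inv_f: "continuous_on X g \<Longrightarrow> continuous_on X (\<lambda>x. inv f (g x))"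
  using continuous_on_compose2[OF continuous_f[of UNIV]] continuous_on_compose2[OF continuous_inv_f[of UNIV]] by auto

lemma leaf_f: "leaf F (f x) = f ` leaf F x"
proof (rule F.leaf_unique)
  show "f ` leaf F x \<in> F" using leaves F.leaf_mem by blast
  show "f x \<in> f ` leaf F x" using F.in_leaf by blast
qed

lemma P_f: "f x \<in> P \<longleftrightarrow> x \<in> P"
  using P(2) bij_f by (metis bij_is_inj image_iff inj_image_mem_iff)

lemma arc_f: "arc g \<Longrightarrow> arc (f \<circ> g)"
  unfolding arc_def path_def
  by (auto intro!: continuous_on_f comp_inj_on inj_on_subset[OF bij_is_inj[OF bij_f]])

lemma arc_inv_f: "arc g \<Longrightarrow> arc (inv f \<circ> g)"
  unfolding arc_def path_def
  by (auto intro!: continuous_on_inv_f comp_inj_on inj_on_subset[OF bij_is_inj[OF bij_imp_bij_inv[OF bij_f]]])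

lemma leaf_arc_f: "F.leaf_arc x g \<Longrightarrow> F.leaf_arc (f x) (f \<circ> g)"
  unfolding F.leaf_arc_def using arc_f by (auto simp: leaf_f path_image_compose)

lemma leaf_interval_f: "leaf_interval F J \<Longrightarrow> leaf_interval F (f ` J)"
  unfolding leaf_interval_def using arc_f leaves by (metis image_mono path_image_compose imageI)

lemma leaf_interval_inv_f: "leaf_interval F (f ` J) \<Longrightarrow> leaf_interval F J"
proof -
  assume "leaf_interval F (f ` J)"
  then obtain g L where g: "arc g" "path_image g = f ` J" "L \<in> F" "f ` J \<subseteq> L" unfolding leaf_interval_def by blast
  obtain L' where L': "L' \<in> F" "L = f ` L'" using g(3) leaves by blast
  have "arc (inv f \<circ> g)" using g(1) by (rule arc_inv_f)
  moreover have "path_image (inv f \<circ> g) = J"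
    using g(2) bij_f by (simp add: path_image_compose image_image bij_is_inj)
  moreover have "J \<subseteq> L'" using g(4) L'(2) bij_f by (simp add: bij_is_inj inj_image_subset_iff)
  ultimately show ?thesis using L'(1) unfolding leaf_interval_def by blast
qed

lemma same_start_f: "same_start (f \<circ> g) (f \<circ> h) \<longleftrightarrow> same_start g h"
  unfolding same_start_def image_comp[symmetric] inj_image_subset_iff[OF bij_is_inj[OF bij_f]] by simp

lemma leaf_arc_iterate: "F.leaf_arc x g \<Longrightarrow> F.leaf_arc ((f ^^ m) x) ((f ^^ m) \<circ> g)"
  using leaf_arc_f by (induction m) (auto simp: o_assoc[symmetric])

lemma same_start_iterate: "same_start ((f ^^ m) \<circ> g) ((f ^^ m) \<circ> h) \<longleftrightarrow> same_start g h"
  using same_start_f by (induction m) (auto simp: o_assoc[symmetric])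

lemma P_iterate: "(f ^^ m) x \<in> P \<longleftrightarrow> x \<in> P"
  using P_f by (induction m) auto

lemma bij_iterate: "bij (f ^^ m)"
  using bij_f by (rule bij_fn)

subsection \<open>Length\<close>

text \<open>Only arcs off the singularities are measured, so the length of a set that meets \<open>P\<close> is defined by
  exhaustion.\<close>

definition leaf_length :: "'a set \<Rightarrow> ennreal" where
  "leaf_length X = (SUP J\<in>{J. leaf_interval F J \<and> J \<subseteq> X - P}. \<mu> J)"

lemma leaf_length_upper: "leaf_interval F J \<Longrightarrow> J \<subseteq> X - P \<Longrightarrow> \<mu> J \<le> leaf_length X"
  unfolding leaf_length_def by (rule SUP_upper) simp

lemma leaf_length_mono: "X - P \<subseteq> Y \<Longrightarrow> leaf_length X \<le> leaf_length Y"
  unfolding leaf_length_def by (rule SUP_subset_mono) auto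

lemma leaf_length_image: "leaf_length (f ` X) = ennreal c * leaf_length X"
proof -
  have "{J. leaf_interval F J \<and> J \<subseteq> f ` X - P} = (`) f ` {J. leaf_interval F J \<and> J \<subseteq> X - P}"
  proof (intro equalityI subsetI)
    fix K assume "K \<in> {J. leaf_interval F J \<and> J \<subseteq> f ` X - P}"
    then have K: "leaf_interval F K" "K \<subseteq> f ` X - P" by auto
    then obtain J where J: "J \<subseteq> X" "K = f ` J" by (meson Diff_subset subset_imageE subset_trans)
    have "J \<subseteq> X - P" using J K(2) P_f by auto
    then show "K \<in> (`) f ` {J. leaf_interval F J \<and> J \<subseteq> X - P}"
      using K(1) J leaf_interval_inv_f by blast
  qed (use leaf_interval_f P_f in auto)
  then have "leaf_length (f ` X) = (SUP J\<in>{J. leaf_interval F J \<and> J \<subseteq> X - P}. \<mu> (f ` J))"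
    by (simp add: leaf_length_def image_image)
  also have "\<dots> = (SUP J\<in>{J. leaf_interval F J \<and> J \<subseteq> X - P}. ennreal c * \<mu> J)"
    using P(3) by (intro SUP_cong refl scaling) auto
  also have "\<dots> = ennreal c * leaf_length X"
    unfolding leaf_length_def by (rule SUP_mult_left_ennreal[symmetric])
  finally show ?thesis .
qed

lemma measure_leaf_arc:
  assumes g: "arc g" "path_image g \<subseteq> leaf F x" "path_image g \<inter> P = {}"
  shows "\<mu> (path_image g) < \<infinity>" "\<mu> (path_image g) > 0" "transverse_arc G g"
proof -
  show "transverse_arc G g" using leaf_arc_transverse[OF g(1,2)] g(3) P(3) by blast
  then show "\<mu> (path_image g) < \<infinity>" "\<mu> (path_image g) > 0" using measure_arc_finite measure_arc_positive by auto
qed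

lemma leaf_length_positive:
  assumes g: "arc g" "path_image g \<subseteq> leaf F x" "path_image g \<inter> P = {}" "path_image g \<subseteq> X"
  shows "leaf_length X > 0"
proof -
  have "\<mu> (path_image g) \<le> leaf_length X"
    using leaf_length_upper F.leaf_interval_path_image[OF g(1,2)] g(3,4) by blast
  then show ?thesis using measure_leaf_arc(2)[OF g(1-3)] by (rule less_le_trans[rotated])
qed

text \<open>Near its starting point the length is bounded by \<open>bounded_measure_near_start\<close>, and the rest is a
  compact transverse arc.\<close>

lemma tail_bound:
  assumes g: "F.leaf_arc p g" and reg: "\<And>t. t \<in> {0<..1} \<Longrightarrow> g t \<notin> P"
  obtains M where "M < \<infinity>" "\<And>\<epsilon>. 0 < \<epsilon> \<Longrightarrow> \<epsilon> < 1 \<Longrightarrow> \<mu> (g ` {\<epsilon>..1}) \<le> M"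
proof -
  note G = F.leaf_arcD[OF g]
  obtain \<delta> M where d: "0 < \<delta>" "\<delta> \<le> 1" and M: "M < \<infinity>" "\<And>\<epsilon>. 0 < \<epsilon> \<Longrightarrow> \<epsilon> < \<delta> \<Longrightarrow> \<mu> (g ` {\<epsilon>..\<delta>}) \<le> M"
    using bounded_measure_near_start[OF G(1,3,2)] reg P(3) by blast
  have ta: "transverse_arc G (subarc g a 1)" "path_image (subarc g a 1) = g ` {a..1}" if "0 < a" "a < 1" for a
  proof -
    show im: "path_image (subarc g a 1) = g ` {a..1}"
      using that by (simp add: path_image_subarc closed_segment_eq_real_ivl)
    show "transverse_arc G (subarc g a 1)"
    proof (rule measure_leaf_arc(3))
      show "arc (subarc g a 1)" using arc_subarc_arc[OF G(1), of a 1] that by auto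
      show "path_image (subarc g a 1) \<subseteq> leaf F p" using im G(5) that by auto
      show "path_image (subarc g a 1) \<inter> P = {}" using im reg that by auto
    qed
  qed
  have cpt: "compact (g ` {a..b})" if "0 \<le> a" "b \<le> 1" for a b
    using that by (intro compact_continuous_image continuous_on_subset[OF arc_continuous[OF G(1)]]) auto
  define M2 where "M2 = (if \<delta> < 1 then \<mu> (g ` {\<delta>..1}) else 0)"
  show thesis
  proof (rule that[of "M + M2"])
    show "M + M2 < \<infinity>"
      using M(1) ta[OF d(1)] measure_arc_finite unfolding M2_def by (metis ennreal_add_less_top infinity_ennreal_def ennreal_zero_less_top)
    fix \<epsilon> :: real assume e: "0 < \<epsilon>" "\<epsilon> < 1"
    define e' where "e' = min \<epsilon> (\<delta> / 2)"
    have e': "0 < e'" "e' \<le> \<epsilon>" "e' < \<delta>" "e' < 1" using e d by (auto simp: e'_def)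
    have sub: "\<mu> (g ` {\<epsilon>..1}) \<le> \<mu> (g ` {e'..1})"
      using e e' ta[OF e'(1,4)] by (intro measure_mono[OF ta(1)[OF e'(1,4)]] cpt image_mono) auto
    show "\<mu> (g ` {\<epsilon>..1}) \<le> M + M2"
    proof (cases "\<delta> < 1")
      case True
      have eq: "g ` {e'..1} = g ` {e'..\<delta>} \<union> g ` {\<delta>..1}"
        using e' True by (simp add: image_Un[symmetric] ivl_disj_un_two_touch(4))
      have "\<mu> (g ` {e'..1}) \<le> \<mu> (g ` {e'..\<delta>}) + \<mu> (g ` {\<delta>..1})"
        unfolding eq using ta[OF e'(1,4)] eq e' d
        by (intro measure_subadditive[OF ta(1)[OF e'(1,4)]] cpt) auto
      also have "\<dots> \<le> M + M2" using M(2)[OF e'(1,3)] True by (auto simp: M2_def intro: add_mono)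
      finally show ?thesis using sub by (rule order_trans[rotated])
    next
      case False
      then have "\<delta> = 1" using d by simp
      then show ?thesis using M(2)[OF e'(1,3)] sub by (simp add: M2_def)
    qed
  qed
qed

lemma leaf_length_finite:
  assumes g: "F.leaf_arc p g" and p: "p \<in> P" and reg: "\<And>t. t \<in> {0<..1} \<Longrightarrow> g t \<notin> P"
  shows "leaf_length (path_image g) < \<infinity>"
proof -
  note G = F.leaf_arcD[OF g]
  obtain M where M: "M < \<infinity>" "\<And>\<epsilon>. 0 < \<epsilon> \<Longrightarrow> \<epsilon> < 1 \<Longrightarrow> \<mu> (g ` {\<epsilon>..1}) \<le> M"
    using tail_bound[OF g reg] by blast
  have "leaf_length (path_image g) \<le> M" unfolding leaf_length_def
  proof (rule SUP_least)
    fix J assume "J \<in> {J. leaf_interval F J \<and> J \<subseteq> path_image g - P}"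
    then obtain j where j: "arc j" "path_image j = J" and J: "J \<subseteq> path_image g - P"
      by (auto simp: leaf_interval_def)
    have cJ: "compact J" using j by (metis arc_imp_path compact_path_image)
    then have "open (- J)" by (simp add: compact_imp_closed open_Compl)
    moreover have "g 0 \<in> - J" using p G(2) J by auto
    ultimately obtain \<delta> where d: "\<delta> > 0" "\<And>s. s \<in> {0..1} \<Longrightarrow> \<bar>s - 0\<bar> < \<delta> \<Longrightarrow> g s \<in> - J"
      using nearby_parameters[OF arc_continuous[OF G(1)], of 0 "- J"] by auto
    define e where "e = min (\<delta> / 2) (1 / 2)"
    have e: "0 < e" "e < 1" "e < \<delta>" using d(1) by (auto simp: e_def)
    have "J \<subseteq> g ` {e..1}"
    proof
      fix y assume y: "y \<in> J"
      then obtain t where t: "t \<in> {0..1}" "y = g t" using J by (auto simp: path_image_def)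
      then have "t \<ge> e" using d(2)[of t] y e by force
      then show "y \<in> g ` {e..1}" using t by auto
    qed
    moreover have im: "path_image (subarc g e 1) = g ` {e..1}"
      using e by (simp add: path_image_subarc closed_segment_eq_real_ivl)
    moreover have "transverse_arc G (subarc g e 1)"
    proof (rule measure_leaf_arc(3))
      show "arc (subarc g e 1)" using arc_subarc_arc[OF G(1), of e 1] e by auto
      show "path_image (subarc g e 1) \<subseteq> leaf F p" using im G(5) e by auto
      show "path_image (subarc g e 1) \<inter> P = {}" using im reg e by auto
    qed
    ultimately have "\<mu> J \<le> \<mu> (g ` {e..1})"
      using cJ by (metis arc_imp_path compact_path_image measure_mono order_refl transverse_arc_def)
    then show "\<mu> J \<le> M" using M(2)[OF e(1,2)] by (rule order_trans)
  qed
  then show ?thesis using M(1) by (rule le_less_trans)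
qed

lemma leaf_length_iterate: "leaf_length ((f ^^ m) ` X) = ennreal (c ^ m) * leaf_length X"
proof (induction m)
  case (Suc m)
  have "leaf_length ((f ^^ Suc m) ` X) = ennreal c * leaf_length ((f ^^ m) ` X)"
    using leaf_length_image[of "(f ^^ m) ` X"] by (simp add: image_comp)
  then show ?case using Suc c by (simp add: ennreal_mult mult.assoc)
qed simp

subsection \<open>Leaves contain neither connections nor loops\<close>

text \<open>Injectivity is required only before the final parameter, so as to include loops based at a point
  of \<open>P\<close>.\<close>

definition connection :: "(real \<Rightarrow> 'a) \<Rightarrow> bool" where
  "connection \<gamma> \<longleftrightarrow> path \<gamma> \<and> inj_on \<gamma> {0..<1} \<and> path_image \<gamma> \<subseteq> leaf F (\<gamma> 0) \<and>
     \<gamma> 0 \<in> P \<and> \<gamma> 1 \<in> P \<and> (\<forall>t\<in>{0<..<1}. \<gamma> t \<notin> P)"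

lemma connectionD:
  assumes "connection \<gamma>"
  shows "continuous_on {0..1} \<gamma>" "inj_on \<gamma> {0..<1}" "\<gamma> ` {0..1} \<subseteq> leaf F (\<gamma> 0)" "\<gamma> 0 \<in> P" "\<gamma> 1 \<in> P"
    "\<And>t. 0 < t \<Longrightarrow> t < 1 \<Longrightarrow> \<gamma> t \<notin> P"
  using assms by (auto simp: connection_def path_def path_image_def)

lemma connection_initial_arc:
  assumes "connection \<gamma>" "0 < b" "b < 1"
  shows "F.leaf_arc (\<gamma> 0) (subarc \<gamma> 0 b)" "\<And>t. t \<in> {0<..1} \<Longrightarrow> subarc \<gamma> 0 b t \<notin> P"
    "path_image (subarc \<gamma> 0 b) = \<gamma> ` {0..b}"
proof -
  note C = connectionD[OF assms(1)]
  show im: "path_image (subarc \<gamma> 0 b) = \<gamma> ` {0..b}" using assms by (simp add: path_image_subarc closed_segment_eq_real_ivl)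
  show "F.leaf_arc (\<gamma> 0) (subarc \<gamma> 0 b)" unfolding F.leaf_arc_def
  proof (intro conjI)
    show "arc (subarc \<gamma> 0 b)"
      using assms by (intro arc_subarc continuous_on_subset[OF C(1)] inj_on_subset[OF C(2)])
        (auto simp: closed_segment_eq_real_ivl)
    show "path_image (subarc \<gamma> 0 b) \<subseteq> leaf F (\<gamma> 0)" using im C(3) assms by auto
  qed (simp add: subarc_def)
  show "subarc \<gamma> 0 b t \<notin> P" if "t \<in> {0<..1}" for t
  proof -
    have "b * t \<le> b" using that assms by (simp add: mult_left_le)
    then have "b * t < 1" using assms by linarith
    then show ?thesis using C(6)[of "b * t"] that assms by (simp add: subarc_def)
  qed
qed

lemma connection_reverse:
  assumes "connection \<gamma>" shows "connection (reversepath \<gamma>)"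
proof -
  note C = connectionD[OF assms]
  have "\<gamma> 1 \<in> leaf F (\<gamma> 0)" using C(3) by auto
  then have L: "leaf F (\<gamma> 1) = leaf F (\<gamma> 0)" by (rule F.leaf_eq)
  have "inj_on \<gamma> {0<..1}"
  proof (rule inj_onI)
    fix s t :: real assume st: "s \<in> {0<..1}" "t \<in> {0<..1}" "\<gamma> s = \<gamma> t"
    then have "s = 1 \<longleftrightarrow> t = 1" using C(5) C(6)[of s] C(6)[of t] by (cases "s = 1"; cases "t = 1") auto
    then show "s = t" using st inj_onD[OF C(2), of s t] by (cases "s = 1") auto
  qed
  then have "inj_on (reversepath \<gamma>) {0..<1}"
    unfolding reversepath_def inj_on_def by (auto dest!: bspec)
  then show ?thesis using assms C(4-6) L unfolding connection_def path_image_reversepath path_reversepath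
    by (auto simp: reversepath_def)
qed

text \<open>A connection is covered by two arcs issuing from points of \<open>P\<close>, one from either end.\<close>

lemma connection_length:
  assumes "connection \<gamma>"
  shows "leaf_length (path_image \<gamma>) < \<infinity>" "leaf_length (path_image \<gamma>) > 0"
proof -
  note C = connectionD[OF assms]
  define g where "g = subarc \<gamma> 0 (1/2)"
  define h where "h = subarc (reversepath \<gamma>) 0 (1/2)"
  have half: "0 < 1/(2::real)" "1/(2::real) < 1" by auto
  note g = connection_initial_arc[OF assms half, folded g_def]
  note h = connection_initial_arc[OF connection_reverse[OF assms] half, folded h_def]
  obtain M where M: "M < \<infinity>" "\<And>\<epsilon>. 0 < \<epsilon> \<Longrightarrow> \<epsilon> < 1 \<Longrightarrow> \<mu> (g ` {\<epsilon>..1}) \<le> M"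
    using tail_bound[OF g(1,2)] by blast
  obtain N where N: "N < \<infinity>" "\<And>\<epsilon>. 0 < \<epsilon> \<Longrightarrow> \<epsilon> < 1 \<Longrightarrow> \<mu> (h ` {\<epsilon>..1}) \<le> N"
    using tail_bound[OF h(1,2)] by blast
  have "leaf_length (path_image \<gamma>) \<le> M + N" unfolding leaf_length_def
  proof (rule SUP_least)
    fix J assume "J \<in> {J. leaf_interval F J \<and> J \<subseteq> path_image \<gamma> - P}"
    then obtain j where j: "arc j" "path_image j = J" and J: "J \<subseteq> path_image \<gamma> - P"
      by (auto simp: leaf_interval_def)
    have cJ: "compact J" using j by (metis arc_imp_path compact_path_image)
    then have oJ: "open (- J)" by (simp add: compact_imp_closed open_Compl)
    have "\<gamma> 0 \<in> - J" "\<gamma> 1 \<in> - J" using C(4,5) J by auto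
    then obtain d1 d2 where d: "d1 > 0" "\<And>s. s \<in> {0..1} \<Longrightarrow> \<bar>s - 0\<bar> < d1 \<Longrightarrow> \<gamma> s \<in> - J"
        "d2 > 0" "\<And>s. s \<in> {0..1} \<Longrightarrow> \<bar>s - 1\<bar> < d2 \<Longrightarrow> \<gamma> s \<in> - J"
      using nearby_parameters[OF C(1) _ oJ, of 0] nearby_parameters[OF C(1) _ oJ, of 1] by (metis atLeastAtMost_iff order_refl zero_le_one)
    define e where "e = min (min d1 d2) 1 / 4"
    have e: "0 < e" "2 * e < 1" "e < d1" "e < d2" using d(1,3) by (auto simp: e_def)
    define k where "k = subarc \<gamma> e (1 - e)"
    have kim: "path_image k = \<gamma> ` {e..1 - e}" using e by (simp add: k_def path_image_subarc closed_segment_eq_real_ivl)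
    have "J \<subseteq> path_image k" unfolding kim
    proof
      fix y assume y: "y \<in> J"
      then obtain t where t: "t \<in> {0..1}" "y = \<gamma> t" using J by (auto simp: path_image_def)
      then have "\<not> \<bar>t - 0\<bar> < d1" "\<not> \<bar>t - 1\<bar> < d2" using d(2)[of t] d(4)[of t] y by auto
      then have "t \<in> {e..1 - e}" using e t(1) by auto
      then show "y \<in> \<gamma> ` {e..1 - e}" using t(2) by blast
    qed
    moreover have tk: "transverse_arc G k"
    proof (rule measure_leaf_arc(3))
      show "arc k" unfolding k_def
        using e by (intro arc_subarc continuous_on_subset[OF C(1)] inj_on_subset[OF C(2)])
          (auto simp: closed_segment_eq_real_ivl)
      have "\<gamma> ` {e..1 - e} \<subseteq> \<gamma> ` {0..1}" using e by (intro image_mono) auto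
      then show "path_image k \<subseteq> leaf F (\<gamma> 0)" using C(3) unfolding kim by blast
      show "path_image k \<inter> P = {}" using C(6) e unfolding kim by force
    qed
    ultimately have "\<mu> J \<le> \<mu> (path_image k)"
      using cJ tk by (intro measure_mono) (auto simp: transverse_arc_def arc_imp_path compact_path_image)
    also have kgh: "path_image k = g ` {2 * e..1} \<union> h ` {2 * e..1}"
    proof -
      have "g ` {2 * e..1} = \<gamma> ` ((\<lambda>t. t / 2) ` {2 * e..1})" unfolding image_image g_def subarc_def by simp
      also have "(\<lambda>t. t / 2) ` {2 * e..1} = {e..1/2}" by (simp add: image_divide_atLeastAtMost)
      finally have "g ` {2 * e..1} = \<gamma> ` {e..1/2}" .
      moreover have "h ` {2 * e..1} = \<gamma> ` ((\<lambda>t. (-1/2) * t + 1) ` {2 * e..1})"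
        unfolding image_image h_def subarc_def reversepath_def by simp
      moreover have "(\<lambda>t. (-1/2) * t + 1) ` {2 * e..1} = {1/2..1 - e}"
        using e unfolding image_affinity_atLeastAtMost by auto
      moreover have "{e..1 - e} = {e..1/2} \<union> {1/2..1 - e}" using e by auto
      ultimately show ?thesis unfolding kim by (simp add: image_Un)
    qed
    also have "\<mu> \<dots> \<le> \<mu> (g ` {2 * e..1}) + \<mu> (h ` {2 * e..1})"
      using F.leaf_arcD(1)[OF g(1)] F.leaf_arcD(1)[OF h(1)] e kgh
      by (intro measure_subadditive[OF tk] compact_continuous_image)
        (auto intro: continuous_on_subset[OF arc_continuous])
    also have "\<dots> \<le> M + N" using M(2) N(2) e by (intro add_mono) auto
    finally show "\<mu> J \<le> M + N" .
  qed
  moreover have "M + N < \<infinity>" using M(1) N(1) by (simp add: ennreal_add_less_top)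
  ultimately show "leaf_length (path_image \<gamma>) < \<infinity>" by (rule le_less_trans)
  show "leaf_length (path_image \<gamma>) > 0"
  proof (rule leaf_length_positive)
    have im: "path_image (subarc \<gamma> (1/3) (1/2)) = \<gamma> ` {1/3..1/2}"
      by (simp add: path_image_subarc closed_segment_eq_real_ivl)
    show "arc (subarc \<gamma> (1/3) (1/2))"
      by (intro arc_subarc continuous_on_subset[OF C(1)] inj_on_subset[OF C(2)])
        (auto simp: closed_segment_eq_real_ivl)
    show "path_image (subarc \<gamma> (1/3) (1/2)) \<subseteq> path_image \<gamma>" unfolding im unfolding path_image_def by (intro image_mono) auto
    then show "path_image (subarc \<gamma> (1/3) (1/2)) \<subseteq> leaf F (\<gamma> 0)" using C(3) by (auto simp: path_image_def)
    show "path_image (subarc \<gamma> (1/3) (1/2)) \<inter> P = {}" using C(6) unfolding im by force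
  qed
qed

text \<open>Otherwise the arc would follow the connection to its end and hence come back to its own
  starting point.\<close>

lemma arc_inside_connection:
  assumes \<gamma>: "connection \<gamma>" and h: "F.leaf_arc (\<gamma> 0) h" and hP: "\<And>t. t \<in> {0<..1} \<Longrightarrow> h t \<notin> P"
    and s: "same_start h (subarc \<gamma> 0 (1/2))"
  shows "path_image h \<subseteq> path_image \<gamma>"
proof (rule ccontr)
  assume out: "\<not> ?thesis"
  note C = connectionD[OF \<gamma>] and H = F.leaf_arcD[OF h]
  have inside: "\<gamma> ` {0..b} \<subseteq> path_image h" if b: "1/2 < b" "b < 1" for b
  proof -
    have b0: "0 < b" using b by linarith
    note B = connection_initial_arc[OF \<gamma> b0 b(2)]
    have "same_start (subarc \<gamma> 0 (1/2)) (subarc \<gamma> 0 b)"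
      by (rule same_start_reparametrized[of "1 / (2 * b)" 1]) (use b in \<open>auto simp: subarc_def field_simps\<close>)
    then have "same_start h (subarc \<gamma> 0 b)" using s same_start_trans by blast
    then have "path_image h \<subseteq> path_image (subarc \<gamma> 0 b) \<or> path_image (subarc \<gamma> 0 b) \<subseteq> path_image h"
      using F.same_start_nested[OF h B(1)] hP P(3) by blast
    moreover have "path_image (subarc \<gamma> 0 b) \<subseteq> path_image \<gamma>" unfolding B(3) unfolding path_image_def using b by (intro image_mono) auto
    ultimately show ?thesis using out B(3) by blast
  qed
  have limit: "\<gamma> 1 \<in> K" if K: "closed K" "\<And>b. 1/2 < b \<Longrightarrow> b < 1 \<Longrightarrow> \<gamma> b \<in> K" for K
  proof -
    have "closed ({0..1} \<inter> \<gamma> -` K)" by (intro continuous_closed_preimage C(1) K(1) closed_atLeastAtMost)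
    moreover have "{1/2<..<1} \<subseteq> {0..1} \<inter> \<gamma> -` K" using K(2) by auto
    ultimately have "closure {1/2<..<1} \<subseteq> {0..1} \<inter> \<gamma> -` K" by (rule closure_minimal[rotated])
    moreover have "1 \<in> closure {1/2<..<1::real}" by simp
    ultimately show ?thesis by blast
  qed
  obtain a where a: "a \<in> {0<..1}" "h ` {0..a} \<subseteq> subarc \<gamma> 0 (1/2) ` {0..1}"
    using s[unfolded same_start_def, THEN conjunct1, rule_format, of 1] by auto
  have ha: "h ` {0..a} \<subseteq> \<gamma> ` {0..1/2}"
    using a(2) connection_initial_arc(3)[OF \<gamma>, of "1/2"] by (simp add: path_image_def)
  have cl: "closed (h ` {a..1})"
    using a(1) by (intro compact_imp_closed compact_continuous_image continuous_on_subset[OF arc_continuous[OF H(1)]]) auto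
  have "\<gamma> 1 \<in> h ` {a..1}"
  proof (rule limit[OF cl])
    fix b :: real assume b: "1/2 < b" "b < 1"
    then have "\<gamma> b \<in> path_image h" by (intro subsetD[OF inside[OF b]]) auto
    then obtain t where t: "t \<in> {0..1}" "\<gamma> b = h t" by (auto simp: path_image_def)
    have "\<not> t \<le> a"
    proof
      assume "t \<le> a"
      then have "\<gamma> b \<in> \<gamma> ` {0..1/2}" using ha t by auto
      then obtain r where "r \<in> {0..1/2}" "\<gamma> b = \<gamma> r" by blast
      then show False using inj_onD[OF C(2), of b r] b by auto
    qed
    then show "\<gamma> b \<in> h ` {a..1}" using t by auto
  qed
  then obtain t where "t \<in> {a..1}" "\<gamma> 1 = h t" by blast
  then show False using hP[of t] C(5) a(1) by auto
qed

text \<open>The finite sets of starts at the single points of \<open>P\<close>, united over the finite set \<open>P\<close>.\<close>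

lemma finite_start_classes:
  obtains d :: "'a \<Rightarrow> (real \<Rightarrow> 'a) \<Rightarrow> complex" and D where "finite D"
    "\<And>p g. p \<in> P \<Longrightarrow> F.leaf_arc p g \<Longrightarrow> d p g \<in> D"
    "\<And>p g h. F.leaf_arc p g \<Longrightarrow> F.leaf_arc p h \<Longrightarrow> d p g = d p h \<Longrightarrow> same_start g h"
proof -
  have "\<exists>d. \<exists>D::complex set. finite D \<and> (\<forall>g. F.leaf_arc p g \<longrightarrow> d g \<in> D) \<and>
      (\<forall>g h. F.leaf_arc p g \<longrightarrow> F.leaf_arc p h \<longrightarrow> d g = d h \<longrightarrow> same_start g h)" for p
    using F.finitely_many_starts[of p] by metis
  then obtain d D where dD: "\<And>p. finite (D p :: complex set)" "\<And>p g. F.leaf_arc p g \<Longrightarrow> d p g \<in> D p"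
    "\<And>p g h. F.leaf_arc p g \<Longrightarrow> F.leaf_arc p h \<Longrightarrow> d p g = d p h \<Longrightarrow> same_start g h"
    by metis
  show thesis using that[of "\<Union>p\<in>P. D p" d] dD P(1) by blast
qed

text \<open>Iterating \<open>f\<close> gives infinitely many connections; since there are only finitely many starts at
  the finitely many points of \<open>P\<close>, two of them coincide, although their lengths differ by a power
  of \<open>c\<close>.\<close>

theorem no_connection: "\<not> connection \<gamma>"
proof
  assume \<gamma>: "connection \<gamma>"
  define \<gamma>' where "\<gamma>' = (\<lambda>i::nat. (f ^^ i) \<circ> \<gamma>)"
  have conn: "connection (\<gamma>' i)" for i
  proof (induction i)
    case (Suc i)
    have eq: "\<gamma>' (Suc i) = f \<circ> \<gamma>' i" by (simp add: \<gamma>'_def o_assoc)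
    show ?case using Suc unfolding eq connection_def path_def path_image_compose
      by (auto intro!: continuous_on_f comp_inj_on inj_on_subset[OF bij_is_inj[OF bij_f]]
          simp: leaf_f P_f)
  qed (use \<gamma> in \<open>simp add: \<gamma>'_def\<close>)
  define \<beta> where "\<beta> = (\<lambda>i. subarc (\<gamma>' i) 0 (1/2))"
  have \<beta>: "F.leaf_arc (\<gamma>' i 0) (\<beta> i)" for i unfolding \<beta>_def using connection_initial_arc(1)[OF conn, of "1/2"] by simp
  obtain d D where D: "finite (D :: complex set)" "\<And>p g. p \<in> P \<Longrightarrow> F.leaf_arc p g \<Longrightarrow> d p g \<in> D"
    and d: "\<And>p g h. F.leaf_arc p g \<Longrightarrow> F.leaf_arc p h \<Longrightarrow> d p g = d p h \<Longrightarrow> same_start g h"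
    using finite_start_classes by metis
  define \<kappa> where "\<kappa> = (\<lambda>i. (\<gamma>' i 0, d (\<gamma>' i 0) (\<beta> i)))"
  have "\<kappa> i \<in> P \<times> D" for i using connectionD(4)[OF conn] D(2)[OF _ \<beta>] by (simp add: \<kappa>_def)
  then have "finite (range \<kappa>)" using P(1) D(1) finite_subset[of "range \<kappa>" "P \<times> D"] by (simp add: image_subset_iff)
  then obtain i j where ij: "i < j" "\<kappa> i = \<kappa> j"
    using finite_imageD[of \<kappa> UNIV] by (metis inj_on_def infinite_UNIV_nat linorder_neqE_nat)
  have eq0: "\<gamma>' i 0 = \<gamma>' j 0" and ss: "same_start (\<beta> i) (\<beta> j)"
    using ij(2) d[OF \<beta>[of i], of "\<beta> j"] \<beta>[of j] by (auto simp: \<kappa>_def)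
  have sub: "path_image (\<gamma>' k) - P \<subseteq> path_image (\<gamma>' l)" if kl: "\<gamma>' k 0 = \<gamma>' l 0" "same_start (\<beta> k) (\<beta> l)" for k l
  proof
    fix y assume "y \<in> path_image (\<gamma>' k) - P"
    then obtain t where t: "t \<in> {0..1}" "y = \<gamma>' k t" "y \<notin> P" by (auto simp: path_image_def)
    then have "t \<noteq> 0" "t \<noteq> 1" using connectionD(4,5)[OF conn] by metis+
    then have t': "0 < t" "t < 1" using t(1) by auto
    note B = connection_initial_arc[OF conn[of k] t']
    have "same_start (\<beta> k) (subarc (\<gamma>' k) 0 t)"
    proof (cases "t \<le> 1/2")
      case True
      have "same_start (subarc (\<gamma>' k) 0 t) (\<beta> k)"
        by (rule same_start_reparametrized[of "2 * t" 1]) (use t' True in \<open>auto simp: subarc_def \<beta>_def\<close>)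
      then show ?thesis by (rule same_start_sym)
    next
      case False
      then show ?thesis
        by (intro same_start_reparametrized[of "1 / (2 * t)" 1]) (use t' in \<open>auto simp: subarc_def \<beta>_def field_simps\<close>)
    qed
    then have "same_start (subarc (\<gamma>' k) 0 t) (subarc (\<gamma>' l) 0 (1/2))"
      using kl(2) same_start_sym same_start_trans unfolding \<beta>_def by blast
    then have "path_image (subarc (\<gamma>' k) 0 t) \<subseteq> path_image (\<gamma>' l)"
      using arc_inside_connection[OF conn[of l], of "subarc (\<gamma>' k) 0 t"] B(1,2) kl(1) by simp
    moreover have "y \<in> path_image (subarc (\<gamma>' k) 0 t)" unfolding B(3) using t(2) t' by auto
    ultimately show "y \<in> path_image (\<gamma>' l)" by blast
  qed
  have "leaf_length (path_image (\<gamma>' i)) = leaf_length (path_image (\<gamma>' j))"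
    using sub[OF eq0 ss] sub[OF eq0[symmetric] same_start_sym[OF ss]]
    by (intro antisym leaf_length_mono) auto
  moreover have "path_image (\<gamma>' j) = (f ^^ (j - i)) ` path_image (\<gamma>' i)"
    using ij(1) by (simp add: \<gamma>'_def path_image_compose image_comp flip: funpow_add)
  ultimately have eq: "leaf_length (path_image (\<gamma>' i)) = ennreal (c ^ (j - i)) * leaf_length (path_image (\<gamma>' i))"
    by (simp add: leaf_length_iterate)
  obtain r where r: "leaf_length (path_image (\<gamma>' i)) = ennreal r" "r > 0"
    using connection_length[OF conn[of i]] by (cases "leaf_length (path_image (\<gamma>' i))") auto
  have "ennreal r = ennreal (c ^ (j - i) * r)" using eq r c by (simp add: ennreal_mult)
  then have "r = c ^ (j - i) * r" using r(2) c(1) by (subst (asm) ennreal_inj) auto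
  then have "c ^ (j - i) = 1" using r(2) by simp
  then show False using c ij(1) power_eq_1_iff[of c "j - i"] by simp
qed

end

context scaled_foliation
begin

subsection \<open>Segments\<close>

text \<open>Up to its first return to \<open>P\<close> the arc would be a connection.\<close>

lemma leaf_arc_avoids:
  assumes g: "F.leaf_arc p g" and p: "p \<in> P" and t: "t \<in> {0<..1}"
  shows "g t \<notin> P"
proof
  assume gt: "g t \<in> P"
  note G = F.leaf_arcD[OF g]
  define T where "T = {t \<in> {0<..1}. g t \<in> P}"
  have "inj_on g T" by (rule inj_on_subset[OF arc_inj[OF G(1)]]) (auto simp: T_def)
  moreover have "g ` T \<subseteq> P" by (auto simp: T_def)
  ultimately have "finite T" using P(1) by (meson finite_imageD finite_subset)
  define s where "s = Min T"
  have "t \<in> T" using t gt by (simp add: T_def)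
  then have "T \<noteq> {}" by blast
  then have s: "s \<in> T" "\<And>r. r \<in> T \<Longrightarrow> s \<le> r"
    using Min_in[OF \<open>finite T\<close>] Min_le[OF \<open>finite T\<close>] by (auto simp: s_def)
  then have s1: "0 < s" "s \<le> 1" by (auto simp: T_def)
  have "connection (subarc g 0 s)" unfolding connection_def
  proof (intro conjI ballI)
    have a: "arc (subarc g 0 s)" using arc_subarc_arc[OF G(1), of 0 s] s1 by auto
    then show "path (subarc g 0 s)" by (rule arc_imp_path)
    show "inj_on (subarc g 0 s) {0..<1}" by (rule inj_on_subset[OF arc_inj[OF a]]) auto
    show "path_image (subarc g 0 s) \<subseteq> leaf F (subarc g 0 s 0)"
      using path_image_subarc_subset[of 0 s g] s1 G(2,3) by (auto simp: subarc_def)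
    show "subarc g 0 s 0 \<in> P" "subarc g 0 s 1 \<in> P" using p G(2) s(1) by (auto simp: subarc_def T_def)
    fix r :: real assume r: "r \<in> {0<..<1}"
    then have sr: "s * r < s" "0 < s * r" using s1 by auto
    then have "s * r \<le> 1" using s1 by linarith
    with sr show "subarc g 0 s r \<notin> P" using s(2)[of "s * r"] s1 by (auto simp: subarc_def T_def)
  qed
  then show False using no_connection by blast
qed

text \<open>Otherwise the two arcs, followed up to the first point where \<open>g\<close> meets \<open>h\<close>, form a loop at \<open>p\<close>,
  which is a connection.\<close>

lemma meeting_arcs_same_start:
  assumes g: "F.leaf_arc p g" and h: "F.leaf_arc p h" and p: "p \<in> P"
    and st: "s \<in> {0<..1}" "t \<in> {0<..1}" "g s = h t"
  shows "same_start g h"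
proof (rule ccontr)
  assume ns: "\<not> same_start g h"
  note G = F.leaf_arcD[OF g] and H = F.leaf_arcD[OF h]
  obtain a where a: "a \<in> {0<..1}" "g ` {0<..a} \<inter> h ` {0<..a} = {}"
    using F.finitely_many_starts[of p] g h ns by metis
  have "open (- h ` {a..1})"
    using a(1) by (intro open_Compl compact_imp_closed compact_continuous_image
        continuous_on_subset[OF arc_continuous[OF H(1)]]) auto
  moreover have "g 0 \<in> - h ` {a..1}"
    using G(2) H(2) a(1) inj_onD[OF arc_inj[OF H(1)], of 0] by force
  ultimately obtain \<delta> where d: "\<delta> > 0" "\<And>r. r \<in> {0..1} \<Longrightarrow> \<bar>r - 0\<bar> < \<delta> \<Longrightarrow> g r \<in> - h ` {a..1}"
    using nearby_parameters[OF arc_continuous[OF G(1)], of 0 "- h ` {a..1}"] by auto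
  define b where "b = min a (\<delta> / 2)"
  have b: "0 < b" "b \<le> a" "b < \<delta>" "b \<le> 1" using a d by (auto simp: b_def)
  have early: "g r \<notin> path_image h" if r: "0 < r" "r \<le> b" for r
  proof
    assume "g r \<in> path_image h"
    then obtain u where u: "u \<in> {0..1}" "g r = h u" by (auto simp: path_image_def)
    have "g r \<noteq> g 0" using inj_onD[OF arc_inj[OF G(1)], of r 0] r b by auto
    then have "u \<noteq> 0" using u G(2) H(2) by auto
    then have "u \<in> {0<..a} \<or> u \<in> {a..1}" using u(1) by auto
    then show False
    proof
      assume "u \<in> {0<..a}"
      then have "g r \<in> h ` {0<..a}" using u(2) by blast
      moreover have "g r \<in> g ` {0<..a}" using r b by auto
      ultimately have "g r \<in> g ` {0<..a} \<inter> h ` {0<..a}" by blast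
      then show False using a(2) by blast
    next
      assume "u \<in> {a..1}"
      then show False using d(2)[of r] r b u(2) by auto
    qed
  qed
  define T where "T = {b..1} \<inter> g -` path_image h"
  have "closed T" unfolding T_def
    using b H(1) by (intro continuous_closed_preimage closed_path_image arc_imp_path
        continuous_on_subset[OF arc_continuous[OF G(1)]]) auto
  moreover have bdd: "bdd_below T" by (auto simp: T_def intro!: bdd_belowI[of _ b])
  moreover have sT: "s \<in> T"
  proof -
    have "g s \<in> path_image h" using st by (auto simp: path_image_def)
    then show ?thesis using early[of s] st by (cases "s \<le> b") (auto simp: T_def)
  qed
  ultimately have IT: "Inf T \<in> T" using closed_contains_Inf by blast
  define r where "r = Inf T"
  have r: "r \<in> T" "\<And>x. x \<in> T \<Longrightarrow> r \<le> x" using IT bdd by (auto simp: r_def intro: cInf_lower)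
  have r01: "0 < r" "r \<le> 1" using r(1) b by (auto simp: T_def)
  obtain u where u: "u \<in> {0..1}" "g r = h u" using r(1) by (auto simp: T_def path_image_def)
  have "g r \<noteq> g 0" using inj_onD[OF arc_inj[OF G(1)], of r 0] r01 by auto
  then have u0: "u > 0" using u G(2) H(2) by (cases "u = 0") auto
  define \<gamma> where "\<gamma> = subarc g 0 r +++ subarc h u 0"
  have ag: "arc (subarc g 0 r)" and ah: "arc (subarc h u 0)"
    using arc_subarc_arc[OF G(1), of 0 r] arc_subarc_arc[OF H(1), of u 0] r01 u u0 by auto
  have img: "path_image (subarc g 0 r) = g ` {0..r}" and imh: "path_image (subarc h u 0) = h ` {0..u}"
    using r01 u0 by (auto simp: path_image_subarc closed_segment_eq_real_ivl)
  have "simple_path \<gamma>" unfolding \<gamma>_def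
  proof (rule simple_path_join_loop[OF ag ah])
    show "path_image (subarc g 0 r) \<inter> path_image (subarc h u 0) \<subseteq> {pathstart (subarc g 0 r), pathstart (subarc h u 0)}"
    proof
      fix y assume y: "y \<in> path_image (subarc g 0 r) \<inter> path_image (subarc h u 0)"
      then obtain x where x: "x \<in> {0..r}" "y = g x" unfolding img by auto
      have "y \<in> path_image h" using y path_image_subarc_subset[OF u(1), of 0 h] by auto
      then have "x \<in> T" if "x > 0" using early[of x] x r01 that by (cases "x \<le> b") (auto simp: T_def)
      then have "x = 0 \<or> x \<in> T" using x(1) by fastforce
      then have "x = 0 \<or> x = r" using r(2)[of x] x by auto
      then show "y \<in> {pathstart (subarc g 0 r), pathstart (subarc h u 0)}" using x u by auto
    qed
  qed (use u G(2) H(2) in auto)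
  then have \<gamma>: "path \<gamma>" "loop_free \<gamma>" by (auto simp: simple_path_def)
  have \<gamma>0: "\<gamma> 0 = p" "\<gamma> 1 = p" using G(2) H(2) by (auto simp: \<gamma>_def joinpaths_def subarc_def)
  have "connection \<gamma>" unfolding connection_def
  proof (intro conjI ballI)
    show "inj_on \<gamma> {0..<1}"
    proof (rule inj_onI)
      fix x y :: real assume xy: "x \<in> {0..<1}" "y \<in> {0..<1}" "\<gamma> x = \<gamma> y"
      then have "x \<in> {0..1}" "y \<in> {0..1}" by auto
      then have "x = y \<or> x = 0 \<and> y = 1 \<or> x = 1 \<and> y = 0" using \<gamma>(2) xy(3) unfolding loop_free_def by blast
      then show "x = y" using xy by auto
    qed
    have "path_image \<gamma> \<subseteq> path_image g \<union> path_image h"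
      using path_image_join_subset[of "subarc g 0 r" "subarc h u 0"] r01 u u0
        path_image_subarc_subset[of 0 r g] path_image_subarc_subset[of u 0 h] unfolding \<gamma>_def by fastforce
    then show "path_image \<gamma> \<subseteq> leaf F (\<gamma> 0)" using G(3) H(3) \<gamma>0 by auto
    fix x :: real assume x: "x \<in> {0<..<1}"
    show "\<gamma> x \<notin> P"
    proof (cases "x \<le> 1/2")
      case True
      then have "r * (2 * x) \<le> 1" using x r01 True by - (rule mult_le_one, auto)
      then have "g (r * (2 * x)) \<notin> P" using x r01 by (intro leaf_arc_avoids[OF g p]) auto
      then show ?thesis using True by (simp add: \<gamma>_def joinpaths_def subarc_def)
    next
      case False
      define y where "y = u * (2 - 2 * x)"
      have "u * (2 - 2 * x) \<le> 1" using x False u by - (rule mult_le_one, auto)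
      then have "y \<in> {0<..1}" using x u0 by (simp add: y_def)
      then have "h y \<notin> P" by (rule leaf_arc_avoids[OF h p])
      moreover have "u + (0 - u) * (2 * x - 1) = y" by (simp add: y_def algebra_simps)
      ultimately show ?thesis using False by (simp add: \<gamma>_def joinpaths_def subarc_def)
    qed
  qed (use \<gamma> \<gamma>0 p in auto)
  then show False using no_connection by blast
qed

lemma leaf_arcs_nested:
  assumes "F.leaf_arc p g" "F.leaf_arc p h" "p \<in> P" "same_start g h"
  shows "path_image g \<subseteq> path_image h \<or> path_image h \<subseteq> path_image g"
  using F.same_start_nested[OF assms(1,2,4)] leaf_arc_avoids[OF assms(1,3)] P(3) by blast

lemma leaf_arc_unique:
  assumes g: "F.leaf_arc p g" and h: "F.leaf_arc p h" and p: "p \<in> P" and e: "g 1 = h 1"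
  shows "path_image g = path_image h"
proof -
  have sub: "path_image g = path_image h"
    if gh: "F.leaf_arc p g" "F.leaf_arc p h" "path_image g \<subseteq> path_image h" "g 1 = h 1" for g h
  proof -
    note G = F.leaf_arcD[OF gh(1)] and H = F.leaf_arcD[OF gh(2)]
    have "h 0 \<in> path_image g" "h 1 \<in> path_image g"
      using G(2) H(2) gh(4) pathstart_in_path_image[of g] pathfinish_in_path_image[of g]
      by (auto simp: pathstart_def pathfinish_def)
    then have "h ` {0..1} \<subseteq> path_image g"
      using connected_in_arc[OF H(1) connected_path_image[OF arc_imp_path[OF G(1)]] gh(3)] by simp
    then show ?thesis using gh(3) by (auto simp: path_image_def)
  qed
  have "same_start g h" using meeting_arcs_same_start[OF g h p, of 1 1] e by simp
  then show ?thesis using leaf_arcs_nested[OF g h p] sub[OF g h] sub[OF h g] e by auto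
qed

lemma leaf_segment_eq:
  assumes g: "F.leaf_arc p g" and p: "p \<in> P"
  shows "leaf_segment F p (g 1) = path_image g"
  unfolding leaf_segment_def
proof (rule the_equality)
  show "\<exists>h. arc h \<and> path_image h = path_image g \<and> pathstart h = p \<and> pathfinish h = g 1 \<and> path_image g \<subseteq> leaf F p"
    using F.leaf_arcD[OF g] by (auto simp: pathfinish_def)
  fix I assume "\<exists>h. arc h \<and> path_image h = I \<and> pathstart h = p \<and> pathfinish h = g 1 \<and> I \<subseteq> leaf F p"
  then obtain h where "F.leaf_arc p h" "path_image h = I" "h 1 = g 1"
    by (auto simp: F.leaf_arc_def pathstart_def pathfinish_def)
  then show "I = path_image g" using leaf_arc_unique[OF _ g p] by blast
qed

lemma leaf_segment_initial:
  assumes g: "F.leaf_arc p g" and p: "p \<in> P" and t: "t \<in> {0<..1}"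
  shows "leaf_segment F p (g t) = g ` {0..t}"
proof -
  note G = F.leaf_arcD[OF g]
  have im: "path_image (subarc g 0 t) = g ` {0..t}" using t by (simp add: path_image_subarc closed_segment_eq_real_ivl)
  have "F.leaf_arc p (subarc g 0 t)" unfolding F.leaf_arc_def
    using arc_subarc_arc[OF G(1), of 0 t] path_image_subarc_subset[of 0 t g] t G(2,3) by (auto simp: subarc_def)
  from leaf_segment_eq[OF this p] show ?thesis using im by (simp add: subarc_def)
qed

lemma leaf_segment_f:
  assumes p: "p \<in> P" and z: "z \<in> leaf F p" "z \<noteq> p"
  shows "leaf_segment F (f p) (f z) = f ` leaf_segment F p z"
proof -
  obtain g where g: "F.leaf_arc p g" "g 1 = z" using F.leaf_arc_exists[OF z] .
  have "f p \<in> P" using p P_f by blast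
  from leaf_segment_eq[OF leaf_arc_f[OF g(1)] this] show ?thesis
    using leaf_segment_eq[OF g(1) p] g(2) by (simp add: path_image_compose)
qed

lemma leaf_segment_length:
  assumes p: "p \<in> P" and z: "z \<in> leaf F p" "z \<noteq> p"
  shows "0 < leaf_length (leaf_segment F p z)" "leaf_length (leaf_segment F p z) < \<infinity>"
proof -
  obtain g where g: "F.leaf_arc p g" "g 1 = z" using F.leaf_arc_exists[OF z] .
  note G = F.leaf_arcD[OF g(1)]
  have eq: "leaf_segment F p z = path_image g" using leaf_segment_eq[OF g(1) p] g(2) by simp
  show "leaf_length (leaf_segment F p z) < \<infinity>"
    unfolding eq using leaf_length_finite[OF g(1) p] leaf_arc_avoids[OF g(1) p] by blast
  have im: "path_image (subarc g (1/2) 1) = g ` {1/2..1}" by (simp add: path_image_subarc closed_segment_eq_real_ivl)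
  show "0 < leaf_length (leaf_segment F p z)"
  proof (rule leaf_length_positive)
    show "arc (subarc g (1/2) 1)" using arc_subarc_arc[OF G(1), of "1/2" 1] by auto
    show "path_image (subarc g (1/2) 1) \<subseteq> leaf F p" using path_image_subarc_subset[of "1/2" 1 g] G(3) by auto
    show "path_image (subarc g (1/2) 1) \<inter> P = {}" unfolding im using leaf_arc_avoids[OF g(1) p] by auto
    show "path_image (subarc g (1/2) 1) \<subseteq> leaf_segment F p z"
      unfolding eq by (rule path_image_subarc_subset) auto
  qed
qed

text \<open>If two iterates of an arc start along the same prong, then so do the arc and its iterate by the
  difference of the exponents.  The two prongs may be tested on any arcs with the same ends.\<close>

lemma same_start_shift:
  assumes g: "F.leaf_arc p g" and p: "p \<in> P" and m: "(f ^^ m) p = p"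
    and k: "F.leaf_arc ((f ^^ i) p) k" "k 1 = (f ^^ i) (g 1)"
    and l: "F.leaf_arc ((f ^^ i) p) l" "l 1 = (f ^^ (i + m)) (g 1)"
    and kl: "same_start k l"
  shows "same_start ((f ^^ m) \<circ> g) g"
proof -
  have fj: "(f ^^ (i + m)) x = (f ^^ i) ((f ^^ m) x)" for x by (simp add: funpow_add)
  have ip: "(f ^^ i) p \<in> P" using p P_iterate by blast
  have fg: "F.leaf_arc ((f ^^ i) p) ((f ^^ i) \<circ> g)" "F.leaf_arc ((f ^^ i) p) ((f ^^ (i + m)) \<circ> g)"
    using leaf_arc_iterate[OF g, of i] leaf_arc_iterate[OF g, of "i + m"] fj m by simp_all
  have "same_start ((f ^^ i) \<circ> g) k"
    using meeting_arcs_same_start[OF fg(1) k(1) ip, of 1 1] k(2) by simp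
  moreover have "same_start ((f ^^ (i + m)) \<circ> g) l"
    using meeting_arcs_same_start[OF fg(2) l(1) ip, of 1 1] l(2) by simp
  ultimately have "same_start ((f ^^ (i + m)) \<circ> g) ((f ^^ i) \<circ> g)"
    using kl same_start_sym same_start_trans by blast
  moreover have "(f ^^ (i + m)) \<circ> g = (f ^^ i) \<circ> ((f ^^ m) \<circ> g)" using fj by auto
  ultimately show ?thesis using same_start_iterate by metis
qed

end

section \<open>First intersection points modulo the dynamics\<close>

lemma geometric_fundamental_domain:
  fixes a x y :: real
  assumes a: "0 < a" "a < 1" and x: "x > 0" and y: "y > 0"
  shows "(\<exists>n. a * y < a ^ n * x \<and> a ^ n * x \<le> y) \<or> (\<exists>n. a * y < x / a ^ n \<and> x / a ^ n \<le> y)"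
proof (cases "x > y")
  case True
  have ex: "\<exists>n. a ^ n * x \<le> y"
  proof -
    obtain n where "a ^ n < y / x" using real_arch_pow_inv[of "y / x" a] a x y by auto
    then show ?thesis using x by (auto simp: field_simps intro: less_imp_le)
  qed
  define n where "n = (LEAST n. a ^ n * x \<le> y)"
  have n: "a ^ n * x \<le> y" unfolding n_def using ex by (rule LeastI_ex)
  then have "n \<noteq> 0" using True by (cases n) auto
  then obtain k where k: "n = Suc k" using not0_implies_Suc by blast
  have "\<not> a ^ k * x \<le> y" using not_less_Least[of k "\<lambda>n. a ^ n * x \<le> y"] k by (simp add: n_def)
  then have "a * y < a * (a ^ k * x)" using a by simp
  then have "a * y < a ^ n * x" by (simp add: k mult.assoc)
  then show ?thesis using n by blast
next
  case False
  have ex: "\<exists>n. x / a ^ n > y"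
  proof -
    obtain n where "a ^ n < x / y" using real_arch_pow_inv[of "x / y" a] a x y by auto
    then show ?thesis using a y by (intro exI[of _ n]) (simp add: field_simps)
  qed
  define n where "n = (LEAST n. x / a ^ n > y)"
  have n: "x / a ^ n > y" unfolding n_def using ex by (rule LeastI_ex)
  then have "n \<noteq> 0" using False by (cases n) auto
  then obtain k where k: "n = Suc k" using not0_implies_Suc by blast
  have "\<not> x / a ^ k > y" using not_less_Least[of k "\<lambda>n. x / a ^ n > y"] k by (simp add: n_def)
  moreover have "a * y < x / a ^ k" using n a by (simp add: k field_simps)
  ultimately show ?thesis by force
qed

locale two_scaled_foliations =
  S: scaled_foliation Fs Fu A \<mu>u f P cs + U: scaled_foliation Fu Fs A \<mu>s f P cu
  for Fs Fu :: "'a::t2_space set set" and A :: "'a atlas" and \<mu>s \<mu>u :: "'a set \<Rightarrow> ennreal"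
    and f :: "'a \<Rightarrow> 'a" and P :: "'a set" and cs cu :: real +
  assumes contracting: "cs < 1"
begin

abbreviation "stable_arc \<equiv> S.F.leaf_arc"

abbreviation "unstable_arc \<equiv> S.G.leaf_arc"

text \<open>First intersection points, with leaves in place of separatrices.\<close>

definition first_meeting :: "'a \<Rightarrow> 'a \<Rightarrow> 'a \<Rightarrow> bool" where
  "first_meeting p q z \<longleftrightarrow> p \<in> P \<and> q \<in> P \<and> z \<notin> P \<and> z \<in> leaf Fs p \<and> z \<in> leaf Fu q \<and>
     (leaf_segment Fs p z - {p}) \<inter> (leaf_segment Fu q z - {q}) = {z}"

lemma first_meeting_f: "first_meeting (f p) (f q) (f z) \<longleftrightarrow> first_meeting p q z"
proof -
  note inj = bij_is_inj[OF S.bij_f]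
  have mem: "f z \<in> leaf Fs (f p) \<longleftrightarrow> z \<in> leaf Fs p" "f z \<in> leaf Fu (f q) \<longleftrightarrow> z \<in> leaf Fu q"
    using inj by (auto simp: S.leaf_f U.leaf_f inj_image_mem_iff)
  show ?thesis
  proof (cases "p \<in> P \<and> q \<in> P \<and> z \<notin> P \<and> z \<in> leaf Fs p \<and> z \<in> leaf Fu q")
    case True
    then have ne: "z \<noteq> p" "z \<noteq> q" by auto
    have "(leaf_segment Fs (f p) (f z) - {f p}) \<inter> (leaf_segment Fu (f q) (f z) - {f q}) =
        f ` ((leaf_segment Fs p z - {p}) \<inter> (leaf_segment Fu q z - {q}))"
      using True ne S.leaf_segment_f U.leaf_segment_f
      by (simp add: image_Int[OF inj] image_set_diff[OF inj])
    moreover have "{f z} = f ` {z}" by simp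
    ultimately show ?thesis using True mem S.P_f unfolding first_meeting_def
      by (metis inj inj_image_eq_iff)
  next
    case False
    then show ?thesis using mem S.P_f unfolding first_meeting_def by blast
  qed
qed

lemma first_meeting_iterate: "first_meeting ((f ^^ m) p) ((f ^^ m) q) ((f ^^ m) z) \<longleftrightarrow> first_meeting p q z"
  using first_meeting_f by (induction m) auto

lemma segment_iterate:
  assumes "p \<in> P" "z \<in> leaf Fs p" "z \<noteq> p"
  shows "leaf_segment Fs ((f ^^ m) p) ((f ^^ m) z) = (f ^^ m) ` leaf_segment Fs p z"
proof -
  obtain g where g: "stable_arc p g" "g 1 = z" using S.F.leaf_arc_exists[OF assms(2,3)] .
  have "(f ^^ m) p \<in> P" using assms(1) S.P_iterate by blast
  from S.leaf_segment_eq[OF S.leaf_arc_iterate[OF g(1)] this] show ?thesis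
    using S.leaf_segment_eq[OF g(1) assms(1)] g(2) by (simp add: path_image_compose)
qed

text \<open>Let \<open>\<Phi>\<close> be an iterate of \<open>f\<close> fixing \<open>p\<close> and \<open>q\<close> and the prongs of \<open>z\<^sub>0\<close> at them.  Lengths
  of stable segments are multiplied by \<open>a\<close>, so every point of the same kind can be moved by a
  power of \<open>\<Phi>\<close> between \<open>\<Phi>\<^sup>2 z\<^sub>0\<close> and \<open>z\<^sub>0\<close> on the stable prong.  Being a first meeting, it
  cannot lie beyond \<open>\<Phi>\<^sup>2 z\<^sub>0\<close> on the unstable prong.  So it lies on two fixed compact arcs.\<close>

lemma finitely_many_in_fundamental_domain:
  fixes m :: nat
  defines "\<Phi> \<equiv> f ^^ m"
  assumes m: "m > 0" and z0: "first_meeting p q z0"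
    and p: "\<Phi> p = p" and q: "\<Phi> q = q"
    and g: "stable_arc p g" "g 1 = z0" and h: "unstable_arc q h" "h 1 = z0"
    and sg: "same_start (\<Phi> \<circ> g) g" and sh: "same_start (\<Phi> \<circ> h) h"
  obtains W where "finite W"
    "\<And>z g' h'. first_meeting p q z \<Longrightarrow> stable_arc p g' \<Longrightarrow> g' 1 = z \<Longrightarrow> same_start g' g \<Longrightarrow>
       unstable_arc q h' \<Longrightarrow> h' 1 = z \<Longrightarrow> same_start h' h \<Longrightarrow>
       \<exists>w\<in>W. \<exists>k. (w = (f ^^ k) z \<or> z = (f ^^ k) w) \<and> (f ^^ k) q = q"
proof -
  define a where "a = cs ^ m"
  have a: "0 < a" "a < 1" using S.c contracting m by (auto simp: a_def power_less_one_iff)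
  have pP: "p \<in> P" and qP: "q \<in> P" using z0 by (auto simp: first_meeting_def)
  define good where "good = (\<lambda>z. first_meeting p q z \<and> (\<exists>g'. stable_arc p g' \<and> g' 1 = z \<and> same_start g' g) \<and>
      (\<exists>h'. unstable_arc q h' \<and> h' 1 = z \<and> same_start h' h))"
  have goodD: "z \<in> leaf Fs p" "z \<noteq> p" "z \<in> leaf Fu q" "z \<noteq> q" if "good z" for z
    using that pP qP by (auto simp: good_def first_meeting_def)
  have sa: "stable_arc p (\<Phi> \<circ> k)" if "stable_arc p k" for k
    using S.leaf_arc_iterate[OF that, of m] p by (simp add: \<Phi>_def)
  have ua: "unstable_arc q (\<Phi> \<circ> k)" if "unstable_arc q k" for k
    using U.leaf_arc_iterate[OF that, of m] q by (simp add: \<Phi>_def)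
  have ss\<Phi>: "same_start (\<Phi> \<circ> k) (\<Phi> \<circ> l) \<longleftrightarrow> same_start k l" for k l :: "real \<Rightarrow> 'a"
    unfolding \<Phi>_def by (rule S.same_start_iterate)
  have fm\<Phi>: "first_meeting p q (\<Phi> z) \<longleftrightarrow> first_meeting p q z" for z
    using first_meeting_iterate[of m p q z] p q by (simp add: \<Phi>_def)
  have good\<Phi>: "good (\<Phi> z) \<longleftrightarrow> good z" for z
  proof
    assume "good z"
    then obtain g' h' where gh: "first_meeting p q z" "stable_arc p g'" "g' 1 = z" "same_start g' g"
      "unstable_arc q h'" "h' 1 = z" "same_start h' h" by (auto simp: good_def)
    have "same_start (\<Phi> \<circ> g') g" "same_start (\<Phi> \<circ> h') h"
      using ss\<Phi> gh(4,7) sg sh same_start_trans by blast+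
    then show "good (\<Phi> z)" unfolding good_def using gh fm\<Phi> sa ua by (metis comp_apply)
  next
    assume gz: "good (\<Phi> z)"
    then have fm: "first_meeting p q z" using fm\<Phi> by (simp add: good_def)
    then have mem: "z \<in> leaf Fs p" "z \<noteq> p" "z \<in> leaf Fu q" "z \<noteq> q" using pP qP by (auto simp: first_meeting_def)
    obtain g' where g': "stable_arc p g'" "g' 1 = z" using S.F.leaf_arc_exists[OF mem(1,2)] .
    obtain h' where h': "unstable_arc q h'" "h' 1 = z" using S.G.leaf_arc_exists[OF mem(3,4)] .
    obtain g'' h'' where gh: "stable_arc p g''" "g'' 1 = \<Phi> z" "same_start g'' g"
      "unstable_arc q h''" "h'' 1 = \<Phi> z" "same_start h'' h" using gz by (auto simp: good_def)
    have "same_start (\<Phi> \<circ> g') g''"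
      using S.meeting_arcs_same_start[OF sa[OF g'(1)] gh(1) pP, of 1 1] g' gh by simp
    then have "same_start g' g" using gh(3) sg same_start_sym same_start_trans ss\<Phi> by metis
    moreover have "same_start (\<Phi> \<circ> h') h''"
      using U.meeting_arcs_same_start[OF ua[OF h'(1)] gh(4) qP, of 1 1] h' gh by simp
    then have "same_start h' h" using gh(6) sh same_start_sym same_start_trans ss\<Phi> by metis
    ultimately show "good z" unfolding good_def using fm g' h' by blast
  qed
  have good\<Phi>n: "good ((\<Phi> ^^ n) z) \<longleftrightarrow> good z" for n z
    using good\<Phi> by (induction n) auto
  define L where "L = (\<lambda>z. enn2real (S.leaf_length (leaf_segment Fs p z)))"
  have Len: "S.leaf_length (leaf_segment Fs p z) = ennreal (L z)" and Lpos: "L z > 0" if "good z" for z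
    using S.leaf_segment_length[OF pP goodD(1,2)[OF that]]
    by (auto simp: L_def enn2real_positive_iff less_top)
  have L\<Phi>: "L (\<Phi> z) = a * L z" if gz: "good z" for z
  proof -
    have "leaf_segment Fs p (\<Phi> z) = \<Phi> ` leaf_segment Fs p z"
      using segment_iterate[OF pP goodD(1,2)[OF gz], of m] p by (simp add: \<Phi>_def)
    then have "ennreal (L (\<Phi> z)) = ennreal a * ennreal (L z)"
      using Len[OF gz] Len[of "\<Phi> z"] good\<Phi> gz S.leaf_length_iterate[of m] by (simp add: \<Phi>_def a_def)
    also have "\<dots> = ennreal (a * L z)" using a Lpos[OF gz] by (simp add: ennreal_mult)
    finally show ?thesis using a Lpos[OF gz] Lpos[of "\<Phi> z"] good\<Phi> gz by (subst (asm) ennreal_inj) auto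
  qed
  have L\<Phi>n: "L ((\<Phi> ^^ n) z) = a ^ n * L z" if "good z" for n z
  proof (induction n)
    case (Suc n)
    then show ?case using L\<Phi>[of "(\<Phi> ^^ n) z"] good\<Phi>n that by simp
  qed simp
  have gz0: "good z0" unfolding good_def using z0 g h
    by (intro conjI exI[of _ g] exI[of _ h]) (auto simp: same_start_def)
  \<comment> \<open>The domain extends from \<open>\<Phi> z0\<close> inclusively to \<open>z2\<close> exclusively, so the segments to its points are strictly shorter than that to \<open>z0\<close> and longer than that to \<open>z2\<close>.\<close>
  define z2 where "z2 = \<Phi> (\<Phi> z0)"
  have gz2: "good z2" using good\<Phi> gz0 by (simp add: z2_def)
  have Lz2: "L z2 = a * (a * L z0)" using L\<Phi> good\<Phi> gz0 by (simp add: z2_def)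
  have nested: "leaf_segment Fs p w \<subseteq> leaf_segment Fs p w'" if w: "good w" "good w'" "L w < L w'" for w w'
  proof -
    obtain k l where k: "stable_arc p k" "k 1 = w" "same_start k g" and l: "stable_arc p l" "l 1 = w'" "same_start l g"
      using w by (auto simp: good_def)
    have "same_start k l" using k(3) l(3) same_start_sym same_start_trans by blast
    then have "leaf_segment Fs p w \<subseteq> leaf_segment Fs p w' \<or> leaf_segment Fs p w' \<subseteq> leaf_segment Fs p w"
      using S.leaf_arcs_nested[OF k(1) l(1) pP] S.leaf_segment_eq[OF k(1) pP] S.leaf_segment_eq[OF l(1) pP] k(2) l(2) by simp
    moreover have "\<not> leaf_segment Fs p w' \<subseteq> leaf_segment Fs p w"
    proof
      assume "leaf_segment Fs p w' \<subseteq> leaf_segment Fs p w"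
      then have "S.leaf_length (leaf_segment Fs p w') \<le> S.leaf_length (leaf_segment Fs p w)"
        by (intro S.leaf_length_mono) auto
      then show False using Len w Lpos[OF w(1)] by (simp add: ennreal_le_iff)
    qed
    ultimately show ?thesis by blast
  qed
  have aL: "a * L z0 < L z0" "a * (a * L z0) < a * L z0" using a Lpos[OF gz0] by simp_all
  have end_in: "w \<in> leaf_segment Fs p w" if w: "good w" for w
  proof -
    obtain k where k: "stable_arc p k" "k 1 = w" using w by (auto simp: good_def)
    show ?thesis using S.leaf_segment_eq[OF k(1) pP] k(2) by (auto simp: path_image_def)
  qed
  have seg0: "leaf_segment Fs p z0 = path_image g" using S.leaf_segment_eq[OF g(1) pP] g(2) by simp
  have "leaf_segment Fs p z2 \<subseteq> leaf_segment Fs p z0" using nested[OF gz2 gz0] Lz2 aL by simp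
  then have "z2 \<in> path_image g" using end_in[OF gz2] seg0 by blast
  then obtain \<tau> where \<tau>: "\<tau> \<in> {0..1}" "g \<tau> = z2" by (auto simp: path_image_def)
  have \<tau>0: "\<tau> > 0" using \<tau> S.F.leaf_arcD(2)[OF g(1)] goodD(2)[OF gz2] by (cases "\<tau> = 0") auto
  obtain h2 where h2: "unstable_arc q h2" "h2 1 = z2" "same_start h2 h" using gz2 by (auto simp: good_def)
  define C where "C = g ` {\<tau>..1}"
  define W where "W = path_image g \<inter> path_image h2 \<inter> C"
  have finW: "finite W" unfolding W_def
  proof (rule S.finite_intersection)
    show "arc g" "path_image g \<subseteq> leaf Fs p" "arc h2" "path_image h2 \<subseteq> leaf Fu q"
      using S.F.leaf_arcD[OF g(1)] S.G.leaf_arcD[OF h2(1)] by auto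
    show "compact C" unfolding C_def
      using \<tau>0 by (intro compact_continuous_image continuous_on_subset[OF arc_continuous[OF S.F.leaf_arcD(1)[OF g(1)]]]) auto
    show "C \<inter> singularities Fs = {}" unfolding C_def using S.leaf_arc_avoids[OF g(1) pP] \<tau>0 S.P(3) by force
  qed
  have inW: "w \<in> W" if w: "good w" "a * (a * L z0) < L w" "L w \<le> a * L z0" for w
  proof -
    have wz0: "leaf_segment Fs p w \<subseteq> path_image g" using nested[OF w(1) gz0] w(3) aL seg0 by simp
    then obtain t where t: "t \<in> {0..1}" "g t = w" using end_in[OF w(1)] by (auto simp: path_image_def)
    have t0: "t > 0" using t S.F.leaf_arcD(2)[OF g(1)] goodD(2)[OF w(1)] by (cases "t = 0") auto
    have segw: "leaf_segment Fs p w = g ` {0..t}" using S.leaf_segment_initial[OF g(1) pP, of t] t t0 by auto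
    have z2w: "z2 \<in> leaf_segment Fs p w" using nested[OF gz2 w(1)] Lz2 w(2) end_in[OF gz2] by auto
    then obtain s where s: "s \<in> {0..t}" "g s = z2" unfolding segw by auto
    have "s = \<tau>" using inj_onD[OF arc_inj[OF S.F.leaf_arcD(1)[OF g(1)]], of s \<tau>] s t \<tau> by auto
    then have wC: "w \<in> C" using s t by (auto simp: C_def)
    obtain h' where h': "unstable_arc q h'" "h' 1 = w" "same_start h' h" using w(1) by (auto simp: good_def)
    have segs: "leaf_segment Fu q w = path_image h'" "leaf_segment Fu q z2 = path_image h2"
      using U.leaf_segment_eq[OF h'(1) qP] U.leaf_segment_eq[OF h2(1) qP] h'(2) h2(2) by simp_all
    have "z2 \<noteq> w" using Lz2 w(2) by auto
    have "\<not> path_image h2 \<subseteq> path_image h'"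
    proof
      assume "path_image h2 \<subseteq> path_image h'"
      then have "z2 \<in> leaf_segment Fu q w" using h2(2) segs by (auto simp: path_image_def)
      then have "z2 \<in> (leaf_segment Fs p w - {p}) \<inter> (leaf_segment Fu q w - {q})"
        using z2w goodD(2,4)[OF gz2] by blast
      then show False using w(1) \<open>z2 \<noteq> w\<close> by (auto simp: good_def first_meeting_def)
    qed
    moreover have "same_start h' h2" using h'(3) h2(3) same_start_sym same_start_trans by blast
    ultimately have "path_image h' \<subseteq> path_image h2" using U.leaf_arcs_nested[OF h'(1) h2(1) qP] by blast
    then have "w \<in> path_image h2" using h'(2) by (auto simp: path_image_def)
    moreover have "w \<in> path_image g" using t by (auto simp: path_image_def)
    ultimately show ?thesis using wC by (simp add: W_def)
  qed
  have \<Phi>k: "(\<Phi> ^^ n) x = (f ^^ (m * n)) x" for n x unfolding \<Phi>_def by (simp add: funpow_mult)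
  have "(\<Phi> ^^ n) q = q" for n using q by (induction n) auto
  then have qk: "(f ^^ (m * n)) q = q" for n using \<Phi>k by metis
  show thesis
  proof (rule that[OF finW])
    fix z g' h'
    assume z: "first_meeting p q z" "stable_arc p g'" "g' 1 = z" "same_start g' g"
       "unstable_arc q h'" "h' 1 = z" "same_start h' h"
    then have gz: "good z" unfolding good_def by blast
    have "(\<exists>n. a * (a * L z0) < a ^ n * L z \<and> a ^ n * L z \<le> a * L z0) \<or>
          (\<exists>n. a * (a * L z0) < L z / a ^ n \<and> L z / a ^ n \<le> a * L z0)"
      using geometric_fundamental_domain[OF a Lpos[OF gz], of "a * L z0"] a Lpos[OF gz0] by simp
    then show "\<exists>w\<in>W. \<exists>k. (w = (f ^^ k) z \<or> z = (f ^^ k) w) \<and> (f ^^ k) q = q"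
    proof (elim disjE exE)
      fix n assume n: "a * (a * L z0) < a ^ n * L z \<and> a ^ n * L z \<le> a * L z0"
      have "(\<Phi> ^^ n) z \<in> W" using n good\<Phi>n gz L\<Phi>n[OF gz] by (intro inW) auto
      then show ?thesis using \<Phi>k qk by metis
    next
      fix n assume n: "a * (a * L z0) < L z / a ^ n \<and> L z / a ^ n \<le> a * L z0"
      obtain w where w: "(\<Phi> ^^ n) w = z" using \<Phi>k S.bij_iterate by (metis bij_pointE)
      then have gw: "good w" using good\<Phi>n gz by blast
      have "L w = L z / a ^ n" using L\<Phi>n[OF gw, of n] w a by simp
      then have "w \<in> W" using n gw by (intro inW) auto
      then show ?thesis using \<Phi>k qk w by metis
    qed
  qed
qed

text \<open>Triples are classified by their two points of \<open>P\<close> and the two prongs used, which leaves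
  finitely many classes.  The iterates of one triple repeat a class; this yields a power of \<open>f\<close>
  that fixes the points and the prongs, and a fundamental domain for the whole class.\<close>

theorem finitely_many_orbits:
  obtains W where "finite W"
    "\<And>p q z. first_meeting p q z \<Longrightarrow> \<exists>(q', w)\<in>W. \<exists>k. (q' = (f ^^ k) q \<and> w = (f ^^ k) z) \<or> (q = (f ^^ k) q' \<and> z = (f ^^ k) w)"
proof -
  obtain d D where D: "finite (D :: complex set)" "\<And>p g. p \<in> P \<Longrightarrow> stable_arc p g \<Longrightarrow> d p g \<in> D"
    and d: "\<And>p g h. stable_arc p g \<Longrightarrow> stable_arc p h \<Longrightarrow> d p g = d p h \<Longrightarrow> same_start g h"
    using S.finite_start_classes by metis
  obtain e E where E: "finite (E :: complex set)" "\<And>p g. p \<in> P \<Longrightarrow> unstable_arc p g \<Longrightarrow> e p g \<in> E"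
    and e: "\<And>p g h. unstable_arc p g \<Longrightarrow> unstable_arc p h \<Longrightarrow> e p g = e p h \<Longrightarrow> same_start g h"
    using U.finite_start_classes by metis
  define gs where "gs = (\<lambda>p z. SOME g. stable_arc p g \<and> g 1 = z)"
  define hu where "hu = (\<lambda>q z. SOME h. unstable_arc q h \<and> h 1 = z)"
  have gs: "stable_arc p (gs p z) \<and> gs p z 1 = z" and hu: "unstable_arc q (hu q z) \<and> hu q z 1 = z"
    if "first_meeting p q z" for p q z
  proof -
    have "z \<in> leaf Fs p" "z \<noteq> p" "z \<in> leaf Fu q" "z \<noteq> q" using that by (auto simp: first_meeting_def)
    then have ex: "\<exists>g. stable_arc p g \<and> g 1 = z" "\<exists>g. unstable_arc q g \<and> g 1 = z"
      using S.F.leaf_arc_exists S.G.leaf_arc_exists by metis+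
    show "stable_arc p (gs p z) \<and> gs p z 1 = z" unfolding gs_def by (rule someI_ex[OF ex(1)])
    show "unstable_arc q (hu q z) \<and> hu q z 1 = z" unfolding hu_def by (rule someI_ex[OF ex(2)])
  qed
  define \<kappa> where "\<kappa> = (\<lambda>(p, q, z). (p, q, d p (gs p z), e q (hu q z)))"
  define K where "K = P \<times> P \<times> D \<times> E"
  have finK: "finite K" using S.P(1) D(1) E(1) by (simp add: K_def)
  have \<kappa>K: "\<kappa> (p, q, z) \<in> K" if "first_meeting p q z" for p q z
    using that D(2) E(2) gs[OF that] hu[OF that] by (simp add: \<kappa>_def K_def first_meeting_def)
  have per_class: "\<exists>W. finite W \<and> (\<forall>p q z. first_meeting p q z \<and> \<kappa> (p, q, z) = y \<longrightarrow>
      (\<exists>(q', w)\<in>W. \<exists>k. (q' = (f ^^ k) q \<and> w = (f ^^ k) z) \<or> (q = (f ^^ k) q' \<and> z = (f ^^ k) w)))" for y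
  proof (cases "\<exists>p q z. first_meeting p q z \<and> \<kappa> (p, q, z) = y")
    case False
    then show ?thesis by (intro exI[of _ "{}"]) auto
  next
    case True
    then obtain p q z0 where z0: "first_meeting p q z0" "\<kappa> (p, q, z0) = y" by blast
    define g where "g = gs p z0"
    define h where "h = hu q z0"
    have g: "stable_arc p g" "g 1 = z0" and h: "unstable_arc q h" "h 1 = z0"
      using gs[OF z0(1)] hu[OF z0(1)] by (auto simp: g_def h_def)
    define \<kappa>' where "\<kappa>' = (\<lambda>i. \<kappa> ((f ^^ i) p, (f ^^ i) q, (f ^^ i) z0))"
    have fm: "first_meeting ((f ^^ i) p) ((f ^^ i) q) ((f ^^ i) z0)" for i
      using first_meeting_iterate z0(1) by blast
    have "range \<kappa>' \<subseteq> K" using \<kappa>K fm by (auto simp: \<kappa>'_def)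
    then have "finite (range \<kappa>')" using finK finite_subset by blast
    then obtain i j where ij: "i < j" "\<kappa>' i = \<kappa>' j"
      using finite_imageD[of \<kappa>' UNIV] by (metis inj_on_def infinite_UNIV_nat linorder_neqE_nat)
    define m where "m = j - i"
    have m: "m > 0" "j = i + m" using ij(1) by (auto simp: m_def)
    have fj: "(f ^^ j) x = (f ^^ i) ((f ^^ m) x)" for x by (simp add: m(2) funpow_add)
    have fi: "inj (f ^^ i)" using S.bij_iterate bij_is_inj by blast
    have pq: "(f ^^ m) p = p" "(f ^^ m) q = q"
      using ij(2) fj injD[OF fi] by (auto simp: \<kappa>'_def \<kappa>_def)
    have pP: "p \<in> P" "q \<in> P" using z0(1) by (auto simp: first_meeting_def)
    have pi: "(f ^^ j) p = (f ^^ i) p" "(f ^^ j) q = (f ^^ i) q" using fj pq by simp_all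
    have sg: "same_start ((f ^^ m) \<circ> g) g"
    proof (rule S.same_start_shift[OF g(1) pP(1) pq(1)])
      show arcs: "stable_arc ((f ^^ i) p) (gs ((f ^^ i) p) ((f ^^ i) z0))" "stable_arc ((f ^^ i) p) (gs ((f ^^ i) p) ((f ^^ j) z0))"
        "gs ((f ^^ i) p) ((f ^^ i) z0) 1 = (f ^^ i) (g 1)" "gs ((f ^^ i) p) ((f ^^ j) z0) 1 = (f ^^ (i + m)) (g 1)"
        using gs[OF fm[of i]] gs[OF fm[of j]] pi g(2) m(2) by auto
      show "same_start (gs ((f ^^ i) p) ((f ^^ i) z0)) (gs ((f ^^ i) p) ((f ^^ j) z0))"
        using d[OF arcs(1,2)] ij(2) pi by (simp add: \<kappa>'_def \<kappa>_def)
    qed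
    have sh: "same_start ((f ^^ m) \<circ> h) h"
    proof (rule U.same_start_shift[OF h(1) pP(2) pq(2)])
      show arcs: "unstable_arc ((f ^^ i) q) (hu ((f ^^ i) q) ((f ^^ i) z0))" "unstable_arc ((f ^^ i) q) (hu ((f ^^ i) q) ((f ^^ j) z0))"
        "hu ((f ^^ i) q) ((f ^^ i) z0) 1 = (f ^^ i) (h 1)" "hu ((f ^^ i) q) ((f ^^ j) z0) 1 = (f ^^ (i + m)) (h 1)"
        using hu[OF fm[of i]] hu[OF fm[of j]] pi h(2) m(2) by auto
      show "same_start (hu ((f ^^ i) q) ((f ^^ i) z0)) (hu ((f ^^ i) q) ((f ^^ j) z0))"
        using e[OF arcs(1,2)] ij(2) pi by (simp add: \<kappa>'_def \<kappa>_def)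
    qed
    obtain W where W: "finite W"
      "\<And>z g' h'. first_meeting p q z \<Longrightarrow> stable_arc p g' \<Longrightarrow> g' 1 = z \<Longrightarrow> same_start g' g \<Longrightarrow>
       unstable_arc q h' \<Longrightarrow> h' 1 = z \<Longrightarrow> same_start h' h \<Longrightarrow>
       \<exists>w\<in>W. \<exists>k. (w = (f ^^ k) z \<or> z = (f ^^ k) w) \<and> (f ^^ k) q = q"
      using finitely_many_in_fundamental_domain[OF m(1) z0(1) pq g h sg sh] by metis
    show ?thesis
    proof (intro exI[of _ "Pair q ` W"] conjI allI impI)
      show "finite (Pair q ` W)" using W(1) by simp
      fix p' q' z assume z: "first_meeting p' q' z \<and> \<kappa> (p', q', z) = y"
      then have eq: "p' = p" "q' = q" "d p (gs p z) = d p g" "e q (hu q z) = e q h"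
        using z0(2) by (auto simp: \<kappa>_def g_def h_def)
      then have fz: "first_meeting p q z" using z by simp
      have "same_start (gs p z) g" "same_start (hu q z) h"
        using d[OF _ g(1) eq(3)] e[OF _ h(1) eq(4)] gs[OF fz] hu[OF fz] by auto
      then obtain w k where wk: "w \<in> W" "w = (f ^^ k) z \<or> z = (f ^^ k) w" "(f ^^ k) q = q"
        using W(2)[OF fz] gs[OF fz] hu[OF fz] by blast
      show "\<exists>(q'', w)\<in>Pair q ` W. \<exists>k. (q'' = (f ^^ k) q' \<and> w = (f ^^ k) z) \<or> (q' = (f ^^ k) q'' \<and> z = (f ^^ k) w)"
      proof (rule bexI[of _ "(q, w)"])
        show "case (q, w) of (q'', w) \<Rightarrow> \<exists>k. (q'' = (f ^^ k) q' \<and> w = (f ^^ k) z) \<or> (q' = (f ^^ k) q'' \<and> z = (f ^^ k) w)"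
          unfolding eq prod.case using wk(2,3) by (intro exI[of _ k]) auto
      qed (use wk(1) in auto)
    qed
  qed
  have "\<exists>W. \<forall>y. finite (W y) \<and> (\<forall>p q z. first_meeting p q z \<and> \<kappa> (p, q, z) = y \<longrightarrow>
      (\<exists>(q', w)\<in>W y. \<exists>k. (q' = (f ^^ k) q \<and> w = (f ^^ k) z) \<or> (q = (f ^^ k) q' \<and> z = (f ^^ k) w)))"
    by (intro choice allI per_class)
  then obtain W where fin: "finite (W y)" and W: "first_meeting p q z \<and> \<kappa> (p, q, z) = y \<longrightarrow>
      (\<exists>(q', w)\<in>W y. \<exists>k. (q' = (f ^^ k) q \<and> w = (f ^^ k) z) \<or> (q = (f ^^ k) q' \<and> z = (f ^^ k) w))" for y p q z
    by blast
  show thesis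
  proof (rule that[of "\<Union>y\<in>K. W y"])
    show "finite (\<Union>y\<in>K. W y)" using finK fin by blast
    fix p q z assume fm: "first_meeting p q z"
    show "\<exists>(q', w)\<in>(\<Union>y\<in>K. W y). \<exists>k. (q' = (f ^^ k) q \<and> w = (f ^^ k) z) \<or> (q = (f ^^ k) q' \<and> z = (f ^^ k) w)"
      using W[of p q z "\<kappa> (p, q, z)"] fm \<kappa>K[OF fm] by blast
  qed
qed

end

section \<open>Strip counts bound geometric types\<close>

text \<open>The value of \<open>THE\<close> depends only on the predicate, whether or not it has a unique witness, and
  finitely many predicates have support in a given finite set.\<close>

lemma The_bounded:
  assumes "\<And>x. q x \<Longrightarrow> x \<in> X"
  shows "The q \<in> (\<lambda>Y. The (\<lambda>x. x \<in> Y)) ` Pow X"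
  using assms by (intro image_eqI[of _ _ "{x. q x}"]) auto

lemma dom_ran_total_restriction: "dom ((Some \<circ> h) |` S) = S" "ran ((Some \<circ> h) |` S) \<subseteq> h ` S"
  by (auto simp: ran_def restrict_map_def split: if_splits)

text \<open>A type is a tuple of numbers and of functions on index sets bounded by \<open>B\<close>; the values of
  \<open>\<rho>\<close> are controlled by \<open>The_bounded\<close>.\<close>

lemma finite_geometric_types:
  assumes B: "\<And>N D d. (N, D, d) \<in> \<R> \<Longrightarrow> N \<le> B \<and>
      (\<forall>i\<in>{1..N}. card (H_rects f N D i) \<le> B \<and> card (V_rects f N D i) \<le> B)"
  shows "finite (geometric_type A f Fs Fu ` \<R>)"
proof -
  define Q where "Q = {..B} \<times> {..B}"
  define HV where "HV = {xs :: (nat \<times> nat) list. set xs \<subseteq> Q \<and> length xs \<le> B}"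
  define TV where "TV = (\<lambda>Y. The (\<lambda>x :: nat \<times> nat. x \<in> Y)) ` Pow Q"
  define RM where "RM = (\<Union>S\<in>Pow Q. {m :: nat \<times> nat \<rightharpoonup> nat \<times> nat. dom m = S \<and> ran m \<subseteq> TV})"
  define EM where "EM = (\<Union>S\<in>Pow Q. {m :: nat \<times> nat \<rightharpoonup> int. dom m = S \<and> ran m \<subseteq> {1, - 1}})"
  have finQ: "finite Q" by (simp add: Q_def)
  have finS: "finite S" if "S \<in> Pow Q" for S using that finQ finite_subset by blast
  have "finite TV" using finQ by (simp add: TV_def)
  then have "finite RM" unfolding RM_def using finQ finS by (intro finite_UN_I finite_set_of_finite_maps) auto
  moreover have "finite EM" unfolding EM_def using finQ finS by (intro finite_UN_I finite_set_of_finite_maps) auto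
  moreover have "finite HV" unfolding HV_def using finQ by (rule finite_lists_length_le)
  ultimately have "finite ({..B} \<times> HV \<times> RM \<times> EM)" by simp
  moreover have "geometric_type A f Fs Fu ` \<R> \<subseteq> {..B} \<times> HV \<times> RM \<times> EM"
  proof (rule image_subsetI)
    fix R assume R: "R \<in> \<R>"
    obtain N D d where Req: "R = (N, D, d)" by (cases R)
    define h where "h = (\<lambda>i. card (H_rects f N D i))"
    define v where "v = (\<lambda>k. card (V_rects f N D k))"
    define \<rho> where "\<rho> = (\<lambda>(i, j). THE (k, l). k \<in> {1..N} \<and> l \<in> {1..v k} \<and> f ` H_rect f R i j = V_rect A f Fs Fu R k l)"
    define \<epsilon> where "\<epsilon> = (\<lambda>(i, j). if \<forall>x\<in>H_rect f R i j. \<forall>y\<in>H_rect f R i j. (x, y) \<in> d i \<longrightarrow> (f x, f y) \<in> d (fst (\<rho> (i, j)))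
        then 1 else - 1 :: int)"
    define S where "S = (SIGMA i:{1..N}. {1..h i})"
    have bd: "N \<le> B" "h i \<le> B" "v i \<le> B" if "i \<in> {1..N}" for i
      using B R that by (auto simp: Req h_def v_def)
    have N: "N \<le> B" using B R by (auto simp: Req)
    have gt: "geometric_type A f Fs Fu R = (N, map (\<lambda>i. (h i, v i)) [1..<Suc N], (Some \<circ> \<rho>) |` S, (Some \<circ> \<epsilon>) |` S)"
      unfolding geometric_type_def Req prod.case Let_def S_def \<epsilon>_def \<rho>_def h_def v_def by (rule refl)
    have "map (\<lambda>i. (h i, v i)) [1..<Suc N] \<in> HV" using bd N by (auto simp: HV_def Q_def)
    moreover have SQ: "S \<in> Pow Q" using bd N by (fastforce simp: S_def Q_def)
    moreover have "(Some \<circ> \<rho>) |` S \<in> RM"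
    proof -
      have "\<rho> x \<in> TV" for x
      proof (cases x)
        case (Pair i j)
        show ?thesis unfolding Pair \<rho>_def prod.case TV_def
          by (rule The_bounded) (use bd in \<open>fastforce simp: Q_def\<close>)
      qed
      then have "\<rho> ` S \<subseteq> TV" by blast
      then have "ran ((Some \<circ> \<rho>) |` S) \<subseteq> TV" using dom_ran_total_restriction(2) by (rule subset_trans[rotated])
      then show ?thesis unfolding RM_def using dom_ran_total_restriction(1) by (intro UN_I[OF SQ] CollectI conjI)
    qed
    moreover have "(Some \<circ> \<epsilon>) |` S \<in> EM"
    proof -
      have "\<epsilon> x \<in> {1, - 1}" for x by (cases x) (simp add: \<epsilon>_def)
      then have "\<epsilon> ` S \<subseteq> {1, - 1}" by blast
      then have "ran ((Some \<circ> \<epsilon>) |` S) \<subseteq> {1, - 1}" using dom_ran_total_restriction(2) by (rule subset_trans[rotated])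
      then show ?thesis unfolding EM_def using dom_ran_total_restriction(1) by (intro UN_I[OF SQ] CollectI conjI)
    qed
    ultimately show "geometric_type A f Fs Fu R \<in> {..B} \<times> HV \<times> RM \<times> EM" using N by (simp add: gt)
  qed
  ultimately show ?thesis using finite_subset by blast
qed

section \<open>Equivariance of the primitive partitions\<close>

context scaled_foliation
begin

lemma endpoints_f: "endpoints (f ` I) = f ` endpoints I"
proof (intro equalityI subsetI)
  fix x assume "x \<in> endpoints (f ` I)"
  then obtain g where g: "arc g" "path_image g = f ` I" "x = pathstart g" by (auto simp: endpoints_def)
  have "path_image (inv f \<circ> g) = I" using g(2) bij_f by (simp add: path_image_compose image_image bij_is_inj)
  then have "pathstart (inv f \<circ> g) \<in> endpoints I" using arc_inv_f[OF g(1)] by (auto simp: endpoints_def)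
  moreover have "x = f (pathstart (inv f \<circ> g))" using g(3) bij_f by (simp add: pathstart_def bij_is_surj surj_f_inv_f)
  ultimately show "x \<in> f ` endpoints I" by blast
next
  fix x assume "x \<in> f ` endpoints I"
  then obtain g where g: "arc g" "path_image g = I" "x = f (pathstart g)" by (auto simp: endpoints_def)
  then have "arc (f \<circ> g)" "path_image (f \<circ> g) = f ` I" "x = pathstart (f \<circ> g)"
    using arc_f by (auto simp: path_image_compose pathstart_def)
  then show "x \<in> endpoints (f ` I)" unfolding endpoints_def by blast
qed

lemma segments_to_f: "segments_to P F (f ` K) = (`) f ` segments_to P F K"
proof -
  note inj = bij_is_inj[OF bij_f]
  have iff: "f ` I \<in> segments_to P F (f ` K) \<longleftrightarrow> I \<in> segments_to P F K" for I
  proof -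
    have "leaf_interval F (f ` I) \<longleftrightarrow> leaf_interval F I" using leaf_interval_f leaf_interval_inv_f by blast
    moreover have "(\<exists>p\<in>P. \<exists>y\<in>f ` K. p \<noteq> y \<and> endpoints (f ` I) = {p, y}) \<longleftrightarrow> (\<exists>p\<in>P. \<exists>y\<in>K. p \<noteq> y \<and> endpoints I = {p, y})"
    proof -
      have "(\<exists>p\<in>P. \<exists>y\<in>f ` K. p \<noteq> y \<and> endpoints (f ` I) = {p, y}) \<longleftrightarrow>
          (\<exists>p\<in>f ` P. \<exists>y\<in>f ` K. p \<noteq> y \<and> f ` endpoints I = {p, y})" by (simp add: P(2) endpoints_f)
      also have "\<dots> \<longleftrightarrow> (\<exists>p\<in>P. \<exists>y\<in>K. f p \<noteq> f y \<and> f ` endpoints I = f ` {p, y})" by simp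
      also have "\<dots> \<longleftrightarrow> (\<exists>p\<in>P. \<exists>y\<in>K. p \<noteq> y \<and> endpoints I = {p, y})"
        using inj by (simp only: inj_image_eq_iff inj_eq)
      finally show ?thesis .
    qed
    moreover have "(f ` I - endpoints (f ` I)) \<inter> f ` K = f ` ((I - endpoints I) \<inter> K)"
      by (simp add: endpoints_f image_Int[OF inj] image_set_diff[OF inj])
    ultimately show ?thesis unfolding segments_to_def mem_Collect_eq by simp
  qed
  show ?thesis
  proof (intro equalityI subsetI)
    fix J assume J: "J \<in> segments_to P F (f ` K)"
    moreover have "J = f ` (inv f ` J)" using bij_f by (simp add: bij_is_surj image_f_inv_f)
    ultimately show "J \<in> (`) f ` segments_to P F K" using iff[of "inv f ` J"] by (metis imageI)
  qed (use iff in blast)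
qed

lemma components_f: "components (f ` X) = (`) f ` components X"
proof -
  have cc: "connected_component_set (f ` X) (f x) = f ` connected_component_set X x" for x
  proof (intro equalityI subsetI)
    fix y assume "y \<in> connected_component_set (f ` X) (f x)"
    then obtain T where T: "connected T" "T \<subseteq> f ` X" "f x \<in> T" "y \<in> T" by (auto simp: connected_component_def)
    have "connected (inv f ` T)" using T(1) continuous_inv_f by (intro connected_continuous_image)
    moreover have "inv f ` T \<subseteq> X" using T(2) bij_f by (auto simp: bij_is_inj)
    moreover have "x \<in> inv f ` T" using T(3) bij_f by (metis bij_inv_eq_iff imageI)
    ultimately have "inv f y \<in> connected_component_set X x" using T(4) by (auto simp: connected_component_def)
    moreover have "y = f (inv f y)" using bij_f by (simp add: bij_is_surj surj_f_inv_f)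
    ultimately show "y \<in> f ` connected_component_set X x" by (metis imageI)
  next
    fix y assume "y \<in> f ` connected_component_set X x"
    then obtain w T where T: "y = f w" "connected T" "T \<subseteq> X" "x \<in> T" "w \<in> T" by (auto simp: connected_component_def)
    have "connected (f ` T)" using T(2) continuous_f by (intro connected_continuous_image)
    moreover have "f ` T \<subseteq> f ` X" "f x \<in> f ` T" "y \<in> f ` T" using T by auto
    ultimately show "y \<in> connected_component_set (f ` X) (f x)" unfolding mem_Collect_eq connected_component_def by blast
  qed
  show ?thesis unfolding components_def by (simp add: image_image cc)
qed

text \<open>For the family of rectangles of a partition: their number and the numbers of horizontal and
  vertical strips.\<close>

definition strip_counts :: "'a set set \<Rightarrow> nat set" where
  "strip_counts \<C> = insert (card \<C>)
     ((\<lambda>D. card (\<Union>D'\<in>\<C>. components (D \<inter> f -` D'))) ` \<C> \<union>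
      (\<lambda>D. card (\<Union>D'\<in>\<C>. components (f ` D' \<inter> D))) ` \<C>)"

lemma strip_counts_f: "strip_counts ((`) f ` \<C>) = strip_counts \<C>"
proof -
  note inj = bij_is_inj[OF bij_f]
  have cI: "card ((`) f ` X) = card X" for X by (rule card_image) (simp add: inj inj_on_image inj_on_subset[OF inj] inj_on_def inj_image_eq_iff[OF inj])
  have r: "(\<Union>D'\<in>(`) f ` \<C>. components (f ` D \<inter> f -` D')) = (`) f ` (\<Union>D'\<in>\<C>. components (D \<inter> f -` D'))" for D
  proof -
    have "f ` D \<inter> f -` (f ` D') = f ` (D \<inter> f -` D')" for D'
      using bij_is_surj[OF bij_f] by (simp add: image_Int[OF inj] inj_vimage_image_eq[OF inj])
    then show ?thesis by (simp add: image_UN components_f)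
  qed
  have s: "(\<Union>D'\<in>(`) f ` \<C>. components (f ` D' \<inter> f ` D)) = (`) f ` (\<Union>D'\<in>\<C>. components (f ` D' \<inter> D))" for D
    by (simp add: image_UN components_f image_Int[OF inj, symmetric])
  show ?thesis unfolding strip_counts_def cI
      image_image[of "\<lambda>D. card (\<Union>D'\<in>(`) f ` \<C>. components (D \<inter> f -` D'))" "(`) f"]
      image_image[of "\<lambda>D. card (\<Union>D'\<in>(`) f ` \<C>. components (f ` D' \<inter> D))" "(`) f"] r s
    by (rule refl)
qed

end

context two_scaled_foliations
begin

definition pieces :: "nat \<Rightarrow> 'a \<Rightarrow> 'a \<Rightarrow> 'a set set" where
  "pieces n q z = components (UNIV - (\<Union>(delta_s f Fs Fu P q z) \<union> \<Union>(iterate_graph f n (delta_u f Fs Fu P q z))))"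

lemma pieces_f:
  assumes "q \<in> P" "z \<in> leaf Fu q" "z \<noteq> q"
  shows "pieces n (f q) (f z) = (`) f ` pieces n q z"
proof -
  note bij = S.bij_f
  have "J_u f Fu (f q) (f z) = f ` J_u f Fu q z"
  proof -
    have "(f ^^ i) -` (f ` X) = f ` ((f ^^ i) -` X)" for i X
    proof (intro equalityI subsetI)
      fix x assume x: "x \<in> (f ^^ i) -` (f ` X)"
      obtain y where y: "x = f y" using bij by (metis bij_pointE)
      then have "f ((f ^^ i) y) \<in> f ` X" using x by (simp add: funpow_swap1)
      then show "x \<in> f ` ((f ^^ i) -` X)" using y bij by (simp add: inj_image_mem_iff bij_is_inj)
    qed (auto simp: funpow_swap1[symmetric])
    then show ?thesis unfolding J_u_def U.leaf_segment_f[OF assms] by (simp add: image_UN)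
  qed
  then have ds: "delta_s f Fs Fu P (f q) (f z) = (`) f ` delta_s f Fs Fu P q z"
    unfolding delta_s_def by (simp add: S.segments_to_f)
  have Uf: "\<Union>((`) f ` \<X>) = f ` \<Union>\<X>" for \<X> by blast
  have du: "delta_u f Fs Fu P (f q) (f z) = (`) f ` delta_u f Fs Fu P q z"
    unfolding delta_u_def ds Uf by (rule U.segments_to_f)
  have it: "iterate_graph f n ((`) f ` \<X>) = (`) f ` iterate_graph f n \<X>" for \<X>
    unfolding iterate_graph_def by (simp add: image_image funpow_swap1)
  show ?thesis
    unfolding pieces_def ds du it Uf image_Un[symmetric] S.components_f[symmetric]
    using bij by (simp add: image_set_diff bij_is_inj bij_is_surj)
qed

lemma pieces_iterate:
  assumes "q \<in> P" "z \<in> leaf Fu q" "z \<noteq> q"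
  shows "S.strip_counts (pieces n ((f ^^ k) q) ((f ^^ k) z)) = S.strip_counts (pieces n q z)"
    "finite (pieces n ((f ^^ k) q) ((f ^^ k) z)) \<longleftrightarrow> finite (pieces n q z)"
proof -
  have inj: "inj f" using S.bij_f by (rule bij_is_inj)
  have mem: "(f ^^ k) q \<in> P \<and> (f ^^ k) z \<in> leaf Fu ((f ^^ k) q) \<and> (f ^^ k) z \<noteq> (f ^^ k) q" for k
    using assms S.P_f by (induction k) (auto simp: U.leaf_f inj_eq[OF inj])
  have st: "pieces n ((f ^^ Suc k) q) ((f ^^ Suc k) z) = (`) f ` pieces n ((f ^^ k) q) ((f ^^ k) z)" for k
    using pieces_f[of "(f ^^ k) q" "(f ^^ k) z" n] mem[of k] by simp
  show "S.strip_counts (pieces n ((f ^^ k) q) ((f ^^ k) z)) = S.strip_counts (pieces n q z)"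
    by (induction k) (simp_all only: st S.strip_counts_f funpow_0)
  have "finite ((`) f ` \<X>) \<longleftrightarrow> finite \<X>" for \<X>
    by (rule finite_image_iff) (simp add: inj_on_def inj_image_eq_iff[OF inj])
  then show "finite (pieces n ((f ^^ k) q) ((f ^^ k) z)) \<longleftrightarrow> finite (pieces n q z)"
    by (induction k) (simp_all only: st funpow_0)
qed

text \<open>Along an orbit the counts do not change, and there are finitely many orbits.\<close>

lemma bounded_strip_counts:
  obtains B where "\<And>p q z x. first_meeting p q z \<Longrightarrow> finite (pieces n q z) \<Longrightarrow> x \<in> S.strip_counts (pieces n q z) \<Longrightarrow> x \<le> B"
proof -
  obtain W where W: "finite W" "\<And>p q z. first_meeting p q z \<Longrightarrow>
      \<exists>(q', w)\<in>W. \<exists>k. (q' = (f ^^ k) q \<and> w = (f ^^ k) z) \<or> (q = (f ^^ k) q' \<and> z = (f ^^ k) w)"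
    using finitely_many_orbits by blast
  define X where "X = (\<Union>(q, w)\<in>{(q, w) \<in> W. finite (pieces n q w)}. S.strip_counts (pieces n q w))"
  have "finite X" unfolding X_def
  proof (rule finite_UN_I)
    show "finite {(q, w) \<in> W. finite (pieces n q w)}" by (rule finite_subset[OF _ W(1)]) auto
  qed (auto simp: S.strip_counts_def)
  have "x \<in> X" if fm: "first_meeting p q z" and fin: "finite (pieces n q z)" and x: "x \<in> S.strip_counts (pieces n q z)" for p q z x
  proof -
    obtain q' w k where w: "(q', w) \<in> W" "(q' = (f ^^ k) q \<and> w = (f ^^ k) z) \<or> (q = (f ^^ k) q' \<and> z = (f ^^ k) w)"
      using W(2)[OF fm] by blast
    have qz: "q \<in> P" "z \<in> leaf Fu q" "z \<noteq> q" using fm by (auto simp: first_meeting_def)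
    from w(2) have "S.strip_counts (pieces n q' w) = S.strip_counts (pieces n q z) \<and> finite (pieces n q' w)"
    proof
      assume "q' = (f ^^ k) q \<and> w = (f ^^ k) z"
      then show ?thesis using pieces_iterate[OF qz] fin by simp
    next
      assume e: "q = (f ^^ k) q' \<and> z = (f ^^ k) w"
      have "leaf Fu ((f ^^ k) q') = (f ^^ k) ` leaf Fu q'"
        by (induction k) (simp_all add: U.leaf_f image_image)
      then have "q' \<in> P" "w \<in> leaf Fu q'" "w \<noteq> q'"
        using e qz S.P_iterate S.bij_iterate[of k] by (auto simp: inj_image_mem_iff bij_is_inj)
      from pieces_iterate[OF this] show ?thesis using e fin by simp
    qed
    then show ?thesis using w(1) x unfolding X_def by blast
  qed
  then show thesis using that[of "Max X"] \<open>finite X\<close> Max_ge by blast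
qed

theorem finitely_many_primitive_types: "finite (primitive_types A f Fs Fu P n)"
proof -
  obtain B where B: "\<And>p q z x. first_meeting p q z \<Longrightarrow> finite (pieces n q z) \<Longrightarrow> x \<in> S.strip_counts (pieces n q z) \<Longrightarrow> x \<le> B"
    using bounded_strip_counts by blast
  show ?thesis unfolding primitive_types_def
  proof (rule finite_geometric_types)
    fix N D d assume "(N, D, d) \<in> primitive_partitions A f Fs Fu P n"
    then obtain p q z where fi: "first_intersection_point Fs Fu P p q z" and bij: "bij_betw D {1..N} (pieces n q z)"
      unfolding primitive_partitions_def pieces_def by blast
    have "first_meeting p q z"
      using fi path_component_subset[of "leaf Fs p - {p}"] path_component_subset[of "leaf Fu q - {q}"]
      unfolding first_intersection_point_def first_meeting_def separatrices_def by blast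
    moreover have fin: "finite (pieces n q z)" using bij bij_betw_finite by blast
    ultimately have le: "x \<le> B" if "x \<in> S.strip_counts (pieces n q z)" for x using B that by blast
    have im: "pieces n q z = D ` {1..N}" using bij by (simp add: bij_betw_def)
    have "N = card (pieces n q z)" using bij_betw_same_card[OF bij] by simp
    then have "N \<le> B" by (intro le) (simp add: S.strip_counts_def)
    moreover have "card (H_rects f N D i) \<le> B \<and> card (V_rects f N D i) \<le> B" if i: "i \<in> {1..N}" for i
    proof
      have "H_rects f N D i = (\<Union>D'\<in>pieces n q z. components (D i \<inter> f -` D'))"
        unfolding H_rects_def im by blast
      then show "card (H_rects f N D i) \<le> B" using i by (intro le) (auto simp: S.strip_counts_def im)
      have "V_rects f N D i = (\<Union>D'\<in>pieces n q z. components (f ` D' \<inter> D i))"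
        unfolding V_rects_def im by blast
      then show "card (V_rects f N D i) \<le> B" using i by (intro le) (auto simp: S.strip_counts_def im)
    qed
    ultimately show "N \<le> B \<and> (\<forall>i\<in>{1..N}. card (H_rects f N D i) \<le> B \<and> card (V_rects f N D i) \<le> B)" by blast
  qed
qed

end

section \<open>Generalized pseudo-Anosov homeomorphisms\<close>

text \<open>Rotating a joint chart twice by a right angle amounts to a change of sign.\<close>

lemma foliated_chart_minus:
  fixes F :: "'a::t2_space set set"
  assumes ch: "foliated_chart F 2 x U \<phi>" shows "foliated_chart F 2 x U (\<lambda>y. - \<phi> y)"
proof -
  note C = foliated_chartD[OF ch]
  show ?thesis
  proof (rule foliated_chartI[where \<chi>' = "\<lambda>w. inv_into U \<phi> (- w)"])
    show "continuous_on (ball 0 1) (\<lambda>w. inv_into U \<phi> (- w))"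
      by (intro continuous_on_compose2[OF C(7)] continuous_intros) auto
    show "plaque F U y = {w \<in> U. - \<phi> w \<in> prong_plaque 2 (- \<phi> y)}" if "y \<in> U" for y
      using C(12)[OF that] C(11)[OF that] by (auto simp: prong_plaque_2)
  qed (use C in \<open>auto intro: continuous_on_minus\<close>)
qed

lemma transverse_foliations_sym:
  fixes F G :: "'a::t2_space set set"
  assumes "transverse_foliations F G" shows "transverse_foliations G F"
  unfolding transverse_foliations_def
proof (intro conjI allI impI)
  have pr: "prongs F x k \<longleftrightarrow> prongs G x k" for x k using assms by (simp add: transverse_foliations_def)
  then show "prongs G x k \<longleftrightarrow> prongs F x k" for x k by simp
  fix x assume "x \<notin> singularities G"
  then have "x \<notin> singularities F" by (simp add: singularities_def pr)
  then obtain U \<phi> where U: "foliated_chart F 2 x U \<phi>" "foliated_chart G 2 x U (\<lambda>y. \<i> * \<phi> y)"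
    using assms by (auto simp: transverse_foliations_def)
  have "(\<lambda>y. \<i> * (\<i> * \<phi> y)) = (\<lambda>y. - \<phi> y)" by (simp add: fun_eq_iff flip: mult.assoc)
  then have "foliated_chart F 2 x U (\<lambda>y. \<i> * (\<i> * \<phi> y))" using foliated_chart_minus[OF U(1)] by simp
  then show "\<exists>U \<phi>. foliated_chart G 2 x U \<phi> \<and> foliated_chart F 2 x U (\<lambda>y. \<i> * \<phi> y)" using U(2) by blast
qed

text \<open>A chart at \<open>f x\<close> composed with \<open>f\<close> is a chart at \<open>x\<close>.\<close>

lemma prongs_homeomorphism:
  fixes F :: "'a::t2_space set set"
  assumes F: "singular_foliation F" and h: "homeomorphism UNIV UNIV f (inv f)" and fF: "(`) f ` F = F"
    and pr: "prongs F (f x) k"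
  shows "prongs F x k"
proof -
  interpret foliation F using F by unfold_locales
  have ff: "inv f (f y) = y" "f (inv f y) = y" for y using h by (auto simp: homeomorphism_def)
  have cf: "continuous_on X f" "continuous_on X (inv f)" for X
    using h continuous_on_subset unfolding homeomorphism_def by blast+
  have pf: "path (f \<circ> g)" "path (inv f \<circ> g)" if "path g" for g
    using that unfolding path_def by (auto intro: continuous_on_compose[OF _ cf(1)] continuous_on_compose[OF _ cf(2)] simp del: o_apply)
  have leaf_f: "leaf F (f y) = f ` leaf F y" for y
    by (rule leaf_unique) (use fF leaf_mem in_leaf in blast)+
  obtain V \<psi> where k: "k \<ge> 1" and ch: "foliated_chart F k (f x) V \<psi>" using pr by (auto simp: prongs_def)
  note C = foliated_chartD[OF ch]
  define U where "U = f -` V"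
  have "foliated_chart F k x U (\<psi> \<circ> f)"
  proof (rule foliated_chartI[where \<chi>' = "inv f \<circ> inv_into V \<psi>"])
    show "open U" unfolding U_def using C(1) cf(1) by (simp add: continuous_on_open_vimage open_vimage)
    show "continuous_on U (\<psi> \<circ> f)"
      by (intro continuous_on_compose cf continuous_on_subset[OF C(4)]) (auto simp: U_def)
    show "continuous_on (ball 0 1) (inv f \<circ> inv_into V \<psi>)"
      by (intro continuous_on_compose cf C(7))
    fix y assume y: "y \<in> U"
    have "w \<in> plaque F U y \<longleftrightarrow> f w \<in> plaque F V (f y)" for w
    proof
      assume "w \<in> plaque F U y"
      then obtain g where g: "path g" "path_image g \<subseteq> leaf F y \<inter> U" "pathstart g = y" "pathfinish g = w"
        by (auto simp: plaque_def path_component_def)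
      have "path (f \<circ> g)" using g(1) by (rule pf)
      moreover have "path_image (f \<circ> g) \<subseteq> leaf F (f y) \<inter> V"
        using g(2) by (auto simp: path_image_compose leaf_f U_def)
      ultimately show "f w \<in> plaque F V (f y)" unfolding plaque_def mem_Collect_eq path_component_def
        using g(3,4) by (intro exI[of _ "f \<circ> g"]) (simp add: pathstart_def pathfinish_def)
    next
      assume "f w \<in> plaque F V (f y)"
      then obtain g where g: "path g" "path_image g \<subseteq> leaf F (f y) \<inter> V" "pathstart g = f y" "pathfinish g = f w"
        by (auto simp: plaque_def path_component_def)
      have "path (inv f \<circ> g)" using g(1) by (rule pf)
      moreover have "path_image (inv f \<circ> g) \<subseteq> leaf F y \<inter> U"
        using g(2) by (auto simp: path_image_compose leaf_f U_def ff)
      ultimately show "w \<in> plaque F U y" unfolding plaque_def mem_Collect_eq path_component_def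
        using g(3,4) by (intro exI[of _ "inv f \<circ> g"]) (simp add: pathstart_def pathfinish_def ff)
    qed
    then show "plaque F U y = {w \<in> U. (\<psi> \<circ> f) w \<in> prong_plaque k ((\<psi> \<circ> f) y)}"
      using C(12)[of "f y"] y by (auto simp: U_def)
  qed (use C ff in \<open>auto simp: U_def\<close>)
  then show ?thesis using k by (auto simp: prongs_def)
qed

theorem theorem1:
  fixes A :: "('a::t2_space) atlas" and f :: "'a \<Rightarrow> 'a"
    and Fs Fu :: "'a set set" and P :: "'a set"
  assumes "closed_oriented_surface A"
    and "generalized_pseudo_Anosov A f Fs Fu"
    and "Sing_set f Fs P"
  shows "\<forall>n > compatibility_order A f Fs Fu P. finite (primitive_types A f Fs Fu P n)"
proof -
  from assms(2)[unfolded generalized_pseudo_Anosov_def, THEN conjunct2]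
  obtain \<mu>s \<mu>u and stretch :: real where pA:
     "measured_foliation A Fs \<mu>s \<and> measured_foliation A Fu \<mu>u \<and>
        transverse_foliations Fs Fu \<and>
        (`) f ` Fs = Fs \<and> (`) f ` Fu = Fu \<and> stretch > 1 \<and>
        (\<forall>J. leaf_interval Fu J \<and> J \<inter> singularities Fu = {} \<longrightarrow>
           \<mu>s (f ` J) = ennreal stretch * \<mu>s J) \<and>
        (\<forall>I. leaf_interval Fs I \<and> I \<inter> singularities Fs = {} \<longrightarrow>
           \<mu>u (f ` I) = ennreal (inverse stretch) * \<mu>u I)"
    by (elim exE) (rule that)
  have h: "homeomorphism UNIV UNIV f (inv f)"
    using assms(2) unfolding generalized_pseudo_Anosov_def orientation_preserving_homeo_def by (elim conjE)
  have m: "measured_foliation A Fs \<mu>s" "measured_foliation A Fu \<mu>u" and t: "transverse_foliations Fs Fu"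
    and im: "(`) f ` Fs = Fs" "(`) f ` Fu = Fu" and st: "stretch > 1"
    using pA by simp_all
  have sc: "leaf_interval Fu J \<Longrightarrow> J \<inter> singularities Fu = {} \<Longrightarrow> \<mu>s (f ` J) = ennreal stretch * \<mu>s J"
    "leaf_interval Fs J \<Longrightarrow> J \<inter> singularities Fs = {} \<Longrightarrow> \<mu>u (f ` J) = ennreal (inverse stretch) * \<mu>u J" for J
    using pA by simp_all
  have fol: "singular_foliation Fs" "singular_foliation Fu" using m by (auto simp: measured_foliation_def)
  have inj: "inj f" using h by (intro inj_on_inverseI[of _ "inv f"]) (auto simp: homeomorphism_def)
  have sing: "singularities Fu = singularities Fs" using t by (simp add: singularities_def transverse_foliations_def)
  have finS: "finite (singularities Fs)" using fol(1) by (simp add: singular_foliation_def)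
  have "f ` singularities Fs \<subseteq> singularities Fs"
    using prongs_homeomorphism[OF fol(1) h im(1)] by (auto simp: singularities_def)
  then have "f ` singularities Fs = singularities Fs"
    using finS inj by (intro endo_inj_surj) (auto intro: inj_on_subset)
  then have P: "finite P" "f ` P = P" "singularities Fs \<subseteq> P"
    using assms(3) finS by (auto simp: Sing_set_def split: if_splits)
  interpret two_scaled_foliations Fs Fu A \<mu>s \<mu>u f P "inverse stretch" stretch
    by unfold_locales
      (use h m t transverse_foliations_sym[OF t] im st sc fol P sing in \<open>auto simp: inverse_eq_divide\<close>)
  show ?thesis using finitely_many_primitive_types by blast
qed

end
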